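(* Let $\phi:M\to N$ be a Poisson map between Poisson manifolds. The class $\mathrm{mod}(\phi)\in H^1_\pi(\phi)$ is the obstruction to the existence of volume forms $\mu\in\Omega^{\mathrm{top}}(M)$ and $\nu\in\Omega^{\mathrm{top}}(N)$ such that the modular vector fields $X_\mu$ and $X_\nu$ are $\phi$-related; that is, $\mathrm{mod}(\phi)=0$ if and only if there exist volume forms $\mu$ on $M$ and $\nu$ on $N$ with $\mathrm{d}\phi\cdot X_\mu=X_\nu\circ\phi$.
   Context: All manifolds are smooth and assumed orientable. For a Poisson manifold $(M,\pi)$: $\pi(\mathrm{d}f,\mathrm{d}g)=\{f,g\}$, $\pi^\sharp(\mathrm{d}h)=X_h:=\{h,\cdot\}$; $T^*M$ is a Lie algebroid with anchor $\pi^\sharp$ and bracket $[\alpha,\beta]_\pi=\mathcal{L}_{\pi^\sharp\alpha}\beta-\mathcal{L}_{\pi^\sharp\beta}\alpha-\mathrm{d}\pi(\alpha,\beta)$. For a volume form $\mu$, the modular vector field $X_\mu$ is defined by $\mathcal{L}_{X_f}\mu=X_\mu(f)\mu$ for all $f\in C^\infty(M)$. For a Poisson map $\phi:(M,\pi_M)\to(N,\pi_N)$, the bundle $\phi^*T^*N\to M$ is a Lie algebroid, with structure determined by $[\phi^*\alpha,\phi^*\beta]=\phi^*[\alpha,\beta]_{\pi_N}$ and $\rho(\phi^*\alpha)=\pi_M^\sharp(\phi^*\alpha)$ for $\alpha,\beta\in\Omega^1(N)$. Its Lie algebroid cohomology is denoted $H^\bullet_\pi(\phi)$; $k$-cochains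 are $k$-vector fields along $\phi$, i.e. sections of $\wedge^k\phi^*TN$. The differential of $h\in C^\infty(M)$ is $-\mathrm{d}\phi\cdot X_h$. The modular class of $\phi$ is the class $\mathrm{mod}(\phi)\in H^1_\pi(\phi)$ represented by $X_{\mu,\nu}=\mathrm{d}\phi\cdot X_\mu-X_\nu\circ\phi$, for any volume forms $\mu$ on $M$ and $\nu$ on $N$; it does not depend on $\mu,\nu$. *)

theory Defs
  imports "HOL-Analysis.Analysis"
begin

section \<open>Smooth manifolds\<close>

text \<open>
  Charts take values in a linear subspace of a Euclidean space and have relatively open images, so
  that manifolds of dimension 0 are covered as well.  This is why derivatives are taken
  within \<^term>\<open>S\<close>.  On a relatively open subset of a subspace only the values of \<^term>\<open>f'\<close> on
  directions of that subspace are determined; the existential quantifier leaves the other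
  directions free.
\<close>

primrec cont_diff_on ::
    "nat \<Rightarrow> 'e::euclidean_space set \<Rightarrow> ('e \<Rightarrow> 'f::real_normed_vector) \<Rightarrow> bool" where
  "cont_diff_on 0 S f \<longleftrightarrow> continuous_on S f"
| "cont_diff_on (Suc k) S f \<longleftrightarrow>
     (\<exists>f'. (\<forall>x\<in>S. (f has_derivative f' x) (at x within S)) \<and>
           (\<forall>v. cont_diff_on k S (\<lambda>x. f' x v)))"

definition smooth_on :: "'e::euclidean_space set \<Rightarrow> ('e \<Rightarrow> 'f::real_normed_vector) \<Rightarrow> bool" where
  "smooth_on S f \<longleftrightarrow> (\<forall>k. cont_diff_on k S f)"

record ('a, 'e) manifold =
  model :: "'e set"
  charts :: "('a set \<times> ('a \<Rightarrow> 'e)) set"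

definition smooth_manifold ::
    "('a::{t2_space,second_countable_topology}, 'e::euclidean_space) manifold \<Rightarrow> bool" where
  "smooth_manifold M \<longleftrightarrow>
     subspace (model M) \<and>
     (\<Union>(U, c)\<in>charts M. U) = UNIV \<and>
     (\<forall>(U, c)\<in>charts M.
        open U \<and> openin (top_of_set (model M)) (c ` U) \<and>
        homeomorphism U (c ` U) c (inv_into U c)) \<and>
     (\<forall>(U, c)\<in>charts M. \<forall>(W, d)\<in>charts M. smooth_on (c ` (U \<inter> W)) (d \<circ> inv_into U c))"

definition mdim :: "('a, 'e::euclidean_space) manifold \<Rightarrow> nat" where
  "mdim M = dim (model M)"

definition smooth_functions :: "('a, 'e::euclidean_space) manifold \<Rightarrow> ('a \<Rightarrow> real) set" where
  "smooth_functions M = {f. \<forall>(U, c)\<in>charts M. smooth_on (c ` U) (f \<circ> inv_into U c)}"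

definition smooth_map ::
    "('a::topological_space, 'e::euclidean_space) manifold \<Rightarrow>
     ('b::topological_space, 'f::euclidean_space) manifold \<Rightarrow> ('a \<Rightarrow> 'b) \<Rightarrow> bool" where
  "smooth_map M N \<phi> \<longleftrightarrow>
     continuous_on UNIV \<phi> \<and>
     (\<forall>(U, c)\<in>charts M. \<forall>(W, d)\<in>charts N.
        smooth_on (c ` (U \<inter> \<phi> -` W)) (d \<circ> \<phi> \<circ> inv_into U c))"

section \<open>Tangent and cotangent vectors, vector fields and forms\<close>

text \<open>
  Tangent vectors are derivations of the algebra of smooth functions at a point.  They are
  normalised to vanish on non-smooth functions, and covectors to vanish off the tangent space,
  so that equality of the HOL functions is equality of (co)vectors.
\<close>

type_synonym 'a tangent = "('a \<Rightarrow> real) \<Rightarrow> real"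
type_synonym 'a cotangent = "'a tangent \<Rightarrow> real"

definition tangent_space :: "('a, 'e::euclidean_space) manifold \<Rightarrow> 'a \<Rightarrow> 'a tangent set" where
  "tangent_space M x =
     {v. (\<forall>f. f \<notin> smooth_functions M \<longrightarrow> v f = 0) \<and>
         (\<forall>f\<in>smooth_functions M. \<forall>g\<in>smooth_functions M. \<forall>a b.
            v (\<lambda>y. a * f y + b * g y) = a * v f + b * v g) \<and>
         (\<forall>f\<in>smooth_functions M. \<forall>g\<in>smooth_functions M.
            v (\<lambda>y. f y * g y) = f x * v g + g x * v f)}"

definition cotangent_space :: "('a, 'e::euclidean_space) manifold \<Rightarrow> 'a \<Rightarrow> 'a cotangent set" where
  "cotangent_space M x =
     {\<xi>. (\<forall>v. v \<notin> tangent_space M x \<longrightarrow> \<xi> v = 0) \<and>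
          (\<forall>v\<in>tangent_space M x. \<forall>w\<in>tangent_space M x. \<forall>a b.
             \<xi> (\<lambda>f. a * v f + b * w f) = a * \<xi> v + b * \<xi> w)}"

definition differential ::
    "('a, 'e::euclidean_space) manifold \<Rightarrow> ('a \<Rightarrow> real) \<Rightarrow> 'a \<Rightarrow> 'a cotangent" where
  "differential M f x v = (if v \<in> tangent_space M x then v f else 0)"

definition tangent_map ::
    "('b, 'f::euclidean_space) manifold \<Rightarrow> ('a \<Rightarrow> 'b) \<Rightarrow> 'a tangent \<Rightarrow> 'b tangent" where
  "tangent_map N \<phi> v f = (if f \<in> smooth_functions N then v (f \<circ> \<phi>) else 0)"

definition cotangent_map ::
    "('a, 'e::euclidean_space) manifold \<Rightarrow> ('b, 'f::euclidean_space) manifold \<Rightarrow>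
     ('a \<Rightarrow> 'b) \<Rightarrow> 'a \<Rightarrow> 'b cotangent \<Rightarrow> 'a cotangent" where
  "cotangent_map M N \<phi> x \<xi> v = (if v \<in> tangent_space M x then \<xi> (tangent_map N \<phi> v) else 0)"

text \<open>Sections of \<open>\<phi>\<^sup>*TN\<close>; smoothness is tested by letting them act on smooth functions of \<open>N\<close>.\<close>

definition vector_fields_along ::
    "('a, 'e::euclidean_space) manifold \<Rightarrow> ('b, 'f::euclidean_space) manifold \<Rightarrow>
     ('a \<Rightarrow> 'b) \<Rightarrow> ('a \<Rightarrow> 'b tangent) set" where
  "vector_fields_along M N \<phi> =
     {X. (\<forall>x. X x \<in> tangent_space N (\<phi> x)) \<and>
         (\<forall>f\<in>smooth_functions N. (\<lambda>x. X x f) \<in> smooth_functions M)}"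

abbreviation vector_fields :: "('a, 'e::euclidean_space) manifold \<Rightarrow> ('a \<Rightarrow> 'a tangent) set" where
  "vector_fields M \<equiv> vector_fields_along M M id"

text \<open>
  Sections of \<open>\<phi>\<^sup>*T\<^sup>*N\<close>; smoothness is tested on pullbacks of global vector fields of \<open>N\<close>, which
  contain local frames of \<open>\<phi>\<^sup>*TN\<close> near every point.
\<close>

definition one_forms_along ::
    "('a, 'e::euclidean_space) manifold \<Rightarrow> ('b, 'f::euclidean_space) manifold \<Rightarrow>
     ('a \<Rightarrow> 'b) \<Rightarrow> ('a \<Rightarrow> 'b cotangent) set" where
  "one_forms_along M N \<phi> =
     {s. (\<forall>x. s x \<in> cotangent_space N (\<phi> x)) \<and>
         (\<forall>Y\<in>vector_fields N. (\<lambda>x. s x (Y (\<phi> x))) \<in> smooth_functions M)}"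

abbreviation one_forms :: "('a, 'e::euclidean_space) manifold \<Rightarrow> ('a \<Rightarrow> 'a cotangent) set" where
  "one_forms M \<equiv> one_forms_along M M id"

definition lie_bracket ::
    "('a, 'e::euclidean_space) manifold \<Rightarrow> ('a \<Rightarrow> 'a tangent) \<Rightarrow> ('a \<Rightarrow> 'a tangent) \<Rightarrow>
     'a \<Rightarrow> 'a tangent" where
  "lie_bracket M X Y x f =
     (if f \<in> smooth_functions M then X x (\<lambda>y. Y y f) - Y x (\<lambda>y. X y f) else 0)"

text \<open>\<open>(L\<^sub>X \<alpha>)(Y)\<close> at \<^term>\<open>x\<close>, for a one-form \<open>\<alpha>\<close> and vector fields \<open>X\<close>, \<open>Y\<close>.\<close>

definition lie_derivative_one_form ::
    "('a, 'e::euclidean_space) manifold \<Rightarrow> ('a \<Rightarrow> 'a tangent) \<Rightarrow> ('a \<Rightarrow> 'a cotangent) \<Rightarrow>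
     ('a \<Rightarrow> 'a tangent) \<Rightarrow> 'a \<Rightarrow> real" where
  "lie_derivative_one_form M X \<alpha> Y x = X x (\<lambda>y. \<alpha> y (Y y)) - \<alpha> x (lie_bracket M X Y x)"

section \<open>Volume forms\<close>

text \<open>A \<open>k\<close>-form is evaluated on a sequence of vectors, of which only the first \<open>k\<close> entries matter.\<close>

definition alternating_form ::
    "('a, 'e::euclidean_space) manifold \<Rightarrow> nat \<Rightarrow> 'a \<Rightarrow> ((nat \<Rightarrow> 'a tangent) \<Rightarrow> real) \<Rightarrow> bool" where
  "alternating_form M k x \<omega> \<longleftrightarrow>
     (\<forall>v w. (\<forall>i<k. v i = w i) \<longrightarrow> \<omega> v = \<omega> w) \<and>
     (\<forall>v. (\<forall>i<k. v i \<in> tangent_space M x) \<longrightarrow>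
        (\<forall>i<k. \<forall>u\<in>tangent_space M x. \<forall>w\<in>tangent_space M x. \<forall>a b.
           \<omega> (v(i := (\<lambda>f. a * u f + b * w f))) = a * \<omega> (v(i := u)) + b * \<omega> (v(i := w))) \<and>
        (\<forall>j<k. \<forall>i<j. v i = v j \<longrightarrow> \<omega> v = 0))"

definition differential_forms ::
    "('a, 'e::euclidean_space) manifold \<Rightarrow> nat \<Rightarrow> ('a \<Rightarrow> (nat \<Rightarrow> 'a tangent) \<Rightarrow> real) set" where
  "differential_forms M k =
     {\<omega>. (\<forall>x. alternating_form M k x (\<omega> x)) \<and>
          (\<forall>Y. (\<forall>i<k. Y i \<in> vector_fields M) \<longrightarrow>
             (\<lambda>x. \<omega> x (\<lambda>i. Y i x)) \<in> smooth_functions M)}"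

definition volume_forms ::
    "('a, 'e::euclidean_space) manifold \<Rightarrow> ('a \<Rightarrow> (nat \<Rightarrow> 'a tangent) \<Rightarrow> real) set" where
  "volume_forms M =
     {\<mu> \<in> differential_forms M (mdim M).
        \<forall>x. \<exists>v. (\<forall>i<mdim M. v i \<in> tangent_space M x) \<and> \<mu> x v \<noteq> 0}"

definition orientable_manifold :: "('a, 'e::euclidean_space) manifold \<Rightarrow> bool" where
  "orientable_manifold M \<longleftrightarrow> volume_forms M \<noteq> {}"

text \<open>\<open>(L\<^sub>X \<omega>)(Y\<^sub>0, \<dots>, Y\<^sub>k\<^sub>-\<^sub>1)\<close> at \<^term>\<open>x\<close>, for a \<open>k\<close>-form \<open>\<omega>\<close> and vector fields \<open>X\<close>, \<open>Y\<^sub>i\<close>.\<close>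

definition lie_derivative_form ::
    "('a, 'e::euclidean_space) manifold \<Rightarrow> nat \<Rightarrow> ('a \<Rightarrow> 'a tangent) \<Rightarrow>
     ('a \<Rightarrow> (nat \<Rightarrow> 'a tangent) \<Rightarrow> real) \<Rightarrow> (nat \<Rightarrow> 'a \<Rightarrow> 'a tangent) \<Rightarrow> 'a \<Rightarrow> real" where
  "lie_derivative_form M k X \<omega> Y x =
     X x (\<lambda>y. \<omega> y (\<lambda>i. Y i y)) -
     (\<Sum>i<k. \<omega> x ((\<lambda>j. Y j x)(i := lie_bracket M X (Y i) x)))"

section \<open>Poisson manifolds and Poisson maps\<close>

type_synonym 'a bivector_field = "'a \<Rightarrow> 'a cotangent \<Rightarrow> 'a cotangent \<Rightarrow> real"

definition bivector_fields :: "('a, 'e::euclidean_space) manifold \<Rightarrow> 'a bivector_field set" where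
  "bivector_fields M =
     {\<pi>. (\<forall>x. \<forall>\<xi>\<in>cotangent_space M x. \<forall>\<eta>\<in>cotangent_space M x. \<forall>\<zeta>\<in>cotangent_space M x. \<forall>a b.
            \<pi> x (\<lambda>v. a * \<xi> v + b * \<eta> v) \<zeta> = a * \<pi> x \<xi> \<zeta> + b * \<pi> x \<eta> \<zeta> \<and>
            \<pi> x \<xi> \<eta> = - \<pi> x \<eta> \<xi>) \<and>
          (\<forall>\<alpha>\<in>one_forms M. \<forall>\<beta>\<in>one_forms M. (\<lambda>x. \<pi> x (\<alpha> x) (\<beta> x)) \<in> smooth_functions M)}"

definition poisson_bracket ::
    "('a, 'e::euclidean_space) manifold \<Rightarrow> 'a bivector_field \<Rightarrow>
     ('a \<Rightarrow> real) \<Rightarrow> ('a \<Rightarrow> real) \<Rightarrow> 'a \<Rightarrow> real" where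
  "poisson_bracket M \<pi> f g x = \<pi> x (differential M f x) (differential M g x)"

definition poisson_manifold ::
    "('a::{t2_space,second_countable_topology}, 'e::euclidean_space) manifold \<Rightarrow>
     'a bivector_field \<Rightarrow> bool" where
  "poisson_manifold M \<pi> \<longleftrightarrow>
     smooth_manifold M \<and> \<pi> \<in> bivector_fields M \<and>
     (\<forall>f\<in>smooth_functions M. \<forall>g\<in>smooth_functions M. \<forall>h\<in>smooth_functions M. \<forall>x.
        poisson_bracket M \<pi> f (poisson_bracket M \<pi> g h) x +
        poisson_bracket M \<pi> g (poisson_bracket M \<pi> h f) x +
        poisson_bracket M \<pi> h (poisson_bracket M \<pi> f g) x = 0)"

definition poisson_map ::
    "('a::topological_space, 'e::euclidean_space) manifold \<Rightarrow> 'a bivector_field \<Rightarrow>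
     ('b::topological_space, 'f::euclidean_space) manifold \<Rightarrow> 'b bivector_field \<Rightarrow>
     ('a \<Rightarrow> 'b) \<Rightarrow> bool" where
  "poisson_map M \<pi>\<^sub>M N \<pi>\<^sub>N \<phi> \<longleftrightarrow>
     smooth_map M N \<phi> \<and>
     (\<forall>f\<in>smooth_functions N. \<forall>g\<in>smooth_functions N.
        poisson_bracket M \<pi>\<^sub>M (f \<circ> \<phi>) (g \<circ> \<phi>) = poisson_bracket N \<pi>\<^sub>N f g \<circ> \<phi>)"

text \<open>The map \<open>\<pi>\<^sup>\<sharp>\<close>, with the sign convention \<open>\<eta>(\<pi>\<^sup>\<sharp> \<xi>) = \<pi>(\<xi>, \<eta>)\<close>.\<close>

definition sharp ::
    "('a, 'e::euclidean_space) manifold \<Rightarrow> 'a bivector_field \<Rightarrow> 'a \<Rightarrow> 'a cotangent \<Rightarrow> 'a tangent" where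
  "sharp M \<pi> x \<xi> f = (if f \<in> smooth_functions M then \<pi> x \<xi> (differential M f x) else 0)"

definition hamiltonian ::
    "('a, 'e::euclidean_space) manifold \<Rightarrow> 'a bivector_field \<Rightarrow> ('a \<Rightarrow> real) \<Rightarrow> 'a \<Rightarrow> 'a tangent" where
  "hamiltonian M \<pi> h x = sharp M \<pi> x (differential M h x)"

definition modular_vector_field ::
    "('a, 'e::euclidean_space) manifold \<Rightarrow> 'a bivector_field \<Rightarrow>
     ('a \<Rightarrow> (nat \<Rightarrow> 'a tangent) \<Rightarrow> real) \<Rightarrow> 'a \<Rightarrow> 'a tangent" where
  "modular_vector_field M \<pi> \<mu> =
     (THE X. X \<in> vector_fields M \<and>
        (\<forall>f\<in>smooth_functions M. \<forall>Y. (\<forall>i<mdim M. Y i \<in> vector_fields M) \<longrightarrow>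
           (\<forall>x. lie_derivative_form M (mdim M) (hamiltonian M \<pi> f) \<mu> Y x =
                X x f * \<mu> x (\<lambda>i. Y i x))))"

section \<open>The Lie algebroid of a Poisson map and its first cohomology\<close>

text \<open>
  The bracket \<open>[\<alpha>, \<beta>]\<^sub>\<pi> = L\<^bsub>\<pi>\<^sup>\<sharp>\<alpha>\<^esub> \<beta> - L\<^bsub>\<pi>\<^sup>\<sharp>\<beta>\<^esub> \<alpha> - d \<pi>(\<alpha>, \<beta>)\<close>, given by its values on vector fields.
\<close>

definition cotangent_bracket ::
    "('b, 'f::euclidean_space) manifold \<Rightarrow> 'b bivector_field \<Rightarrow>
     ('b \<Rightarrow> 'b cotangent) \<Rightarrow> ('b \<Rightarrow> 'b cotangent) \<Rightarrow> 'b \<Rightarrow> 'b cotangent" where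
  "cotangent_bracket N \<pi> \<alpha> \<beta> =
     (THE \<gamma>. \<gamma> \<in> one_forms N \<and>
        (\<forall>Y\<in>vector_fields N. \<forall>y.
           \<gamma> y (Y y) = lie_derivative_one_form N (\<lambda>z. sharp N \<pi> z (\<alpha> z)) \<beta> Y y
                     - lie_derivative_one_form N (\<lambda>z. sharp N \<pi> z (\<beta> z)) \<alpha> Y y
                     - Y y (\<lambda>z. \<pi> z (\<alpha> z) (\<beta> z))))"

text \<open>
  The anchor \<open>\<rho>\<close> of \<open>\<phi>\<^sup>*T\<^sup>*N\<close> at \<^term>\<open>x\<close>.  A pulled-back form \<open>\<phi>\<^sup>*\<alpha>\<close>, viewed as a section of
  \<open>\<phi>\<^sup>*T\<^sup>*N\<close>, is \<open>\<alpha> \<circ> \<phi>\<close>; applying \<^const>\<open>cotangent_map\<close> to it gives the pulled-back one-form on \<open>M\<close>.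
\<close>

definition anchor ::
    "('a, 'e::euclidean_space) manifold \<Rightarrow> 'a bivector_field \<Rightarrow>
     ('b, 'f::euclidean_space) manifold \<Rightarrow> ('a \<Rightarrow> 'b) \<Rightarrow> 'a \<Rightarrow> 'b cotangent \<Rightarrow> 'a tangent" where
  "anchor M \<pi>\<^sub>M N \<phi> x \<xi> = sharp M \<pi>\<^sub>M x (cotangent_map M N \<phi> x \<xi>)"

definition is_pullback_bracket ::
    "('a, 'e::euclidean_space) manifold \<Rightarrow> 'a bivector_field \<Rightarrow>
     ('b, 'f::euclidean_space) manifold \<Rightarrow> 'b bivector_field \<Rightarrow> ('a \<Rightarrow> 'b) \<Rightarrow>
     (('a \<Rightarrow> 'b cotangent) \<Rightarrow> ('a \<Rightarrow> 'b cotangent) \<Rightarrow> 'a \<Rightarrow> 'b cotangent) \<Rightarrow> bool" where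
  "is_pullback_bracket M \<pi>\<^sub>M N \<pi>\<^sub>N \<phi> B \<longleftrightarrow>
     (\<forall>s\<in>one_forms_along M N \<phi>. \<forall>t\<in>one_forms_along M N \<phi>.
        B s t \<in> one_forms_along M N \<phi> \<and>
        B s t = (\<lambda>x v. - B t s x v) \<and>
        (\<forall>u\<in>one_forms_along M N \<phi>. \<forall>a b.
           B (\<lambda>x v. a * s x v + b * t x v) u = (\<lambda>x v. a * B s u x v + b * B t u x v)) \<and>
        (\<forall>u\<in>one_forms_along M N \<phi>. \<forall>x v.
           B s (B t u) x v + B t (B u s) x v + B u (B s t) x v = 0) \<and>
        (\<forall>f\<in>smooth_functions M.
           B s (\<lambda>x v. f x * t x v) =
             (\<lambda>x v. f x * B s t x v + anchor M \<pi>\<^sub>M N \<phi> x (s x) f * t x v))) \<and>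
     (\<forall>\<alpha>\<in>one_forms N. \<forall>\<beta>\<in>one_forms N.
        B (\<alpha> \<circ> \<phi>) (\<beta> \<circ> \<phi>) = cotangent_bracket N \<pi>\<^sub>N \<alpha> \<beta> \<circ> \<phi>)"

definition coboundary0 ::
    "('a, 'e::euclidean_space) manifold \<Rightarrow> 'a bivector_field \<Rightarrow>
     ('b, 'f::euclidean_space) manifold \<Rightarrow> ('a \<Rightarrow> 'b) \<Rightarrow> ('a \<Rightarrow> real) \<Rightarrow> 'a \<Rightarrow> 'b tangent" where
  "coboundary0 M \<pi>\<^sub>M N \<phi> h x f = - tangent_map N \<phi> (hamiltonian M \<pi>\<^sub>M h x) f"

text \<open>\<open>(d P)(s, t) = \<rho>(s)(P(t)) - \<rho>(t)(P(s)) - P([s, t])\<close>, where \<open>P(s)\<close> is the function \<open>x \<mapsto> s\<^sub>x(P\<^sub>x)\<close>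
  and \<open>[s, t] = B s t\<close>.\<close>

definition coboundary1 ::
    "('a, 'e::euclidean_space) manifold \<Rightarrow> 'a bivector_field \<Rightarrow>
     ('b, 'f::euclidean_space) manifold \<Rightarrow> ('a \<Rightarrow> 'b) \<Rightarrow>
     (('a \<Rightarrow> 'b cotangent) \<Rightarrow> ('a \<Rightarrow> 'b cotangent) \<Rightarrow> 'a \<Rightarrow> 'b cotangent) \<Rightarrow>
     ('a \<Rightarrow> 'b tangent) \<Rightarrow> ('a \<Rightarrow> 'b cotangent) \<Rightarrow> ('a \<Rightarrow> 'b cotangent) \<Rightarrow> 'a \<Rightarrow> real" where
  "coboundary1 M \<pi>\<^sub>M N \<phi> B P s t x =
     anchor M \<pi>\<^sub>M N \<phi> x (s x) (\<lambda>y. t y (P y)) -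
     anchor M \<pi>\<^sub>M N \<phi> x (t x) (\<lambda>y. s y (P y)) -
     B s t x (P x)"

text \<open>
  For a Poisson map, a bracket \<open>B\<close> satisfying \<^const>\<open>is_pullback_bracket\<close> exists and its values on
  smooth sections are uniquely determined, so quantifying over it amounts to naming it.
\<close>

definition cocycles1 ::
    "('a, 'e::euclidean_space) manifold \<Rightarrow> 'a bivector_field \<Rightarrow>
     ('b, 'f::euclidean_space) manifold \<Rightarrow> 'b bivector_field \<Rightarrow> ('a \<Rightarrow> 'b) \<Rightarrow>
     ('a \<Rightarrow> 'b tangent) set" where
  "cocycles1 M \<pi>\<^sub>M N \<pi>\<^sub>N \<phi> =
     {P \<in> vector_fields_along M N \<phi>.
        \<forall>B. is_pullback_bracket M \<pi>\<^sub>M N \<pi>\<^sub>N \<phi> B \<longrightarrow>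
          (\<forall>s\<in>one_forms_along M N \<phi>. \<forall>t\<in>one_forms_along M N \<phi>. \<forall>x.
             coboundary1 M \<pi>\<^sub>M N \<phi> B P s t x = 0)}"

text \<open>The class of \<open>P\<close> in \<open>H\<^sup>1\<^sub>\<pi>(\<phi>)\<close>, as the set of all cocycles cohomologous to \<open>P\<close>.\<close>

definition cohomology_class ::
    "('a, 'e::euclidean_space) manifold \<Rightarrow> 'a bivector_field \<Rightarrow>
     ('b, 'f::euclidean_space) manifold \<Rightarrow> 'b bivector_field \<Rightarrow> ('a \<Rightarrow> 'b) \<Rightarrow>
     ('a \<Rightarrow> 'b tangent) \<Rightarrow> ('a \<Rightarrow> 'b tangent) set" where
  "cohomology_class M \<pi>\<^sub>M N \<pi>\<^sub>N \<phi> P =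
     {Q \<in> cocycles1 M \<pi>\<^sub>M N \<pi>\<^sub>N \<phi>.
        \<exists>h\<in>smooth_functions M. \<forall>x f. Q x f - P x f = coboundary0 M \<pi>\<^sub>M N \<phi> h x f}"

definition zero_cohomology_class ::
    "('a, 'e::euclidean_space) manifold \<Rightarrow> 'a bivector_field \<Rightarrow>
     ('b, 'f::euclidean_space) manifold \<Rightarrow> 'b bivector_field \<Rightarrow> ('a \<Rightarrow> 'b) \<Rightarrow>
     ('a \<Rightarrow> 'b tangent) set" where
  "zero_cohomology_class M \<pi>\<^sub>M N \<pi>\<^sub>N \<phi> = cohomology_class M \<pi>\<^sub>M N \<pi>\<^sub>N \<phi> (\<lambda>x f. 0)"

definition relative_modular_field ::
    "('a, 'e::euclidean_space) manifold \<Rightarrow> 'a bivector_field \<Rightarrow>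
     ('b, 'f::euclidean_space) manifold \<Rightarrow> 'b bivector_field \<Rightarrow> ('a \<Rightarrow> 'b) \<Rightarrow>
     ('a \<Rightarrow> (nat \<Rightarrow> 'a tangent) \<Rightarrow> real) \<Rightarrow> ('b \<Rightarrow> (nat \<Rightarrow> 'b tangent) \<Rightarrow> real) \<Rightarrow>
     'a \<Rightarrow> 'b tangent" where
  "relative_modular_field M \<pi>\<^sub>M N \<pi>\<^sub>N \<phi> \<mu> \<nu> x f =
     tangent_map N \<phi> (modular_vector_field M \<pi>\<^sub>M \<mu> x) f - modular_vector_field N \<pi>\<^sub>N \<nu> (\<phi> x) f"

definition modular_class ::
    "('a, 'e::euclidean_space) manifold \<Rightarrow> 'a bivector_field \<Rightarrow>
     ('b, 'f::euclidean_space) manifold \<Rightarrow> 'b bivector_field \<Rightarrow> ('a \<Rightarrow> 'b) \<Rightarrow>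
     ('a \<Rightarrow> 'b tangent) set" where
  "modular_class M \<pi>\<^sub>M N \<pi>\<^sub>N \<phi> =
     (THE c. \<forall>\<mu>\<in>volume_forms M. \<forall>\<nu>\<in>volume_forms N.
        c = cohomology_class M \<pi>\<^sub>M N \<pi>\<^sub>N \<phi> (relative_modular_field M \<pi>\<^sub>M N \<pi>\<^sub>N \<phi> \<mu> \<nu>))"

end

theory Submission
  imports Defs
begin

text \<open>
  For a volume form \<open>\<mu>\<close> and a Hamiltonian vector field \<open>X\<^sub>f\<close>, the function \<open>X\<^sub>\<mu>(f)\<close> is the divergence of
  \<open>X\<^sub>f\<close> with respect to \<open>\<mu>\<close>.  Two volume forms differ by a nowhere vanishing function \<open>g\<close>, and
  \<open>g\<^sup>2 = exp (2 h)\<close> for a smooth \<open>h\<close>, whence \<open>X\<^bsub>g \<mu>\<^esub> = X\<^sub>\<mu> - X\<^sub>h\<close>.  As \<open>\<phi>\<close> is Poisson, \<open>X\<^sub>k \<circ> \<phi>\<close> is the image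
  of \<open>X\<^bsub>k \<circ> \<phi>\<^esub>\<close>, so changing \<open>\<mu>\<close> and \<open>\<nu>\<close> changes \<open>X\<^bsub>\<mu>,\<nu>\<^esub>\<close> by a coboundary.  Conversely, if \<open>X\<^bsub>\<mu>,\<nu>\<^esub>\<close> is
  minus the coboundary of \<open>h\<close>, then it is the image of \<open>X\<^sub>h\<close> and replacing \<open>\<mu>\<close> by \<open>exp h \<mu>\<close> kills it.
  The existence of modular vector fields rests on the fact that a tangent space, defined by
  derivations, has the dimension of the manifold, which is Hadamard's lemma.
\<close>

section \<open>Calculus of continuously differentiable maps\<close>

text \<open>Tangent vectors act on globally smooth functions only, so nothing defined in a single
  chart can be fed to them directly. Coordinates, coordinate fields and Hadamard coefficients are
  therefore multiplied by cutoff functions, and identities valid near a point are turned into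
  identities between global objects. The chain rule is not among the axioms of a derivation. The one
  instance required, for \<open>exp\<close>, is computed in coordinates and carried to all tangent
  vectors by the spanning property of coordinate fields. It is applied to the square of g because g
  may have different signs on different components of M. The divergence exists because an
  alternating, function-linear functional of n vector fields is determined at a point by its value
  on one frame. This is proved for functionals of vector fields, not of vectors, so that it covers
  the Lie derivative, whose formula differentiates its arguments. A cohomology class is a set of
  cocycles, so equality of two classes yields a coboundary only through a common element; the zero
  field is that element.\<close>

lemma cont_diff_on_SucE:
  assumes "cont_diff_on (Suc k) S f"
  obtains f' where "\<And>x. x \<in> S \<Longrightarrow> (f has_derivative f' x) (at x within S)"
    "\<And>v. cont_diff_on k S (\<lambda>x. f' x v)"
  using assms by auto

lemma cont_diff_on_SucI:
  assumes "\<And>x. x \<in> S \<Longrightarrow> (f has_derivative f' x) (at x within S)"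
    "\<And>v. cont_diff_on k S (\<lambda>x. f' x v)"
  shows "cont_diff_on (Suc k) S f"
  using assms by auto

lemma cont_diff_on_cong:
  assumes "\<And>x. x \<in> S \<Longrightarrow> f x = g x"
  shows "cont_diff_on k S f \<longleftrightarrow> cont_diff_on k S g"
proof (cases k)
  case 0
  then show ?thesis using continuous_on_cong[of S S f g] assms by simp
next
  case (Suc j)
  have "(f has_derivative D) (at x within S) \<longleftrightarrow> (g has_derivative D) (at x within S)" if "x \<in> S" for x D
    using assms that has_derivative_transform[of x S g f D] has_derivative_transform[of x S f g D] by metis
  then show ?thesis using Suc by (simp cong: ball_cong)
qed

lemma cont_diff_on_subset: "cont_diff_on k S f \<Longrightarrow> T \<subseteq> S \<Longrightarrow> cont_diff_on k T f"
proof (induction k arbitrary: f)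
  case 0
  then show ?case by (auto intro: continuous_on_subset)
next
  case (Suc k)
  obtain f' where f': "\<And>x. x \<in> S \<Longrightarrow> (f has_derivative f' x) (at x within S)"
    "\<And>v. cont_diff_on k S (\<lambda>x. f' x v)" using Suc.prems(1) by (rule cont_diff_on_SucE) (rule that)
  show ?case
  proof (rule cont_diff_on_SucI)
    show "(f has_derivative f' x) (at x within T)" if "x \<in> T" for x
      using f'(1)[of x] Suc.prems(2) that has_derivative_subset by blast
    show "cont_diff_on k T (\<lambda>x. f' x v)" for v by (rule Suc.IH[OF f'(2) Suc.prems(2)])
  qed
qed

lemma cont_diff_on_imp_continuous_on: "cont_diff_on k S f \<Longrightarrow> continuous_on S f"
  by (cases k) (auto simp: continuous_on_eq_continuous_within dest!: bspec intro: has_derivative_continuous)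

lemma cont_diff_on_SucD: "cont_diff_on (Suc k) S f \<Longrightarrow> cont_diff_on k S f"
proof (induction k arbitrary: f)
  case 0
  show ?case using cont_diff_on_imp_continuous_on[OF 0] by simp
next
  case (Suc k)
  obtain f' where f': "\<And>x. x \<in> S \<Longrightarrow> (f has_derivative f' x) (at x within S)"
    "\<And>v. cont_diff_on (Suc k) S (\<lambda>x. f' x v)" using Suc.prems by (rule cont_diff_on_SucE) (rule that)
  show ?case
  proof (rule cont_diff_on_SucI)
    show "(f has_derivative f' x) (at x within S)" if "x \<in> S" for x using f'(1) that .
    show "cont_diff_on k S (\<lambda>x. f' x v)" for v by (rule Suc.IH[OF f'(2)])
  qed
qed

lemma cont_diff_on_const: "cont_diff_on k S (\<lambda>x. a)"
proof (induction k arbitrary: a)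
  case (Suc k)
  show ?case by (rule cont_diff_on_SucI[OF has_derivative_const Suc])
qed simp

lemma cont_diff_on_bounded_linear:
  assumes "bounded_linear f"
  shows "cont_diff_on k S f"
proof (cases k)
  case 0
  then show ?thesis using assms by (auto intro: linear_continuous_on)
next
  case (Suc j)
  show ?thesis unfolding Suc
    by (rule cont_diff_on_SucI[OF bounded_linear_imp_has_derivative[OF assms] cont_diff_on_const])
qed

lemma cont_diff_on_linear_comp:
  assumes "bounded_linear L"
  shows "cont_diff_on k S f \<Longrightarrow> cont_diff_on k S (\<lambda>x. L (f x))"
proof (induction k arbitrary: f)
  case 0
  then show ?case using assms by (auto intro: bounded_linear.continuous_on)
next
  case (Suc k)
  obtain f' where f': "\<And>x. x \<in> S \<Longrightarrow> (f has_derivative f' x) (at x within S)"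
      "\<And>v. cont_diff_on k S (\<lambda>x. f' x v)" using Suc.prems by (rule cont_diff_on_SucE) (rule that)
  show ?case
    by (rule cont_diff_on_SucI[OF bounded_linear.has_derivative[OF assms f'(1)] Suc.IH[OF f'(2)]])
qed

lemma cont_diff_on_add:
  "cont_diff_on k S f \<Longrightarrow> cont_diff_on k S g \<Longrightarrow> cont_diff_on k S (\<lambda>x. f x + g x)"
proof (induction k arbitrary: f g)
  case 0
  then show ?case by (auto intro: continuous_intros)
next
  case (Suc k)
  obtain f' where f': "\<And>x. x \<in> S \<Longrightarrow> (f has_derivative f' x) (at x within S)"
      "\<And>v. cont_diff_on k S (\<lambda>x. f' x v)" using Suc.prems(1) by (rule cont_diff_on_SucE) (rule that)
  obtain g' where g': "\<And>x. x \<in> S \<Longrightarrow> (g has_derivative g' x) (at x within S)"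
      "\<And>v. cont_diff_on k S (\<lambda>x. g' x v)" using Suc.prems(2) by (rule cont_diff_on_SucE) (rule that)
  show ?case
    by (rule cont_diff_on_SucI[OF has_derivative_add[OF f'(1) g'(1)] Suc.IH[OF f'(2) g'(2)]])
qed

lemma cont_diff_on_sum:
  "(\<And>i. i \<in> I \<Longrightarrow> cont_diff_on k S (f i)) \<Longrightarrow> cont_diff_on k S (\<lambda>x. \<Sum>i\<in>I. f i x)"
  by (induction I rule: infinite_finite_induct) (auto intro: cont_diff_on_const cont_diff_on_add)

lemma (in bounded_bilinear) cont_diff_on_prod:
  "cont_diff_on k S f \<Longrightarrow> cont_diff_on k S g \<Longrightarrow> cont_diff_on k S (\<lambda>x. prod (f x) (g x))"
proof (induction k arbitrary: f g)
  case 0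
  then show ?case by (auto intro: continuous_on)
next
  case (Suc k)
  obtain f' where f': "\<And>x. x \<in> S \<Longrightarrow> (f has_derivative f' x) (at x within S)"
      "\<And>v. cont_diff_on k S (\<lambda>x. f' x v)" using Suc.prems(1) by (rule cont_diff_on_SucE) (rule that)
  obtain g' where g': "\<And>x. x \<in> S \<Longrightarrow> (g has_derivative g' x) (at x within S)"
      "\<And>v. cont_diff_on k S (\<lambda>x. g' x v)" using Suc.prems(2) by (rule cont_diff_on_SucE) (rule that)
  note f = cont_diff_on_SucD[OF Suc.prems(1)] and g = cont_diff_on_SucD[OF Suc.prems(2)]
  show ?case
    by (rule cont_diff_on_SucI[OF FDERIV[OF f'(1) g'(1)]
          cont_diff_on_add[OF Suc.IH[OF f g'(2)] Suc.IH[OF f'(2) g]]])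
qed

lemmas cont_diff_on_mult = bounded_bilinear.cont_diff_on_prod[OF bounded_bilinear_mult]
  and cont_diff_on_scaleR = bounded_bilinear.cont_diff_on_prod[OF bounded_bilinear_scaleR]

lemma cont_diff_on_compose:
  fixes g :: "'e::euclidean_space \<Rightarrow> 'f::euclidean_space" and f :: "'f \<Rightarrow> 'g::real_normed_vector"
  shows "cont_diff_on k S g \<Longrightarrow> cont_diff_on k T f \<Longrightarrow> g ` S \<subseteq> T \<Longrightarrow> cont_diff_on k S (\<lambda>x. f (g x))"
proof (induction k arbitrary: f)
  case 0
  then show ?case using continuous_on_compose2[of T f S g] by simp
next
  case (Suc k)
  obtain g' where g': "\<And>x. x \<in> S \<Longrightarrow> (g has_derivative g' x) (at x within S)"
      "\<And>v. cont_diff_on k S (\<lambda>x. g' x v)" using Suc.prems(1) by (rule cont_diff_on_SucE) (rule that)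
  obtain f' where f': "\<And>x. x \<in> T \<Longrightarrow> (f has_derivative f' x) (at x within T)"
      "\<And>v. cont_diff_on k T (\<lambda>x. f' x v)" using Suc.prems(2) by (rule cont_diff_on_SucE) (rule that)
  note d = f'(1) g'(1) and c = f'(2) g'(2)
  have g: "cont_diff_on k S g" by (rule cont_diff_on_SucD[OF Suc.prems(1)])
  have fg: "((\<lambda>x. f (g x)) has_derivative (\<lambda>v. f' (g x) (g' x v))) (at x within S)" if "x \<in> S" for x
  proof (rule has_derivative_in_compose[where f = g and g = f])
    show "(g has_derivative g' x) (at x within S)" using d(2)[OF that] .
    have "g x \<in> T" using that Suc.prems(3) by auto
    then show "(f has_derivative f' (g x)) (at (g x) within g ` S)"
      using has_derivative_subset[OF d(1) Suc.prems(3)] by simp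
  qed
  \<comment> \<open>The direction \<open>g' x v\<close> moves with x, whereas
    \<open>cont_diff_on\<close> controls \<open>f'\<close> only in fixed directions; expanding over
    \<open>Basis\<close> moves the dependence on x into scalar coefficients.\<close>
  have eq: "f' (g x) (g' x v) = (\<Sum>b\<in>Basis. (g' x v \<bullet> b) *\<^sub>R f' (g x) b)" if "x \<in> S" for x v
  proof -
    have "linear (f' (g x))"
      using d(1)[of "g x"] that Suc.prems(3) has_derivative_linear by blast
    then have "f' (g x) (\<Sum>b\<in>Basis. (g' x v \<bullet> b) *\<^sub>R b) = (\<Sum>b\<in>Basis. (g' x v \<bullet> b) *\<^sub>R f' (g x) b)"
      by (simp add: linear_sum linear_scale)
    then show ?thesis by (simp only: euclidean_representation)
  qed
  have "cont_diff_on k S (\<lambda>x. \<Sum>b\<in>Basis. (g' x v \<bullet> b) *\<^sub>R f' (g x) b)" for v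
    by (rule cont_diff_on_sum, rule cont_diff_on_scaleR[OF
          cont_diff_on_linear_comp[OF bounded_linear_inner_left c(2)] Suc.IH[OF g c(1) Suc.prems(3)]])
  then have "cont_diff_on k S (\<lambda>x. f' (g x) (g' x v))" for v
    by (subst cont_diff_on_cong[OF eq])
  with fg show ?case by (rule cont_diff_on_SucI)
qed

text \<open>The derivative - (1/f) f' (1/f) contains 1/f again, but only one order less of it is
  asked for, so induction on the order closes.\<close>

lemma cont_diff_on_inverse:
  fixes f :: "'e::euclidean_space \<Rightarrow> real"
  shows "cont_diff_on k S f \<Longrightarrow> (\<And>x. x \<in> S \<Longrightarrow> f x \<noteq> 0) \<Longrightarrow> cont_diff_on k S (\<lambda>x. inverse (f x))"
proof (induction k)
  case 0
  then show ?case by (simp add: continuous_on_inverse)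
next
  case (Suc k)
  then obtain f' where f': "\<And>x. x \<in> S \<Longrightarrow> (f has_derivative f' x) (at x within S)"
    and c: "\<And>v. cont_diff_on k S (\<lambda>x. f' x v)" by auto
  have i: "cont_diff_on k S (\<lambda>x. inverse (f x))"
    by (rule Suc.IH[OF cont_diff_on_SucD[OF Suc.prems(1)] Suc.prems(2)])
  have "((\<lambda>x. inverse (f x)) has_derivative (\<lambda>v. (-1) * (inverse (f x) * f' x v * inverse (f x)))) (at x within S)"
    if "x \<in> S" for x
    using Deriv.has_derivative_inverse[OF Suc.prems(2)[OF that] f'[OF that]] by simp
  moreover have "cont_diff_on k S (\<lambda>x. (-1) * (inverse (f x) * f' x v * inverse (f x)))" for v
    by (rule cont_diff_on_mult[OF cont_diff_on_const cont_diff_on_mult[OF cont_diff_on_mult[OF i c] i]])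
  ultimately show ?case
    by (rule cont_diff_on_SucI)
qed

lemma cont_diff_on_exp:
  fixes f :: "'e::euclidean_space \<Rightarrow> real"
  shows "cont_diff_on k S f \<Longrightarrow> cont_diff_on k S (\<lambda>x. exp (f x))"
proof (induction k)
  case 0
  then show ?case by (simp add: continuous_on_exp)
next
  case (Suc k)
  then obtain f' where f': "\<And>x. x \<in> S \<Longrightarrow> (f has_derivative f' x) (at x within S)"
    and c: "\<And>v. cont_diff_on k S (\<lambda>x. f' x v)" by auto
  have "((\<lambda>x. exp (f x)) has_derivative (\<lambda>v. exp (f x) * f' x v)) (at x within S)"
    if "x \<in> S" for x
    using has_derivative_exp[OF f'[OF that]] by (simp add: mult.commute)
  moreover have "cont_diff_on k S (\<lambda>x. exp (f x) * f' x v)" for v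
    by (rule cont_diff_on_mult[OF Suc.IH[OF cont_diff_on_SucD[OF Suc.prems]] c])
  ultimately show ?case
    by (rule cont_diff_on_SucI)
qed

text \<open>The derivative f' / f contains no logarithm, so a case distinction on the order replaces
  induction.\<close>

lemma cont_diff_on_ln:
  fixes f :: "'e::euclidean_space \<Rightarrow> real"
  assumes f: "cont_diff_on k S f" and pos: "\<And>x. x \<in> S \<Longrightarrow> f x > 0"
  shows "cont_diff_on k S (\<lambda>x. ln (f x))"
proof -
  have nz: "f x \<noteq> 0" if "x \<in> S" for x using pos[OF that] by simp
  show ?thesis
  proof (cases k)
    case 0
    then show ?thesis using assms nz by (simp add: continuous_on_ln)
  next
    case (Suc j)
    then obtain f' where f': "\<And>x. x \<in> S \<Longrightarrow> (f has_derivative f' x) (at x within S)"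
      and c: "\<And>v. cont_diff_on j S (\<lambda>x. f' x v)" using f by auto
    have "((\<lambda>x. ln (f x)) has_derivative (\<lambda>v. f' x v * inverse (f x))) (at x within S)"
      if "x \<in> S" for x
      using has_derivative_ln[OF pos[OF that] f'[OF that]] by simp
    moreover have "cont_diff_on j S (\<lambda>x. f' x v * inverse (f x))" for v
      by (rule cont_diff_on_mult[OF c cont_diff_on_inverse[OF cont_diff_on_SucD[OF f[unfolded Suc]] nz]])
    ultimately show ?thesis
      unfolding Suc by (rule cont_diff_on_SucI)
  qed
qed

text \<open>For m = 0 this is the classical smooth function exp (-1/t), extended by 0 to t \<le> 0.
  The powers of 1/t are included because they appear on differentiation: the family is closed under
  derivatives up to linear combinations, which gives all orders by one induction over arbitrary
  m.\<close>

definition flat_exp :: "nat \<Rightarrow> real \<Rightarrow> real" where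
  "flat_exp m t = (if t > 0 then exp (- inverse t) * inverse t ^ m else 0)"

text \<open>With s = 1/t the limit from the right is that of s ^ m / exp s at infinity.\<close>

lemma flat_exp_tendsto: "(flat_exp m \<longlongrightarrow> 0) (at 0)"
proof -
  have "((\<lambda>t::real. inverse t ^ m / exp (inverse t)) \<longlongrightarrow> 0) (at_right 0)"
    by (rule filterlim_compose[OF tendsto_power_div_exp_0 filterlim_inverse_at_top_right])
  then have "(flat_exp m \<longlongrightarrow> 0) (at_right 0)"
    by (rule Lim_transform_eventually)
       (auto simp: eventually_at_filter flat_exp_def exp_minus divide_inverse)
  moreover have "(flat_exp m \<longlongrightarrow> 0) (at_left 0)"
    by (rule tendsto_eventually) (auto simp: eventually_at_filter flat_exp_def)
  ultimately show ?thesis by (simp add: filterlim_at_split)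
qed

lemma has_real_derivative_flat_exp:
  "(flat_exp m has_real_derivative (flat_exp (m + 2) t - of_nat m * flat_exp (Suc m) t)) (at t)"
proof (cases t "0::real" rule: linorder_cases)
  case less
  have "((\<lambda>t. 0) has_real_derivative 0) (at t)" by simp
  then have "(flat_exp m has_real_derivative 0) (at t)"
    by (rule has_field_derivative_transform_within_open[where S = "{..<0}"])
       (use less in \<open>auto simp: flat_exp_def\<close>)
  then show ?thesis using less by (simp add: flat_exp_def)
next
  case equal
  \<comment> \<open>The difference quotient at 0 is \<open>flat_exp (Suc m)\<close> itself, so
    differentiability at 0 is the limit already known for the next exponent.\<close>
  have "((\<lambda>h. (flat_exp m (0 + h) - flat_exp m 0) / h) \<longlongrightarrow> 0) (at 0)"
    using flat_exp_tendsto[of "Suc m"]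
    by (rule Lim_transform_eventually)
       (simp add: eventually_at_filter flat_exp_def divide_inverse mult.assoc power_commutes)
  then show ?thesis using equal by (simp add: DERIV_def flat_exp_def)
next
  case greater
  have i: "(inverse has_real_derivative - (inverse t)\<^sup>2) (at t)"
    using DERIV_inverse[of t] greater by (simp add: numeral_2_eq_2)
  \<comment> \<open>The power rule produces the exponent \<open>m - Suc 0\<close>, which is
    truncated at m = 0; there the factor \<open>of_nat m\<close> is 0.\<close>
  have m: "of_nat m * (- (inverse t)\<^sup>2 * inverse t ^ (m - Suc 0)) = - of_nat m * inverse t ^ Suc m"
    by (cases m) (simp_all add: power2_eq_square algebra_simps)
  have "((\<lambda>t. exp (- inverse t) * inverse t ^ m) has_real_derivative
      exp (- inverse t) * - (- (inverse t)\<^sup>2) * inverse t ^ m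
      + of_nat m * (- (inverse t)\<^sup>2 * inverse t ^ (m - Suc 0)) * exp (- inverse t)) (at t)"
    by (intro DERIV_mult DERIV_fun_exp DERIV_minus DERIV_power i)
  then have "((\<lambda>t. exp (- inverse t) * inverse t ^ m) has_real_derivative
      (flat_exp (m + 2) t - of_nat m * flat_exp (Suc m) t)) (at t)"
    unfolding m using greater by (simp add: flat_exp_def power_add power2_eq_square algebra_simps)
  then show ?thesis
    by (rule has_field_derivative_transform_within_open[where S = "{0<..}"])
       (use greater in \<open>auto simp: flat_exp_def\<close>)
qed

lemma cont_diff_on_flat_exp: "cont_diff_on k UNIV (flat_exp m)"
proof (induction k arbitrary: m)
  case 0
  then show ?case
    using has_real_derivative_flat_exp by (auto intro!: DERIV_continuous_on)
next
  case (Suc k)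
  let ?d = "\<lambda>t. flat_exp (m + 2) t + (- of_nat m) * flat_exp (Suc m) t"
  have "(flat_exp m has_derivative (\<lambda>v. ?d t * v)) (at t)" for t
    using has_real_derivative_flat_exp[of m t] by (simp add: has_field_derivative_def)
  moreover have "cont_diff_on k UNIV (\<lambda>t. ?d t * v)" for v
    by (intro cont_diff_on_mult cont_diff_on_add cont_diff_on_const Suc)
  ultimately show ?case by (rule cont_diff_on_SucI)
qed

section \<open>Relatively open subsets of a subspace\<close>

text \<open>Supplies linear coordinates on the model space; the vectors of the ambient
  \<open>Basis\<close> need not lie in V.\<close>

lemma orthonormal_basis_subspaceE:
  fixes V :: "'e::euclidean_space set"
  assumes "subspace V"
  obtains B where "finite B" "B \<subseteq> V" "card B = dim V" "\<And>x. x \<in> V \<Longrightarrow> (\<Sum>b\<in>B. (x \<bullet> b) *\<^sub>R b) = x"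
proof -
  obtain B where B: "B \<subseteq> V" "pairwise orthogonal B" "\<And>x. x \<in> B \<Longrightarrow> norm x = 1"
      "independent B" "card B = dim V" "span B = V"
    using orthonormal_basis_subspace[OF assms] by metis
  have "finite B" using B(4) by (rule independent_imp_finite)
  then show ?thesis
    using B by (intro that[of B]) (auto intro: orthonormal_basis_expand)
qed

text \<open>A derivative within a relatively open subset of V is determined only along V.
  Derivatives along single vectors of V are canonical, independent of the witness chosen in
  \<open>cont_diff_on\<close>, and can therefore be glued and differentiated again.\<close>

definition dir_deriv :: "('e::real_normed_vector \<Rightarrow> 'f::real_normed_vector) \<Rightarrow> 'e \<Rightarrow> 'e \<Rightarrow> 'f" where
  "dir_deriv f v x = vector_derivative (\<lambda>t. f (x + t *\<^sub>R v)) (at 0)"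

lemma dir_deriv_eq:
  fixes V :: "'e::euclidean_space set"
  assumes V: "subspace V" "openin (top_of_set V) S" and x: "x \<in> S" and v: "v \<in> V"
    and D: "(f has_derivative D) (at x within S)"
  shows "dir_deriv f v x = D v"
proof -
  obtain W where W: "open W" "S = V \<inter> W" using V(2) by (auto simp: openin_open)
  \<comment> \<open>The parameters for which the line through x stays in W; as v lies in V, the line
    then stays in S, so the derivative within S restricts to an ordinary derivative at 0.\<close>
  define T where "T = (\<lambda>t. x + t *\<^sub>R v) -` W"
  have T: "open T" "0 \<in> T"
    unfolding T_def using W x by (auto intro!: open_vimage continuous_intros)
  have sub: "(\<lambda>t. x + t *\<^sub>R v) ` T \<subseteq> S"
    using x v W V(1) by (auto simp: T_def subspace_add subspace_scale)
  have "((\<lambda>t. x + t *\<^sub>R v) has_derivative (\<lambda>t. t *\<^sub>R v)) (at 0 within T)"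
    by (auto intro!: derivative_eq_intros)
  moreover have "(f has_derivative D) (at (x + 0 *\<^sub>R v) within (\<lambda>t. x + t *\<^sub>R v) ` T)"
    using has_derivative_subset[OF D sub] by simp
  ultimately have "((\<lambda>t. f (x + t *\<^sub>R v)) has_derivative (\<lambda>t. D (t *\<^sub>R v))) (at 0 within T)"
    by (rule has_derivative_in_compose)
  moreover have "(\<lambda>t. D (t *\<^sub>R v)) = (\<lambda>t. t *\<^sub>R D v)"
    using has_derivative_linear[OF D] by (simp add: linear_scale)
  ultimately have "((\<lambda>t. f (x + t *\<^sub>R v)) has_vector_derivative D v) (at 0)"
    using T by (simp add: has_vector_derivative_def at_within_open[of 0 T])
  then show ?thesis unfolding dir_deriv_def by (rule vector_derivative_at)
qed

lemma cont_diff_on_dir_deriv: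
  fixes V :: "'e::euclidean_space set"
  assumes V: "subspace V" "openin (top_of_set V) S" and v: "v \<in> V"
    and f: "cont_diff_on (Suc k) S f"
  shows "cont_diff_on k S (dir_deriv f v)"
proof -
  obtain f' where f': "\<And>x. x \<in> S \<Longrightarrow> (f has_derivative f' x) (at x within S)"
      "\<And>v. cont_diff_on k S (\<lambda>x. f' x v)" using f by (rule cont_diff_on_SucE) (rule that)
  have "dir_deriv f v x = f' x v" if "x \<in> S" for x
    using dir_deriv_eq[OF V that v f'(1)[OF that]] .
  then show ?thesis using f'(2)[of v] by (subst cont_diff_on_cong)
qed

text \<open>A witness for \<open>cont_diff_on\<close> must have regular values in every ambient
  direction, while control is given along V only. Precomposing with the orthogonal projection P onto
  V, which fixes S pointwise, gives a witness all of whose values are directional derivatives along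
  V.\<close>

lemma cont_diff_on_Suc_dir_derivI:
  fixes V :: "'e::euclidean_space set"
  assumes V: "subspace V" "openin (top_of_set V) S"
    and f: "\<And>x. x \<in> S \<Longrightarrow> \<exists>D. (f has_derivative D) (at x within S)"
    and v: "\<And>v. v \<in> V \<Longrightarrow> cont_diff_on k S (dir_deriv f v)"
  shows "cont_diff_on (Suc k) S f"
proof -
  obtain B where B: "finite B" "B \<subseteq> V" "\<And>x. x \<in> V \<Longrightarrow> (\<Sum>b\<in>B. (x \<bullet> b) *\<^sub>R b) = x"
    using orthonormal_basis_subspaceE[OF V(1)] by metis
  define P where "P x = (\<Sum>b\<in>B. (x \<bullet> b) *\<^sub>R b)" for x
  have P: "P x \<in> V" for x
    unfolding P_def using B(2) V(1) by (intro subspace_sum subspace_scale) auto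
  have SV: "S \<subseteq> V" using V(2) openin_imp_subset by blast
  then have PS: "P x = x" if "x \<in> S" for x using B(3) that unfolding P_def by auto
  have blP: "bounded_linear P"
    unfolding P_def by (intro bounded_linear_sum bounded_linear_scaleR_const bounded_linear_inner_left)
  obtain D where D: "\<And>x. x \<in> S \<Longrightarrow> (f has_derivative D x) (at x within S)" using f by metis
  show ?thesis
  proof (rule cont_diff_on_SucI)
    fix x assume x: "x \<in> S"
    have "P ` S = S" using PS by simp
    then have "(f has_derivative D x) (at (P x) within P ` S)" using D[OF x] PS[OF x] by simp
    then have "((\<lambda>x. f (P x)) has_derivative (\<lambda>v. D x (P v))) (at x within S)"
      by (rule has_derivative_in_compose[OF bounded_linear_imp_has_derivative[OF blP]])
    then show "(f has_derivative (\<lambda>v. D x (P v))) (at x within S)"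
      by (rule has_derivative_transform[OF x, rotated]) (simp add: PS)
  next
    fix v
    have "dir_deriv f (P v) x = D x (P v)" if "x \<in> S" for x
      using dir_deriv_eq[OF V that P D[OF that]] .
    then show "cont_diff_on k S (\<lambda>x. D x (P v))"
      using v[OF P[of v]] by (subst cont_diff_on_cong[where g = "dir_deriv f (P v)"]) auto
  qed
qed

text \<open>Witnesses chosen on different neighbourhoods may disagree in directions off V and cannot
  simply be glued; the canonical \<open>dir_deriv\<close> does the gluing.\<close>

lemma cont_diff_on_local:
  fixes V :: "'e::euclidean_space set"
  assumes V: "subspace V" "openin (top_of_set V) S"
    and loc: "\<And>x. x \<in> S \<Longrightarrow> \<exists>T. open T \<and> x \<in> T \<and> cont_diff_on k (S \<inter> T) f"
  shows "cont_diff_on k S f"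
  using loc
proof (induction k arbitrary: f)
  case 0
  have "continuous (at x within S) f" if x: "x \<in> S" for x
  proof -
    obtain T where T: "open T" "x \<in> T" "continuous_on (S \<inter> T) f" using 0[OF x] by auto
    then have "continuous (at x within (S \<inter> T)) f"
      using x by (simp add: continuous_on_eq_continuous_within)
    moreover have "at x within (S \<inter> T) = at x within S"
      using T x by (intro at_within_nhd[of _ T]) auto
    ultimately show ?thesis by simp
  qed
  then show ?case by (simp add: continuous_on_eq_continuous_within)
next
  case (Suc k)
  have op: "openin (top_of_set V) (S \<inter> T)" if "open T" for T
    using V(2) that openin_subtopology_Int by (metis open_openin openin_Int_open)
  show ?case
  proof (rule cont_diff_on_Suc_dir_derivI[OF V])
    fix x assume x: "x \<in> S"
    obtain T where T: "open T" "x \<in> T" "cont_diff_on (Suc k) (S \<inter> T) f" using Suc.prems[OF x] by auto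
    then obtain D where "(f has_derivative D) (at x within (S \<inter> T))" using x by auto
    moreover have "at x within (S \<inter> T) = at x within S"
      using T x by (intro at_within_nhd[of _ T]) auto
    ultimately show "\<exists>D. (f has_derivative D) (at x within S)" by auto
  next
    fix v assume v: "v \<in> V"
    show "cont_diff_on k S (dir_deriv f v)"
    proof (rule Suc.IH)
      fix x assume x: "x \<in> S"
      obtain T where T: "open T" "x \<in> T" "cont_diff_on (Suc k) (S \<inter> T) f" using Suc.prems[OF x] by auto
      then show "\<exists>T. open T \<and> x \<in> T \<and> cont_diff_on k (S \<inter> T) (dir_deriv f v)"
        using cont_diff_on_dir_deriv[OF V(1) op[OF T(1)] v T(3)] by blast
    qed
  qed
qed

section \<open>Smooth functions on subsets of Euclidean space\<close>

lemma smooth_on_cong: "(\<And>x. x \<in> S \<Longrightarrow> f x = g x) \<Longrightarrow> smooth_on S f \<longleftrightarrow> smooth_on S g"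
  using cont_diff_on_cong[of S f g] by (simp add: smooth_on_def)

lemma smooth_on_subset: "smooth_on S f \<Longrightarrow> T \<subseteq> S \<Longrightarrow> smooth_on T f"
  using cont_diff_on_subset unfolding smooth_on_def by blast

lemma smooth_on_imp_continuous_on: "smooth_on S f \<Longrightarrow> continuous_on S f"
  using cont_diff_on_imp_continuous_on unfolding smooth_on_def by blast

lemma smooth_on_imp_has_derivative:
  assumes "smooth_on S f" "x \<in> S"
  obtains D where "(f has_derivative D) (at x within S)"
  using assms cont_diff_on.simps(2)[of 0 S f] unfolding smooth_on_def by blast

lemma smooth_on_const: "smooth_on S (\<lambda>x. a)"
  by (simp add: smooth_on_def cont_diff_on_const)

lemma smooth_on_bounded_linear: "bounded_linear f \<Longrightarrow> smooth_on S f"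
  by (simp add: smooth_on_def cont_diff_on_bounded_linear)

lemma smooth_on_add: "smooth_on S f \<Longrightarrow> smooth_on S g \<Longrightarrow> smooth_on S (\<lambda>x. f x + g x)"
  by (simp add: smooth_on_def cont_diff_on_add)

lemma smooth_on_mult:
  fixes f g :: "'e::euclidean_space \<Rightarrow> real"
  shows "smooth_on S f \<Longrightarrow> smooth_on S g \<Longrightarrow> smooth_on S (\<lambda>x. f x * g x)"
  by (simp add: smooth_on_def cont_diff_on_mult)

lemma smooth_on_inner_left: "smooth_on S f \<Longrightarrow> smooth_on S (\<lambda>x. f x \<bullet> b)"
  by (simp add: smooth_on_def cont_diff_on_linear_comp[OF bounded_linear_inner_left])

lemma smooth_on_inner:
  fixes f g :: "'e::euclidean_space \<Rightarrow> 'f::real_inner"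
  shows "smooth_on S f \<Longrightarrow> smooth_on S g \<Longrightarrow> smooth_on S (\<lambda>x. f x \<bullet> g x)"
  by (simp add: smooth_on_def bounded_bilinear.cont_diff_on_prod[OF bounded_bilinear_inner])

lemma smooth_on_inverse:
  fixes f :: "'e::euclidean_space \<Rightarrow> real"
  shows "smooth_on S f \<Longrightarrow> (\<And>x. x \<in> S \<Longrightarrow> f x \<noteq> 0) \<Longrightarrow> smooth_on S (\<lambda>x. inverse (f x))"
  unfolding smooth_on_def using cont_diff_on_inverse by blast

lemma smooth_on_exp:
  fixes f :: "'e::euclidean_space \<Rightarrow> real"
  shows "smooth_on S f \<Longrightarrow> smooth_on S (\<lambda>x. exp (f x))"
  by (simp add: smooth_on_def cont_diff_on_exp)

lemma smooth_on_ln: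
  fixes f :: "'e::euclidean_space \<Rightarrow> real"
  shows "smooth_on S f \<Longrightarrow> (\<And>x. x \<in> S \<Longrightarrow> f x > 0) \<Longrightarrow> smooth_on S (\<lambda>x. ln (f x))"
  unfolding smooth_on_def using cont_diff_on_ln by blast

lemma smooth_on_compose:
  fixes g :: "'e::euclidean_space \<Rightarrow> 'f::euclidean_space"
  shows "smooth_on S g \<Longrightarrow> smooth_on T f \<Longrightarrow> g ` S \<subseteq> T \<Longrightarrow> smooth_on S (\<lambda>x. f (g x))"
  unfolding smooth_on_def using cont_diff_on_compose by blast

lemma smooth_on_local:
  fixes V :: "'e::euclidean_space set"
  assumes "subspace V" "openin (top_of_set V) S"
    and "\<And>x. x \<in> S \<Longrightarrow> \<exists>T. open T \<and> x \<in> T \<and> smooth_on (S \<inter> T) f"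
  shows "smooth_on S f"
  using cont_diff_on_local[OF assms(1,2)] assms(3) unfolding smooth_on_def by meson

lemma smooth_on_dir_deriv:
  fixes V :: "'e::euclidean_space set"
  assumes "subspace V" "openin (top_of_set V) S" "v \<in> V" "smooth_on S f"
  shows "smooth_on S (dir_deriv f v)"
  using cont_diff_on_dir_deriv[OF assms(1-3)] assms(4) unfolding smooth_on_def by blast

text \<open>The squared norm is smooth at the origin, unlike the norm. For positive r the function
  is positive exactly on the open ball of radius sqrt r.\<close>

lemma smooth_on_bump: "smooth_on UNIV (\<lambda>x::'e::euclidean_space. flat_exp 0 (r - x \<bullet> x))"
proof -
  have "smooth_on UNIV (\<lambda>x::'e. r + (-1) * (x \<bullet> x))"
    by (intro smooth_on_add smooth_on_mult smooth_on_const smooth_on_inner smooth_on_bounded_linear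
        bounded_linear_ident)
  moreover have "smooth_on UNIV (flat_exp 0)" by (simp add: smooth_on_def cont_diff_on_flat_exp)
  ultimately have "smooth_on UNIV (\<lambda>x::'e. flat_exp 0 (r + (-1) * (x \<bullet> x)))"
    by (rule smooth_on_compose) simp
  then show ?thesis by simp
qed

context
  fixes V S :: "'e::euclidean_space set"
  assumes V: "subspace V" "openin (top_of_set V) S"
begin

lemma dir_deriv_mult:
  fixes f g :: "'e \<Rightarrow> real"
  assumes "smooth_on S f" "smooth_on S g" "x \<in> S" "v \<in> V"
  shows "dir_deriv (\<lambda>x. f x * g x) v x = f x * dir_deriv g v x + g x * dir_deriv f v x"
proof -
  obtain D where D: "(f has_derivative D) (at x within S)"
    using assms smooth_on_imp_has_derivative by blast
  obtain E where E: "(g has_derivative E) (at x within S)"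
    using assms smooth_on_imp_has_derivative by blast
  show ?thesis
    unfolding dir_deriv_eq[OF V assms(3,4) D] dir_deriv_eq[OF V assms(3,4) E]
      dir_deriv_eq[OF V assms(3,4) has_derivative_mult[OF D E]] by simp
qed

lemma dir_deriv_lincomb:
  fixes f g :: "'e \<Rightarrow> real"
  assumes "smooth_on S f" "smooth_on S g" "x \<in> S" "v \<in> V"
  shows "dir_deriv (\<lambda>x. a * f x + b * g x) v x = a * dir_deriv f v x + b * dir_deriv g v x"
proof -
  obtain D where D: "(f has_derivative D) (at x within S)"
    using assms smooth_on_imp_has_derivative by blast
  obtain E where E: "(g has_derivative E) (at x within S)"
    using assms smooth_on_imp_has_derivative by blast
  have "((\<lambda>x. a * f x + b * g x) has_derivative (\<lambda>v. a * D v + b * E v)) (at x within S)"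
    by (intro has_derivative_add has_derivative_mult_right D E)
  then show ?thesis
    unfolding dir_deriv_eq[OF V assms(3,4) D] dir_deriv_eq[OF V assms(3,4) E]
    by (rule dir_deriv_eq[OF V assms(3,4)])
qed

lemma dir_deriv_exp:
  fixes f :: "'e \<Rightarrow> real"
  assumes "smooth_on S f" "x \<in> S" "v \<in> V"
  shows "dir_deriv (\<lambda>x. exp (f x)) v x = exp (f x) * dir_deriv f v x"
proof -
  obtain D where D: "(f has_derivative D) (at x within S)"
    using assms smooth_on_imp_has_derivative by blast
  show ?thesis
    unfolding dir_deriv_eq[OF V assms(2,3) D]
      dir_deriv_eq[OF V assms(2,3) has_derivative_exp[OF D]] by simp
qed

end


section \<open>Integrals along segments and Hadamard's lemma\<close>

lemma convex_segment_mem: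
  assumes "convex S" "p \<in> S" "y \<in> S" "t \<in> {0..1}"
  shows "p + t *\<^sub>R (y - p) \<in> S"
proof -
  have "p + t *\<^sub>R (y - p) = (1 - t) *\<^sub>R p + t *\<^sub>R y"
    by (simp add: scaleR_diff_left scaleR_diff_right)
  then show ?thesis using convexD_alt[OF assms(1-3), of t] assms(4) by simp
qed

text \<open>Differentiating the integrand in y brings out a factor t. The weight
  \<open>t ^ m\<close> is there to absorb it, so that the derivative is an integral of the same kind
  with m raised by one; Hadamard's lemma is the case m = 0.\<close>

lemma cont_diff_on_integral_segment:
  fixes H :: "'e::euclidean_space \<Rightarrow> real"
  assumes S: "convex S" "p \<in> S"
  shows "cont_diff_on k S H \<Longrightarrow>
    cont_diff_on k S (\<lambda>y. integral {0..1} (\<lambda>t. t ^ m * H (p + t *\<^sub>R (y - p))))"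
proof -
  note seg = convex_segment_mem[OF S]
  have cont_seg: "continuous_on (S \<times> cbox 0 1) (\<lambda>z. snd z ^ m * G (p + snd z *\<^sub>R (fst z - p)))"
    if G: "continuous_on S G" for G :: "'e \<Rightarrow> real" and m
  proof -
    have "continuous_on (S \<times> cbox 0 1) (\<lambda>z. p + snd z *\<^sub>R (fst z - p))"
      by (intro continuous_intros)
    then have "continuous_on (S \<times> cbox 0 1) (\<lambda>z. G (p + snd z *\<^sub>R (fst z - p)))"
      by (rule continuous_on_compose2[OF G]) (auto intro: seg)
    then show ?thesis by (intro continuous_on_mult continuous_on_power continuous_on_snd continuous_on_id)
  qed
  show "cont_diff_on k S H \<Longrightarrow>
    cont_diff_on k S (\<lambda>y. integral {0..1} (\<lambda>t. t ^ m * H (p + t *\<^sub>R (y - p))))"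
  proof (induction k arbitrary: H m)
    case 0
    have "continuous_on S H" using 0 by simp
    from cont_seg[OF this, of m] show ?case
      using integral_continuous_on_param[of S 0 1 "\<lambda>y t. t ^ m * H (p + t *\<^sub>R (y - p))"]
      by (simp add: split_beta)
  next
    case (Suc k)
    obtain H' where H': "\<And>x. x \<in> S \<Longrightarrow> (H has_derivative H' x) (at x within S)"
        "\<And>v. cont_diff_on k S (\<lambda>x. H' x v)" using Suc.prems by (rule cont_diff_on_SucE) (rule that)
    have cH: "continuous_on S H" using cont_diff_on_imp_continuous_on[OF Suc.prems] .
    have bl: "blinfun_apply (Blinfun (H' x)) = H' x" if "x \<in> S" for x
      using H'(1)[OF that] by (intro bounded_linear_Blinfun_apply has_derivative_bounded_linear)
    \<comment> \<open>The y-derivative of the integrand as an operator-valued function, the form in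
      which \<open>leibniz_rule\<close> takes it. Its joint continuity is then checked on basis
      vectors.\<close>
    define F where "F y t = t ^ Suc m *\<^sub>R Blinfun (H' (p + t *\<^sub>R (y - p)))" for y t
    have Fv: "blinfun_apply (F y t) v = t ^ Suc m * H' (p + t *\<^sub>R (y - p)) v" if "y \<in> S" "t \<in> {0..1}" for y t v
      unfolding F_def by (simp only: scaleR_blinfun.rep_eq bl[OF seg[OF that]] real_scaleR_def)
    have cF: "continuous_on (S \<times> cbox 0 1) (\<lambda>(y, t). F y t)"
    proof (rule continuous_on_blinfun_componentwise)
      fix v :: 'e assume "v \<in> Basis"
      have "continuous_on (S \<times> cbox 0 1) (\<lambda>z. snd z ^ Suc m * H' (p + snd z *\<^sub>R (fst z - p)) v)"
        by (rule cont_seg[OF cont_diff_on_imp_continuous_on[OF H'(2)]])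
      moreover have "snd z ^ Suc m * H' (p + snd z *\<^sub>R (fst z - p)) v = blinfun_apply (case z of (y, t) \<Rightarrow> F y t) v"
        if "z \<in> S \<times> cbox 0 1" for z
        using that Fv[of "fst z" "snd z" v] by (simp add: split_beta mem_Times_iff)
      ultimately show "continuous_on (S \<times> cbox 0 1) (\<lambda>z. blinfun_apply (case z of (y, t) \<Rightarrow> F y t) v)"
        by (rule continuous_on_eq)
    qed
    have cP: "continuous_on {0..1} (\<lambda>t. (y, t))" for y :: 'e
      by (intro continuous_on_Pair continuous_on_const continuous_on_id)
    have sub: "(\<lambda>t. (y, t)) ` {0..1::real} \<subseteq> S \<times> cbox 0 1" if "y \<in> S" for y
      using that by auto
    have cH1: "continuous_on {0..1} (\<lambda>t. t ^ m * H (p + t *\<^sub>R (y - p)))" if "y \<in> S" for y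
      using continuous_on_compose2[OF cont_seg[OF cH, of m] cP sub[OF that]] by simp
    have cF1: "continuous_on {0..1} (F y)" if "y \<in> S" for y
      using continuous_on_compose2[OF cF cP sub[OF that]] by simp
    have der: "((\<lambda>y. t ^ m * H (p + t *\<^sub>R (y - p))) has_derivative blinfun_apply (F y t)) (at y within S)"
      if "y \<in> S" "t \<in> cbox 0 1" for y t
    proof -
      have t: "t \<in> {0..1}" using that by simp
      have "((\<lambda>y. p + t *\<^sub>R (y - p)) has_derivative (\<lambda>v. t *\<^sub>R v)) (at y within S)"
        by (auto intro!: derivative_eq_intros)
      moreover have "(H has_derivative H' (p + t *\<^sub>R (y - p))) (at (p + t *\<^sub>R (y - p)) within (\<lambda>y. p + t *\<^sub>R (y - p)) ` S)"
        by (rule has_derivative_subset[OF H'(1)[OF seg[OF that(1) t]]]) (use seg t in blast)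
      ultimately have "((\<lambda>y. H (p + t *\<^sub>R (y - p))) has_derivative (\<lambda>v. H' (p + t *\<^sub>R (y - p)) (t *\<^sub>R v))) (at y within S)"
        by (rule has_derivative_in_compose)
      then have "((\<lambda>y. t ^ m * H (p + t *\<^sub>R (y - p))) has_derivative (\<lambda>v. t ^ m * H' (p + t *\<^sub>R (y - p)) (t *\<^sub>R v))) (at y within S)"
        by (rule has_derivative_mult_right)
      moreover have "(\<lambda>v. t ^ m * H' (p + t *\<^sub>R (y - p)) (t *\<^sub>R v)) = blinfun_apply (F y t)"
        using linear_scale[OF has_derivative_linear[OF H'(1)[OF seg[OF that(1) t]]]]
        by (simp add: Fv[OF that(1) t] fun_eq_iff)
      ultimately show ?thesis by simp
    qed
    show ?case
    proof (rule cont_diff_on_SucI)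
      fix y assume y: "y \<in> S"
      have "((\<lambda>y. integral (cbox 0 1) (\<lambda>t. t ^ m * H (p + t *\<^sub>R (y - p)))) has_derivative
          blinfun_apply (integral (cbox 0 1) (F y))) (at y within S)"
      proof (rule leibniz_rule[OF _ _ cF y S(1)])
        show "(\<lambda>t. t ^ m * H (p + t *\<^sub>R (y - p))) integrable_on cbox 0 1" if "y \<in> S" for y
          using integrable_continuous_real[OF cH1[OF that]] by simp
      qed (rule der)
      moreover have "blinfun_apply (integral (cbox 0 1) (F y)) =
          (\<lambda>v. integral {0..1} (\<lambda>t. t ^ Suc m * H' (p + t *\<^sub>R (y - p)) v))"
      proof
        fix v
        have "F y integrable_on {0..1}" by (rule integrable_continuous_real[OF cF1[OF y]])
        then have "blinfun_apply (integral {0..1} (F y)) v = integral {0..1} (\<lambda>t. blinfun_apply (F y t) v)"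
          by (rule blinfun_apply_integral)
        also have "\<dots> = integral {0..1} (\<lambda>t. t ^ Suc m * H' (p + t *\<^sub>R (y - p)) v)"
          by (rule integral_cong) (rule Fv[OF y])
        finally show "blinfun_apply (integral (cbox 0 1) (F y)) v =
          integral {0..1} (\<lambda>t. t ^ Suc m * H' (p + t *\<^sub>R (y - p)) v)" by simp
      qed
      ultimately show "((\<lambda>y. integral {0..1} (\<lambda>t. t ^ m * H (p + t *\<^sub>R (y - p)))) has_derivative
          (\<lambda>v. integral {0..1} (\<lambda>t. t ^ Suc m * H' (p + t *\<^sub>R (y - p)) v))) (at y within S)" by simp
    next
      fix v show "cont_diff_on k S (\<lambda>y. integral {0..1} (\<lambda>t. t ^ Suc m * H' (p + t *\<^sub>R (y - p)) v))"
        by (rule Suc.IH[OF H'(2)])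
    qed
qed
qed

text \<open>Integrate the t-derivative of F (p + t (y - p)) over the unit interval and pull the
  coordinates of y - p out of the integral; convexity keeps the segment inside S.\<close>

lemma hadamard:
  fixes V :: "'e::euclidean_space set" and F :: "'e \<Rightarrow> real"
  assumes V: "subspace V" "openin (top_of_set V) S" and S: "convex S" "p \<in> S"
    and B: "B \<subseteq> V" "\<And>x. x \<in> V \<Longrightarrow> (\<Sum>b\<in>B. (x \<bullet> b) *\<^sub>R b) = x"
    and F: "smooth_on S F"
  obtains g where "\<And>b. b \<in> B \<Longrightarrow> smooth_on S (g b)"
    "\<And>b. b \<in> B \<Longrightarrow> g b p = dir_deriv F b p"
    "\<And>y. y \<in> S \<Longrightarrow> F y - F p = (\<Sum>b\<in>B. ((y - p) \<bullet> b) * g b y)"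
proof
  let ?g = "\<lambda>b y. integral {0..1} (\<lambda>t. dir_deriv F b (p + t *\<^sub>R (y - p)))"
  have sm: "smooth_on S (dir_deriv F b)" if "b \<in> B" for b
    using smooth_on_dir_deriv[OF V _ F] that B(1) by blast
  show "smooth_on S (?g b)" if "b \<in> B" for b
    using cont_diff_on_integral_segment[OF S, of _ "dir_deriv F b" 0] sm[OF that]
    by (simp add: smooth_on_def)
  show "?g b p = dir_deriv F b p" for b by simp
  fix y assume y: "y \<in> S"
  have SV: "S \<subseteq> V" using V(2) openin_imp_subset by blast
  have yp: "y - p \<in> V" using subspace_diff[OF V(1)] SV y S(2) by blast
  note seg = convex_segment_mem[OF S y]
  have der: "((\<lambda>t. F (p + t *\<^sub>R (y - p))) has_vector_derivative
      (\<Sum>b\<in>B. ((y - p) \<bullet> b) * dir_deriv F b (p + t *\<^sub>R (y - p)))) (at t within {0..1})"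
    if t: "t \<in> {0..1}" for t
  proof -
    let ?q = "p + t *\<^sub>R (y - p)"
    obtain D where D: "(F has_derivative D) (at ?q within S)"
      using smooth_on_imp_has_derivative[OF F seg[OF t]] .
    have "((\<lambda>t. p + t *\<^sub>R (y - p)) has_derivative (\<lambda>h. h *\<^sub>R (y - p))) (at t within {0..1})"
      by (auto intro!: derivative_eq_intros)
    moreover have "(F has_derivative D) (at ?q within (\<lambda>t. p + t *\<^sub>R (y - p)) ` {0..1})"
      by (rule has_derivative_subset[OF D]) (use seg in blast)
    ultimately have "((\<lambda>t. F (p + t *\<^sub>R (y - p))) has_derivative (\<lambda>h. D (h *\<^sub>R (y - p)))) (at t within {0..1})"
      by (rule has_derivative_in_compose)
    moreover have lin: "linear D" using has_derivative_linear[OF D] .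
    moreover have "D (y - p) = (\<Sum>b\<in>B. ((y - p) \<bullet> b) * dir_deriv F b ?q)"
    proof -
      have "D (\<Sum>b\<in>B. ((y - p) \<bullet> b) *\<^sub>R b) = (\<Sum>b\<in>B. ((y - p) \<bullet> b) * D b)"
        by (simp add: linear_sum[OF lin] linear_scale[OF lin])
      also have "\<dots> = (\<Sum>b\<in>B. ((y - p) \<bullet> b) * dir_deriv F b ?q)"
        using dir_deriv_eq[OF V seg[OF t] _ D] B(1) by (intro sum.cong) auto
      finally show ?thesis by (simp only: B(2)[OF yp])
    qed
    ultimately show ?thesis by (simp add: has_vector_derivative_def linear_scale)
  qed
  have int: "(\<lambda>t. dir_deriv F b (p + t *\<^sub>R (y - p))) integrable_on {0..1}" if "b \<in> B" for b
  proof (intro integrable_continuous_real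
        continuous_on_compose2[OF smooth_on_imp_continuous_on[OF sm[OF that]]])
    show "continuous_on {0..1} (\<lambda>t. p + t *\<^sub>R (y - p))" by (intro continuous_intros)
  qed (use seg in blast)
  have "((\<lambda>t. \<Sum>b\<in>B. ((y - p) \<bullet> b) * dir_deriv F b (p + t *\<^sub>R (y - p))) has_integral
      (F (p + 1 *\<^sub>R (y - p)) - F (p + 0 *\<^sub>R (y - p)))) {0..1}"
    by (rule fundamental_theorem_of_calculus) (auto intro: der)
  then have "F y - F p = integral {0..1} (\<lambda>t. \<Sum>b\<in>B. ((y - p) \<bullet> b) * dir_deriv F b (p + t *\<^sub>R (y - p)))"
    by (simp add: integral_unique)
  also have "\<dots> = (\<Sum>b\<in>B. integral {0..1} (\<lambda>t. ((y - p) \<bullet> b) * dir_deriv F b (p + t *\<^sub>R (y - p))))"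
  proof (cases "finite B")
    case True
    show ?thesis
      by (rule integral_sum[OF True]) (use integrable_on_cmult_left[OF int] in simp)
  qed simp
  finally show "F y - F p = (\<Sum>b\<in>B. ((y - p) \<bullet> b) * ?g b y)" by simp
qed

section \<open>Smooth functions on a manifold\<close>

text \<open>Functions built from a chart are smooth only on its domain, with arbitrary values
  elsewhere; this relative notion lets them be handled before they are cut off or glued.\<close>

definition smooth_fun_on :: "('a, 'e::euclidean_space) manifold \<Rightarrow> 'a set \<Rightarrow> ('a \<Rightarrow> real) \<Rightarrow> bool" where
  "smooth_fun_on M A f \<longleftrightarrow> (\<forall>(U, c)\<in>charts M. smooth_on (c ` (U \<inter> A)) (f \<circ> inv_into U c))"

lemma smooth_functions_iff: "f \<in> smooth_functions M \<longleftrightarrow> smooth_fun_on M UNIV f"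
  by (simp add: smooth_functions_def smooth_fun_on_def)

lemma smooth_fun_onI:
  assumes "\<And>U c. (U, c) \<in> charts M \<Longrightarrow> smooth_on (c ` (U \<inter> A)) (\<lambda>y. f (inv_into U c y))"
  shows "smooth_fun_on M A f"
  using assms by (auto simp: smooth_fun_on_def comp_def)

lemma smooth_fun_onD:
  assumes "smooth_fun_on M A f" "(U, c) \<in> charts M"
  shows "smooth_on (c ` (U \<inter> A)) (\<lambda>y. f (inv_into U c y))"
  using assms by (auto simp: smooth_fun_on_def comp_def)

locale smooth_mfd =
  fixes M :: "('a::{t2_space,second_countable_topology}, 'e::euclidean_space) manifold"
  assumes mfd: "smooth_manifold M"
begin

lemma subspace_model: "subspace (model M)"
  using mfd by (simp add: smooth_manifold_def)

lemma chart_at: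
  obtains U c where "(U, c) \<in> charts M" "x \<in> U"
proof -
  have "x \<in> (\<Union>(U, c)\<in>charts M. U)" using mfd by (simp add: smooth_manifold_def)
  then show ?thesis using that by auto
qed

lemma chart_transition:
  assumes "(U, c) \<in> charts M" "(W, d) \<in> charts M"
  shows "smooth_on (c ` (U \<inter> W)) (\<lambda>y. d (inv_into U c y))"
  using mfd assms by (fastforce simp: smooth_manifold_def comp_def)

context
  fixes U c assumes Uc: "(U, c) \<in> charts M"
begin

lemma chart_homeo: "homeomorphism U (c ` U) c (inv_into U c)"
  using mfd Uc by (fastforce simp: smooth_manifold_def)

lemma open_chart: "open U"
  using mfd Uc by (fastforce simp: smooth_manifold_def)

lemma inv_chart: "x \<in> U \<Longrightarrow> inv_into U c (c x) = x"
  using chart_homeo by (simp add: homeomorphism_def)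

lemma continuous_on_chart: "continuous_on U c"
  using chart_homeo by (simp add: homeomorphism_def)

lemma continuous_on_inv_chart: "continuous_on (c ` U) (inv_into U c)"
  using chart_homeo by (simp add: homeomorphism_def)

lemma openin_chart_image:
  assumes "open A"
  shows "openin (top_of_set (model M)) (c ` (U \<inter> A))"
proof (rule openin_trans)
  show "openin (top_of_set (c ` U)) (c ` (U \<inter> A))"
    using assms by (intro homeomorphism_imp_open_map[OF chart_homeo] openin_open_Int)
  show "openin (top_of_set (model M)) (c ` U)"
    using mfd Uc by (fastforce simp: smooth_manifold_def)
qed

lemma chart_image_subset: "c ` U \<subseteq> model M"
  using openin_imp_subset[OF openin_chart_image[of UNIV]] by simp

lemma open_chart_preimage:
  assumes "open W" shows "open (U \<inter> c -` W)"
  using continuous_on_open_vimage[OF open_chart] continuous_on_chart assms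
  by (metis inf_commute)

text \<open>Read in any other chart, the function is F after a transition map.\<close>

lemma smooth_fun_on_chart:
  fixes F :: "'e \<Rightarrow> real"
  assumes F: "smooth_on (c ` (U \<inter> A)) F"
  shows "smooth_fun_on M (U \<inter> A) (\<lambda>x. F (c x))"
proof (rule smooth_fun_onI)
  fix W d assume Wd: "(W, d) \<in> charts M"
  have "homeomorphism W (d ` W) d (inv_into W d)"
    using mfd Wd by (fastforce simp: smooth_manifold_def)
  then have inv: "inv_into W d (d x) = x" if "x \<in> W" for x
    using that by (simp add: homeomorphism_def)
  have "smooth_on (d ` (W \<inter> (U \<inter> A))) (\<lambda>y. c (inv_into W d y))"
    by (rule smooth_on_subset[OF chart_transition[OF Wd Uc]]) auto
  moreover have "(\<lambda>y. c (inv_into W d y)) ` d ` (W \<inter> (U \<inter> A)) \<subseteq> c ` (U \<inter> A)"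
    using inv by auto
  ultimately show "smooth_on (d ` (W \<inter> (U \<inter> A))) (\<lambda>y. F (c (inv_into W d y)))"
    using F smooth_on_compose by blast
qed

end

lemma smooth_fun_on_cong:
  assumes "\<And>x. x \<in> A \<Longrightarrow> f x = g x" "smooth_fun_on M A f"
  shows "smooth_fun_on M A g"
proof (rule smooth_fun_onI)
  fix U c assume Uc: "(U, c) \<in> charts M"
  show "smooth_on (c ` (U \<inter> A)) (\<lambda>y. g (inv_into U c y))"
    using smooth_fun_onD[OF assms(2) Uc] assms(1)
    by (subst smooth_on_cong[where g = "\<lambda>y. f (inv_into U c y)"]) (auto simp: inv_chart[OF Uc])
qed

lemma smooth_fun_on_subset: "smooth_fun_on M A f \<Longrightarrow> A' \<subseteq> A \<Longrightarrow> smooth_fun_on M A' f"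
  by (rule smooth_fun_onI, rule smooth_on_subset, rule smooth_fun_onD) auto

lemma smooth_functions_imp_on: "f \<in> smooth_functions M \<Longrightarrow> smooth_fun_on M A f"
  using smooth_fun_on_subset by (auto simp: smooth_functions_iff)

lemma smooth_fun_on_local:
  assumes "open A" and loc: "\<And>x. x \<in> A \<Longrightarrow> \<exists>A'. open A' \<and> x \<in> A' \<and> smooth_fun_on M A' f"
  shows "smooth_fun_on M A f"
proof (rule smooth_fun_onI)
  fix U c assume Uc: "(U, c) \<in> charts M"
  show "smooth_on (c ` (U \<inter> A)) (\<lambda>y. f (inv_into U c y))"
  proof (rule smooth_on_local[OF subspace_model openin_chart_image[OF Uc assms(1)]])
    fix y assume "y \<in> c ` (U \<inter> A)"
    then obtain x where x: "x \<in> U" "x \<in> A" "y = c x" by auto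
    obtain A' where A': "open A'" "x \<in> A'" "smooth_fun_on M A' f" using loc[OF x(2)] by blast
    obtain T where T: "open T" "c ` (U \<inter> A') = model M \<inter> T"
      using openin_chart_image[OF Uc A'(1)] by (auto simp: openin_open)
    have "smooth_on (c ` (U \<inter> A) \<inter> T) (\<lambda>y. f (inv_into U c y))"
      by (rule smooth_on_subset[OF smooth_fun_onD[OF A'(3) Uc]])
         (use T chart_image_subset[OF Uc] in blast)
    then show "\<exists>T. open T \<and> y \<in> T \<and> smooth_on (c ` (U \<inter> A) \<inter> T) (\<lambda>y. f (inv_into U c y))"
      using T x A'(2) by blast
  qed
qed

lemma smooth_fun_on_const: "smooth_fun_on M A (\<lambda>x. a)"
  by (intro smooth_fun_onI smooth_on_const)

lemma smooth_fun_on_add: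
  "smooth_fun_on M A f \<Longrightarrow> smooth_fun_on M A g \<Longrightarrow> smooth_fun_on M A (\<lambda>x. f x + g x)"
  by (intro smooth_fun_onI smooth_on_add) (simp_all add: smooth_fun_onD)

lemma smooth_fun_on_mult:
  "smooth_fun_on M A f \<Longrightarrow> smooth_fun_on M A g \<Longrightarrow> smooth_fun_on M A (\<lambda>x. f x * g x)"
  by (intro smooth_fun_onI smooth_on_mult) (simp_all add: smooth_fun_onD)

lemma smooth_fun_on_exp: "smooth_fun_on M A f \<Longrightarrow> smooth_fun_on M A (\<lambda>x. exp (f x))"
  by (intro smooth_fun_onI smooth_on_exp) (simp_all add: smooth_fun_onD)

lemma smooth_fun_on_inverse:
  assumes "smooth_fun_on M A f" "\<And>x. x \<in> A \<Longrightarrow> f x \<noteq> 0"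
  shows "smooth_fun_on M A (\<lambda>x. inverse (f x))"
  by (intro smooth_fun_onI smooth_on_inverse smooth_fun_onD[OF assms(1)])
     (auto simp: inv_chart assms(2))

lemma smooth_fun_on_divide:
  assumes "smooth_fun_on M A f" "smooth_fun_on M A g" "\<And>x. x \<in> A \<Longrightarrow> g x \<noteq> 0"
  shows "smooth_fun_on M A (\<lambda>x. f x / g x)"
  using smooth_fun_on_mult[OF assms(1) smooth_fun_on_inverse[OF assms(2,3)]]
  by (simp add: divide_inverse)

lemma smooth_fun_on_ln:
  assumes "smooth_fun_on M A f" "\<And>x. x \<in> A \<Longrightarrow> f x > 0"
  shows "smooth_fun_on M A (\<lambda>x. ln (f x))"
  by (intro smooth_fun_onI smooth_on_ln smooth_fun_onD[OF assms(1)])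
     (auto simp: inv_chart assms(2))

section \<open>The algebra of globally smooth functions, and cutoffs\<close>

lemma smooth_const: "(\<lambda>x. a) \<in> smooth_functions M"
  by (simp add: smooth_functions_iff smooth_fun_on_const)

lemma smooth_add:
  "f \<in> smooth_functions M \<Longrightarrow> g \<in> smooth_functions M \<Longrightarrow> (\<lambda>x. f x + g x) \<in> smooth_functions M"
  by (simp add: smooth_functions_iff smooth_fun_on_add)

lemma smooth_mult:
  "f \<in> smooth_functions M \<Longrightarrow> g \<in> smooth_functions M \<Longrightarrow> (\<lambda>x. f x * g x) \<in> smooth_functions M"
  by (simp add: smooth_functions_iff smooth_fun_on_mult)

lemma smooth_lincomb:
  "f \<in> smooth_functions M \<Longrightarrow> g \<in> smooth_functions M \<Longrightarrow> (\<lambda>x. a * f x + b * g x) \<in> smooth_functions M"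
  by (intro smooth_add smooth_mult smooth_const)

lemma smooth_diff:
  "f \<in> smooth_functions M \<Longrightarrow> g \<in> smooth_functions M \<Longrightarrow> (\<lambda>x. f x - g x) \<in> smooth_functions M"
  using smooth_lincomb[of f g 1 "-1"] by simp

lemma smooth_sum:
  "(\<And>i. i \<in> I \<Longrightarrow> f i \<in> smooth_functions M) \<Longrightarrow> (\<lambda>x. \<Sum>i\<in>I. f i x) \<in> smooth_functions M"
  by (induction I rule: infinite_finite_induct) (auto intro: smooth_const smooth_add)

lemma smooth_exp: "f \<in> smooth_functions M \<Longrightarrow> (\<lambda>x. exp (f x)) \<in> smooth_functions M"
  by (simp add: smooth_functions_iff smooth_fun_on_exp)

lemma smooth_power: "f \<in> smooth_functions M \<Longrightarrow> (\<lambda>x. f x ^ n) \<in> smooth_functions M"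
  by (induction n) (auto intro: smooth_const smooth_mult)

text \<open>The open sets A and - K cover the manifold: on the first the function is a product of
  smooth functions, on the second it vanishes.\<close>

lemma smooth_cutoff:
  assumes \<rho>: "\<rho> \<in> smooth_functions M" and K: "closed K" "K \<subseteq> A" "\<And>x. x \<notin> K \<Longrightarrow> \<rho> x = 0"
    and f: "open A" "smooth_fun_on M A f"
  shows "(\<lambda>x. \<rho> x * f x) \<in> smooth_functions M"
  unfolding smooth_functions_iff
proof (rule smooth_fun_on_local[OF open_UNIV])
  fix x
  show "\<exists>A'. open A' \<and> x \<in> A' \<and> smooth_fun_on M A' (\<lambda>x. \<rho> x * f x)"
  proof (cases "x \<in> K")
    case True
    then show ?thesis
      using K(2) f smooth_fun_on_mult[OF smooth_functions_imp_on[OF \<rho>] f(2)] by blast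
  next
    case False
    have "smooth_fun_on M (- K) (\<lambda>x. \<rho> x * f x)"
      by (rule smooth_fun_on_cong[OF _ smooth_fun_on_const[of _ 0]]) (simp add: K(3))
    then show ?thesis using False K(1) by (intro exI[of _ "- K"]) auto
  qed
qed

lemma bump_function:
  assumes A: "open A" "x \<in> A"
  obtains \<rho> K where "\<rho> \<in> smooth_functions M" "\<rho> x = 1" "closed K" "K \<subseteq> A" "\<And>y. y \<notin> K \<Longrightarrow> \<rho> y = 0"
proof -
  obtain U c where Uc: "(U, c) \<in> charts M" and x: "x \<in> U" by (rule chart_at)
  obtain T where T: "open T" "c ` (U \<inter> A) = model M \<inter> T"
    using openin_chart_image[OF Uc A(1)] by (auto simp: openin_open)
  have "c x \<in> T" using T(2) x A(2) by blast
  then obtain r where r: "r > 0" "cball (c x) r \<subseteq> T" using T(1) open_contains_cball by blast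
  define K' where "K' = model M \<inter> cball (c x) r"
  have K': "K' \<subseteq> c ` (U \<inter> A)" using T r K'_def by auto
  define K where "K = inv_into U c ` K'"
  have "compact K'"
    unfolding K'_def using subspace_model by (intro closed_Int_compact closed_subspace compact_cball)
  moreover have "continuous_on K' (inv_into U c)"
    using continuous_on_subset[OF continuous_on_inv_chart[OF Uc]] K' by blast
  \<comment> \<open>As a compact subset of a Hausdorff space, K is closed in the whole manifold and
    not merely in U. This is what allows extension by zero.\<close>
  ultimately have "closed K" unfolding K_def by (intro compact_imp_closed compact_continuous_image)
  have KA: "K \<subseteq> U \<inter> A"
  proof
    fix y assume "y \<in> K"
    then obtain z where "z \<in> U \<inter> A" "y = inv_into U c (c z)" using K' unfolding K_def by blast
    then show "y \<in> U \<inter> A" using inv_chart[OF Uc] by simp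
  qed
  \<comment> \<open>The factor exp (1 / r^2) cancels the value exp (- 1 / r^2) of the bump at its
    centre, so that the function is 1 at x.\<close>
  define \<psi> where "\<psi> v = flat_exp 0 (r\<^sup>2 - (v - c x) \<bullet> (v - c x)) * exp (inverse (r\<^sup>2))" for v :: 'e
  have "smooth_on UNIV (\<lambda>v::'e. v - c x)"
    using smooth_on_add[OF smooth_on_bounded_linear[OF bounded_linear_ident] smooth_on_const[of _ "- c x"]]
    by simp
  then have "smooth_on UNIV (\<lambda>v. flat_exp 0 (r\<^sup>2 - (v - c x) \<bullet> (v - c x)))"
    by (rule smooth_on_compose[OF _ smooth_on_bump]) simp
  then have sm: "smooth_on UNIV \<psi>"
    unfolding \<psi>_def by (intro smooth_on_mult smooth_on_const)
  have outside: "\<psi> (c y) = 0" if y: "y \<in> U" "y \<notin> K" for y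
  proof -
    have "c y \<in> model M" using chart_image_subset[OF Uc] y by auto
    moreover have "c y \<notin> K'" using y inv_chart[OF Uc y(1)] unfolding K_def by force
    ultimately have "dist (c x) (c y) > r" by (simp add: K'_def)
    then have "r < norm (c y - c x)" by (simp add: dist_norm norm_minus_commute)
    then have "r\<^sup>2 < (norm (c y - c x))\<^sup>2" using r(1) by (intro power_strict_mono) auto
    then show ?thesis by (simp add: \<psi>_def flat_exp_def power2_norm_eq_inner)
  qed
  define \<rho> where "\<rho> y = (if y \<in> U then \<psi> (c y) else 0)" for y
  have 1: "\<rho> y = 0" if "y \<notin> K" for y using outside that by (simp add: \<rho>_def)
  have "smooth_fun_on M UNIV \<rho>"
  proof (rule smooth_fun_on_local[OF open_UNIV])
    fix y
    show "\<exists>A'. open A' \<and> y \<in> A' \<and> smooth_fun_on M A' \<rho>"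
    proof (cases "y \<in> U")
      case True
      have "smooth_fun_on M (U \<inter> UNIV) (\<lambda>y. \<psi> (c y))"
        by (rule smooth_fun_on_chart[OF Uc smooth_on_subset[OF sm]]) simp
      then have "smooth_fun_on M U \<rho>"
        by (intro smooth_fun_on_cong[of U "\<lambda>y. \<psi> (c y)" \<rho>]) (auto simp: \<rho>_def)
      then show ?thesis using True open_chart[OF Uc] by blast
    next
      case False
      have "smooth_fun_on M (- K) \<rho>"
        by (rule smooth_fun_on_cong[OF _ smooth_fun_on_const[of _ 0]]) (simp add: 1)
      then show ?thesis using False KA \<open>closed K\<close> by (intro exI[of _ "- K"]) auto
    qed
  qed
  moreover have "\<rho> x = 1"
    using x r(1) by (simp add: \<rho>_def \<psi>_def flat_exp_def exp_minus)
  ultimately show ?thesis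
    using that[of \<rho> K] 1 KA \<open>closed K\<close> by (simp add: smooth_functions_iff)
qed

end

text \<open>On the preimage of a chart domain W, open by continuity of \<phi>, the composite in
  coordinates is f read in W after \<phi> read in the two charts.\<close>

lemma smooth_map_compose:
  assumes M: "smooth_manifold M" and N: "smooth_manifold N" and \<phi>: "smooth_map M N \<phi>"
    and f: "f \<in> smooth_functions N"
  shows "f \<circ> \<phi> \<in> smooth_functions M"
proof -
  interpret M: smooth_mfd M by unfold_locales (rule M)
  interpret N: smooth_mfd N by unfold_locales (rule N)
  show ?thesis unfolding smooth_functions_iff
  proof (rule M.smooth_fun_on_local[OF open_UNIV])
    fix x
    obtain W d where Wd: "(W, d) \<in> charts N" "\<phi> x \<in> W" by (rule N.chart_at)
    have op: "open (\<phi> -` W)"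
      using \<phi> N.open_chart[OF Wd(1)] by (auto simp: smooth_map_def intro: open_vimage)
    have "smooth_fun_on M (\<phi> -` W) (f \<circ> \<phi>)"
    proof (rule smooth_fun_onI)
      fix U c assume Uc: "(U, c) \<in> charts M"
      have 1: "smooth_on (c ` (U \<inter> \<phi> -` W)) (\<lambda>y. d (\<phi> (inv_into U c y)))"
        using \<phi> Uc Wd(1) by (fastforce simp: smooth_map_def comp_def)
      have 2: "smooth_on (d ` W) (\<lambda>z. f (inv_into W d z))"
        using smooth_fun_onD[OF f[unfolded smooth_functions_iff] Wd(1)] by simp
      have "smooth_on (c ` (U \<inter> \<phi> -` W)) (\<lambda>y. f (inv_into W d (d (\<phi> (inv_into U c y)))))"
        by (rule smooth_on_compose[OF 1 2]) (auto simp: M.inv_chart[OF Uc])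
      then show "smooth_on (c ` (U \<inter> \<phi> -` W)) (\<lambda>y. (f \<circ> \<phi>) (inv_into U c y))"
        by (rule smooth_on_cong[THEN iffD1, rotated])
           (auto simp: M.inv_chart[OF Uc] N.inv_chart[OF Wd(1)])
    qed
    then show "\<exists>A'. open A' \<and> x \<in> A' \<and> smooth_fun_on M A' (f \<circ> \<phi>)" using op Wd(2) by blast
  qed
qed

section \<open>Tangent vectors and local frames\<close>

lemma tangent_spaceI:
  assumes "\<And>f. f \<notin> smooth_functions M \<Longrightarrow> v f = 0"
    and "\<And>f g a b. f \<in> smooth_functions M \<Longrightarrow> g \<in> smooth_functions M \<Longrightarrow>
      v (\<lambda>y. a * f y + b * g y) = a * v f + b * v g"
    and "\<And>f g. f \<in> smooth_functions M \<Longrightarrow> g \<in> smooth_functions M \<Longrightarrow>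
      v (\<lambda>y. f y * g y) = f x * v g + g x * v f"
  shows "v \<in> tangent_space M x"
  using assms by (simp add: tangent_space_def)

lemma tangent_nonsmooth: "v \<in> tangent_space M x \<Longrightarrow> f \<notin> smooth_functions M \<Longrightarrow> v f = 0"
  by (simp add: tangent_space_def)

lemma tangent_lincomb:
  "v \<in> tangent_space M x \<Longrightarrow> f \<in> smooth_functions M \<Longrightarrow> g \<in> smooth_functions M \<Longrightarrow>
    v (\<lambda>y. a * f y + b * g y) = a * v f + b * v g"
  by (simp add: tangent_space_def)

lemma tangent_mult:
  "v \<in> tangent_space M x \<Longrightarrow> f \<in> smooth_functions M \<Longrightarrow> g \<in> smooth_functions M \<Longrightarrow>
    v (\<lambda>y. f y * g y) = f x * v g + g x * v f"
  by (simp add: tangent_space_def)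

lemma tangent_add:
  "v \<in> tangent_space M x \<Longrightarrow> f \<in> smooth_functions M \<Longrightarrow> g \<in> smooth_functions M \<Longrightarrow>
    v (\<lambda>y. f y + g y) = v f + v g"
  using tangent_lincomb[of v M x f g 1 1] by simp

lemma tangent_diff:
  "v \<in> tangent_space M x \<Longrightarrow> f \<in> smooth_functions M \<Longrightarrow> g \<in> smooth_functions M \<Longrightarrow>
    v (\<lambda>y. f y - g y) = v f - v g"
  using tangent_lincomb[of v M x f g 1 "-1"] by simp

lemma tangent_space_zero: "(\<lambda>f. 0) \<in> tangent_space M x"
  by (rule tangent_spaceI) auto

lemma tangent_space_lincomb:
  assumes "v \<in> tangent_space M x" "w \<in> tangent_space M x"
  shows "(\<lambda>f. a * v f + b * w f) \<in> tangent_space M x"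
  using assms
  by (intro tangent_spaceI)
     (simp_all add: tangent_nonsmooth[where x = x and M = M] tangent_lincomb[where x = x and M = M]
        tangent_mult[where x = x and M = M], simp_all add: algebra_simps)

lemma tangent_space_sum:
  assumes "finite I" "\<And>i. i \<in> I \<Longrightarrow> v i \<in> tangent_space M x"
  shows "(\<lambda>f. \<Sum>i\<in>I. a i * v i f) \<in> tangent_space M x"
  using assms
proof (induction I rule: finite_induct)
  case empty
  then show ?case by (simp add: tangent_space_zero)
next
  case (insert i I)
  then show ?case
    using tangent_space_lincomb[of "v i" M x "\<lambda>f. \<Sum>i\<in>I. a i * v i f" "a i" 1] by simp
qed

lemma vector_fieldsI:
  assumes "\<And>x. Y x \<in> tangent_space M x"
    "\<And>f. f \<in> smooth_functions M \<Longrightarrow> (\<lambda>x. Y x f) \<in> smooth_functions M"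
  shows "Y \<in> vector_fields M"
  using assms by (simp add: vector_fields_along_def)

lemma vector_fields_tangent: "Y \<in> vector_fields M \<Longrightarrow> Y x \<in> tangent_space M x"
  by (simp add: vector_fields_along_def)

lemma vector_fields_smooth:
  "Y \<in> vector_fields M \<Longrightarrow> f \<in> smooth_functions M \<Longrightarrow> (\<lambda>x. Y x f) \<in> smooth_functions M"
  by (simp add: vector_fields_along_def)

context smooth_mfd begin

lemma tangent_const:
  assumes "v \<in> tangent_space M x"
  shows "v (\<lambda>y. a) = 0"
proof -
  have "v (\<lambda>y. 1 * 1) = 1 * v (\<lambda>y. 1) + 1 * v (\<lambda>y. 1)"
    using tangent_mult[OF assms smooth_const smooth_const, of 1 1] by simp
  then have "v (\<lambda>y. 1) = 0" by simp
  then show ?thesis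
    using tangent_lincomb[OF assms smooth_const smooth_const, of a 1 0 0] by simp
qed

lemma tangent_cmult:
  assumes "v \<in> tangent_space M x" "f \<in> smooth_functions M"
  shows "v (\<lambda>y. a * f y) = a * v f"
  using tangent_lincomb[OF assms smooth_const, of a 0 0] by simp

lemma tangent_sum:
  assumes "v \<in> tangent_space M x" "\<And>i. i \<in> I \<Longrightarrow> f i \<in> smooth_functions M"
  shows "v (\<lambda>y. \<Sum>i\<in>I. f i y) = (\<Sum>i\<in>I. v (f i))"
  using assms(2)
proof (induction I rule: infinite_finite_induct)
  case (insert i I)
  then show ?case using tangent_add[OF assms(1), of "f i" "\<lambda>y. \<Sum>i\<in>I. f i y"]
    by (simp add: smooth_sum)
qed (simp_all add: tangent_const[OF assms(1)])

lemma vector_fields_lincomb: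
  assumes "g \<in> smooth_functions M" "h \<in> smooth_functions M" "Y \<in> vector_fields M" "Z \<in> vector_fields M"
  shows "(\<lambda>x f. g x * Y x f + h x * Z x f) \<in> vector_fields M"
proof (rule vector_fieldsI)
  show "(\<lambda>f. g x * Y x f + h x * Z x f) \<in> tangent_space M x" for x
    by (rule tangent_space_lincomb[OF vector_fields_tangent[OF assms(3)] vector_fields_tangent[OF assms(4)]])
  show "(\<lambda>x. g x * Y x f + h x * Z x f) \<in> smooth_functions M" if "f \<in> smooth_functions M" for f
    by (rule smooth_add[OF smooth_mult[OF assms(1) vector_fields_smooth[OF assms(3) that]]
          smooth_mult[OF assms(2) vector_fields_smooth[OF assms(4) that]]])
qed

lemma vector_fields_sum:
  assumes "finite I" "\<And>i. i \<in> I \<Longrightarrow> g i \<in> smooth_functions M" "\<And>i. i \<in> I \<Longrightarrow> Y i \<in> vector_fields M"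
  shows "(\<lambda>x f. \<Sum>i\<in>I. g i x * Y i x f) \<in> vector_fields M"
proof (rule vector_fieldsI)
  show "(\<lambda>f. \<Sum>i\<in>I. g i x * Y i x f) \<in> tangent_space M x" for x
    by (rule tangent_space_sum[OF assms(1) vector_fields_tangent[OF assms(3)]])
  show "(\<lambda>x. \<Sum>i\<in>I. g i x * Y i x f) \<in> smooth_functions M" if "f \<in> smooth_functions M" for f
    by (rule smooth_sum, rule smooth_mult[OF assms(2) vector_fields_smooth[OF assms(3) that]])
qed

text \<open>The coordinate derivation along b, damped by \<rho>. Off U the chart and its inverse
  have arbitrary values, but \<rho> vanishes there, so this is a vector field on the whole manifold.
  The conditional implements the convention that tangent vectors vanish on non-smooth
  functions.\<close>

definition coord_field :: "'a set \<Rightarrow> ('a \<Rightarrow> 'e) \<Rightarrow> ('a \<Rightarrow> real) \<Rightarrow> 'e \<Rightarrow> 'a \<Rightarrow> 'a tangent" where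
  "coord_field U c \<rho> b y f =
     (if f \<in> smooth_functions M then \<rho> y * dir_deriv (\<lambda>w. f (inv_into U c w)) b (c y) else 0)"

context
  fixes U c \<rho> K
  assumes Uc: "(U, c) \<in> charts M" and \<rho>: "\<rho> \<in> smooth_functions M"
    and K: "closed K" "K \<subseteq> U" "\<And>x. x \<notin> K \<Longrightarrow> \<rho> x = 0"
begin

lemma openin_chart: "openin (top_of_set (model M)) (c ` U)"
  using openin_chart_image[OF Uc, of UNIV] by simp

lemma smooth_in_chart: "f \<in> smooth_functions M \<Longrightarrow> smooth_on (c ` U) (\<lambda>w. f (inv_into U c w))"
  using smooth_fun_onD[OF _ Uc, of UNIV f] by (simp add: smooth_functions_iff)

lemma smooth_cutoff_chart:
  assumes "smooth_on (c ` U) F"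
  shows "(\<lambda>y. \<rho> y * F (c y)) \<in> smooth_functions M"
proof -
  have "smooth_fun_on M (U \<inter> UNIV) (\<lambda>y. F (c y))"
    by (rule smooth_fun_on_chart[OF Uc]) (simp add: assms)
  then show ?thesis using smooth_cutoff[OF \<rho> K open_chart[OF Uc]] by simp
qed

lemma coord_field_vector_field:
  assumes b: "b \<in> model M"
  shows "coord_field U c \<rho> b \<in> vector_fields M"
proof (rule vector_fieldsI)
  fix y
  show "coord_field U c \<rho> b y \<in> tangent_space M y"
  proof (cases "y \<in> U")
    case True
    then have cy: "c y \<in> c ` U" by simp
    show ?thesis
    proof (rule tangent_spaceI)
      fix f g :: "'a \<Rightarrow> real" and a b' :: real
      assume f: "f \<in> smooth_functions M" and g: "g \<in> smooth_functions M"
      show "coord_field U c \<rho> b y (\<lambda>y. a * f y + b' * g y) = a * coord_field U c \<rho> b y f + b' * coord_field U c \<rho> b y g"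
        using dir_deriv_lincomb[OF subspace_model openin_chart smooth_in_chart[OF f] smooth_in_chart[OF g] cy b]
        by (simp add: coord_field_def f g smooth_lincomb algebra_simps)
      show "coord_field U c \<rho> b y (\<lambda>y. f y * g y) = f y * coord_field U c \<rho> b y g + g y * coord_field U c \<rho> b y f"
        using dir_deriv_mult[OF subspace_model openin_chart smooth_in_chart[OF f] smooth_in_chart[OF g] cy b]
        by (simp add: coord_field_def f g smooth_mult inv_chart[OF Uc True] algebra_simps)
    qed (simp add: coord_field_def)
  next
    case False
    then have "\<rho> y = 0" using K by blast
    then have "coord_field U c \<rho> b y = (\<lambda>f. 0)" by (simp add: coord_field_def fun_eq_iff)
    then show ?thesis by (simp add: tangent_space_zero)
  qed
next
  fix f assume f: "f \<in> smooth_functions M"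
  then have "(\<lambda>x. coord_field U c \<rho> b x f) = (\<lambda>x. \<rho> x * dir_deriv (\<lambda>w. f (inv_into U c w)) b (c x))"
    by (simp add: coord_field_def)
  moreover have "\<dots> \<in> smooth_functions M"
    by (rule smooth_cutoff_chart) (rule smooth_on_dir_deriv[OF subspace_model openin_chart b smooth_in_chart[OF f]])
  ultimately show "(\<lambda>x. coord_field U c \<rho> b x f) \<in> smooth_functions M" by simp
qed

lemma coord_field_exp:
  assumes "b \<in> model M" "h \<in> smooth_functions M" "y \<in> U"
  shows "coord_field U c \<rho> b y (\<lambda>x. exp (h x)) = exp (h y) * coord_field U c \<rho> b y h"
  using dir_deriv_exp[OF subspace_model openin_chart smooth_in_chart[OF assms(2)], of "c y" b] assms
  by (simp add: coord_field_def smooth_exp inv_chart[OF Uc])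

text \<open>Hadamard's lemma, multiplied by cutoff functions, becomes an identity between globally
  smooth functions, to which a derivation can be applied.\<close>

lemma tangent_chart_expansion:
  assumes B: "B \<subseteq> model M" "\<And>x. x \<in> model M \<Longrightarrow> (\<Sum>b\<in>B. (x \<bullet> b) *\<^sub>R b) = x"
    and y: "y \<in> U" and v: "v \<in> tangent_space M y" and f: "f \<in> smooth_functions M"
  shows "\<rho> y * v f = (\<Sum>b\<in>B. v (\<lambda>z. \<rho> z * ((c z - c y) \<bullet> b)) * dir_deriv (\<lambda>w. f (inv_into U c w)) b (c y))"
proof -
  let ?F = "\<lambda>w. f (inv_into U c w)"
  obtain T where T: "open T" "c ` U = model M \<inter> T"
    using openin_chart by (auto simp: openin_open)
  have cy: "c y \<in> T" "c y \<in> model M" using T(2) y by auto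
  then obtain r where r: "r > 0" "ball (c y) r \<subseteq> T" using T(1) open_contains_ball by blast
  \<comment> \<open>Hadamard's lemma asks for a convex domain, hence a ball within the chart
    image.\<close>
  define S where "S = model M \<inter> ball (c y) r"
  have S: "openin (top_of_set (model M)) S" "convex S" "c y \<in> S" "S \<subseteq> c ` U"
    unfolding S_def using r cy T(2)
    by (auto intro: openin_open_Int convex_Int subspace_imp_convex subspace_model)
  obtain g where g: "\<And>b. b \<in> B \<Longrightarrow> smooth_on S (g b)"
    "\<And>b. b \<in> B \<Longrightarrow> g b (c y) = dir_deriv ?F b (c y)"
    "\<And>w. w \<in> S \<Longrightarrow> ?F w - ?F (c y) = (\<Sum>b\<in>B. ((w - c y) \<bullet> b) * g b w)"
    using hadamard[OF subspace_model S(1-3) B smooth_on_subset[OF smooth_in_chart[OF f] S(4)]] by blast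
  define A where "A = U \<inter> c -` ball (c y) r"
  have A: "open A" "y \<in> A" using open_chart_preimage[OF Uc] y r(1) by (auto simp: A_def)
  have cA: "c ` (U \<inter> A) \<subseteq> S" "U \<inter> A = A" using T(2) by (auto simp: A_def S_def)
  \<comment> \<open>\<rho> makes the coordinates global, but the Hadamard coefficients exist only
    over the ball; they get a second cutoff supported in A.\<close>
  obtain \<theta> L where \<theta>: "\<theta> \<in> smooth_functions M" "\<theta> y = 1" "closed L" "L \<subseteq> A" "\<And>z. z \<notin> L \<Longrightarrow> \<theta> z = 0"
    by (rule bump_function[OF A]) (rule that)
  define P where "P b z = \<rho> z * ((c z - c y) \<bullet> b)" for b z
  define Q where "Q b z = \<theta> z * g b (c z)" for b z
  have P: "P b \<in> smooth_functions M" for b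
  proof -
    have "smooth_on (c ` U) (\<lambda>w. (w + (- c y)) \<bullet> b)"
      by (intro smooth_on_inner_left smooth_on_add smooth_on_const smooth_on_bounded_linear bounded_linear_ident)
    then show ?thesis using smooth_cutoff_chart[of "\<lambda>w. (w + (- c y)) \<bullet> b"] by (simp add: P_def[abs_def])
  qed
  have Q: "Q b \<in> smooth_functions M" if "b \<in> B" for b
    unfolding Q_def
    using smooth_fun_on_chart[OF Uc smooth_on_subset[OF g(1)[OF that] cA(1)]] cA(2)
    by (intro smooth_cutoff[OF \<theta>(1,3,4,5) A(1)]) simp_all
  have fy: "(\<lambda>z. f z - f y) \<in> smooth_functions M" by (intro smooth_diff f smooth_const)
  have "\<theta> z * (\<rho> z * (f z - f y)) = (\<Sum>b\<in>B. P b z * Q b z)" for z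
  proof (cases "z \<in> A")
    case True
    then have z: "z \<in> U" "c z \<in> S" using cA by (auto simp: A_def)
    then have "f z - f y = (\<Sum>b\<in>B. ((c z - c y) \<bullet> b) * g b (c z))"
      using g(3)[OF z(2)] by (simp add: inv_chart[OF Uc] y)
    then show ?thesis by (simp add: P_def Q_def sum_distrib_left mult_ac)
  next
    case False
    then have "\<theta> z = 0" using \<theta>(4,5) by blast
    then show ?thesis by (simp add: Q_def)
  qed
  then have eq: "(\<lambda>z. \<theta> z * (\<rho> z * (f z - f y))) = (\<lambda>z. \<Sum>b\<in>B. P b z * Q b z)" by blast
  \<comment> \<open>At y the difference f z - f y vanishes and \<theta> is 1, so the Leibniz rule
    leaves only \<open>\<rho> y * v f\<close>. On the other side each \<open>P b\<close> vanishes at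
    y, which leaves \<open>v (P b)\<close> times the value of \<open>Q b\<close> at y.\<close>
  have "v (\<lambda>z. \<theta> z * (\<rho> z * (f z - f y))) = \<rho> y * v f"
    using tangent_mult[OF v \<theta>(1) smooth_mult[OF \<rho> fy]] tangent_mult[OF v \<rho> fy]
      tangent_diff[OF v f smooth_const] tangent_const[OF v] \<theta>(2) by simp
  moreover have "v (\<lambda>z. \<Sum>b\<in>B. P b z * Q b z) = (\<Sum>b\<in>B. v (P b) * dir_deriv ?F b (c y))"
  proof -
    have "v (\<lambda>z. \<Sum>b\<in>B. P b z * Q b z) = (\<Sum>b\<in>B. v (\<lambda>z. P b z * Q b z))"
      by (rule tangent_sum[OF v]) (intro smooth_mult P Q)
    also have "\<dots> = (\<Sum>b\<in>B. v (P b) * dir_deriv ?F b (c y))"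
    proof (rule sum.cong[OF refl])
      fix b assume b: "b \<in> B"
      show "v (\<lambda>z. P b z * Q b z) = v (P b) * dir_deriv ?F b (c y)"
        using tangent_mult[OF v P[of b] Q[OF b]] \<theta>(2) g(2)[OF b] by (simp add: P_def Q_def)
    qed
    finally show ?thesis .
  qed
  ultimately show ?thesis by (simp add: eq P_def[abs_def])
qed

end

text \<open>The fields of E are global and cut off, so they express another field Y only near x. The
  factor \<psi>, equal to 1 at x, turns this into an equation between global fields, to which
  functionals of vector fields can be applied. The clause on \<open>exp\<close> keeps the one piece
  of coordinate calculus that has to survive once charts are forgotten.\<close>

definition frame_at :: "'a \<Rightarrow> (nat \<Rightarrow> 'a \<Rightarrow> 'a tangent) \<Rightarrow> bool" where
  "frame_at x E \<longleftrightarrow>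
    (\<forall>i<mdim M. E i \<in> vector_fields M) \<and>
    (\<forall>v\<in>tangent_space M x. \<exists>a. v = (\<lambda>f. \<Sum>i<mdim M. a i * E i x f)) \<and>
    (\<forall>Y\<in>vector_fields M. \<exists>A \<psi>. \<psi> \<in> smooth_functions M \<and> \<psi> x = 1 \<and>
       (\<forall>i<mdim M. A i \<in> smooth_functions M) \<and>
       (\<lambda>y f. \<psi> y * Y y f) = (\<lambda>y f. \<Sum>i<mdim M. A i y * E i y f)) \<and>
    (\<forall>i<mdim M. \<forall>h\<in>smooth_functions M. E i x (\<lambda>y. exp (h y)) = exp (h x) * E i x h)"

lemma frame_at_vector_field: "frame_at x E \<Longrightarrow> i < mdim M \<Longrightarrow> E i \<in> vector_fields M"
  by (simp add: frame_at_def)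

lemma frame_at_span:
  assumes "frame_at x E" "v \<in> tangent_space M x"
  obtains a where "v = (\<lambda>f. \<Sum>i<mdim M. a i * E i x f)"
  using assms unfolding frame_at_def by blast

lemma frame_at_expand:
  assumes "frame_at x E" "Y \<in> vector_fields M"
  obtains A \<psi> where "\<psi> \<in> smooth_functions M" "\<psi> x = 1" "\<forall>i<mdim M. A i \<in> smooth_functions M"
    "(\<lambda>y f. \<psi> y * Y y f) = (\<lambda>y f. \<Sum>i<mdim M. A i y * E i y f)"
  using assms unfolding frame_at_def by blast

lemma frame_exists:
  obtains E where "frame_at x E"
proof -
  obtain U c where Uc: "(U, c) \<in> charts M" and x: "x \<in> U" by (rule chart_at)
  obtain \<rho> K where \<rho>: "\<rho> \<in> smooth_functions M" "\<rho> x = 1" "closed K" "K \<subseteq> U" "\<And>z. z \<notin> K \<Longrightarrow> \<rho> z = 0"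
    by (rule bump_function[OF open_chart[OF Uc] x]) (rule that)
  note ctx = Uc \<rho>(1,3,4,5)
  obtain B where B: "finite B" "B \<subseteq> model M" "card B = mdim M"
      "\<And>w. w \<in> model M \<Longrightarrow> (\<Sum>b\<in>B. (w \<bullet> b) *\<^sub>R b) = w"
    using orthonormal_basis_subspaceE[OF subspace_model] unfolding mdim_def by metis
  obtain \<beta> where \<beta>: "bij_betw \<beta> {..<mdim M} B"
    using ex_bij_betw_nat_finite[OF B(1)] B(3) by (auto simp: atLeast0LessThan)
  have \<beta>B: "\<beta> i \<in> B" if "i < mdim M" for i using \<beta> that by (auto simp: bij_betw_def)
  have sumB: "(\<Sum>b\<in>B. G b) = (\<Sum>i<mdim M. G (\<beta> i))" for G :: "'e \<Rightarrow> real"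
    using sum.reindex_bij_betw[OF \<beta>, of G] by simp
  define E where "E i = coord_field U c \<rho> (\<beta> i)" for i
  \<comment> \<open>One factor \<open>\<rho> y\<close> comes from the expansion in the chart, the
    other from the damping of the coordinate fields. Off U both sides are 0.\<close>
  have exp1: "\<rho> y * \<rho> y * v f = (\<Sum>i<mdim M. v (\<lambda>z. \<rho> z * ((c z - c y) \<bullet> \<beta> i)) * E i y f)"
    if "v \<in> tangent_space M y" for v y f
  proof (cases "f \<in> smooth_functions M")
    case f: True
    show ?thesis
    proof (cases "y \<in> U")
      case True
      have tce: "\<rho> y * v f = (\<Sum>b\<in>B. v (\<lambda>z. \<rho> z * ((c z - c y) \<bullet> b)) *
          dir_deriv (\<lambda>w. f (inv_into U c w)) b (c y))"
        by (rule tangent_chart_expansion[OF ctx B(2,4) True that f])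
      have "\<rho> y * \<rho> y * v f = \<rho> y * (\<rho> y * v f)" by simp
      also have "\<dots> = (\<Sum>i<mdim M. v (\<lambda>z. \<rho> z * ((c z - c y) \<bullet> \<beta> i)) * E i y f)"
        unfolding tce sumB sum_distrib_left by (rule sum.cong[OF refl]) (simp add: E_def coord_field_def f)
      finally show ?thesis .
    next
      case False
      then have "\<rho> y = 0" using \<rho>(4,5) by blast
      then show ?thesis by (simp add: E_def coord_field_def f)
    qed
  next
    case False
    then show ?thesis using tangent_nonsmooth[OF that False] by (simp add: E_def coord_field_def)
  qed
  show ?thesis
  proof (rule that[of E], unfold frame_at_def, intro conjI allI impI ballI)
    show "E i \<in> vector_fields M" if "i < mdim M" for i
      unfolding E_def by (rule coord_field_vector_field[OF ctx subsetD[OF B(2) \<beta>B[OF that]]])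
    show "\<exists>a. v = (\<lambda>f. \<Sum>i<mdim M. a i * E i x f)" if "v \<in> tangent_space M x" for v
    proof (intro exI ext)
      show "v f = (\<Sum>i<mdim M. v (\<lambda>z. \<rho> z * ((c z - c x) \<bullet> \<beta> i)) * E i x f)" for f
        using exp1[OF that, of f] \<rho>(2) by simp
    qed
    show "E i x (\<lambda>y. exp (h y)) = exp (h x) * E i x h" if "i < mdim M" "h \<in> smooth_functions M" for i h
      unfolding E_def by (rule coord_field_exp[OF ctx subsetD[OF B(2) \<beta>B[OF that(1)]] that(2) x])
  next
    fix Y assume Y: "Y \<in> vector_fields M"
    define X where "X i z = \<rho> z * (c z \<bullet> \<beta> i)" for i z
    have X: "X i \<in> smooth_functions M" for i
      unfolding X_def
      by (rule smooth_cutoff_chart[OF ctx smooth_on_bounded_linear[OF bounded_linear_inner_left]])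
    \<comment> \<open>The coefficient in \<open>exp1\<close> depends on y also through
      \<open>c y\<close>, which is meaningful only on U. A third factor \<open>\<rho> y\<close>
      replaces the coordinate of \<open>c y\<close> by the global function \<open>X i\<close>; hence
      the exponent 3 below.\<close>
    define A where "A i y = \<rho> y * Y y (X i) - X i y * Y y \<rho>" for i y
    have A: "A i \<in> smooth_functions M" for i
      unfolding A_def by (rule smooth_diff[OF smooth_mult[OF \<rho>(1) vector_fields_smooth[OF Y X]] smooth_mult[OF X vector_fields_smooth[OF Y \<rho>(1)]]])
    have "\<rho> y ^ 3 * Y y f = (\<Sum>i<mdim M. A i y * E i y f)" for y f
    proof -
      have *: "\<rho> y * Y y (\<lambda>z. \<rho> z * ((c z - c y) \<bullet> \<beta> i)) = A i y" for i
      proof -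
        have "(\<lambda>z. \<rho> z * ((c z - c y) \<bullet> \<beta> i)) = (\<lambda>z. 1 * X i z + (- (c y \<bullet> \<beta> i)) * \<rho> z)"
          by (rule ext) (simp add: X_def inner_diff_left right_diff_distrib)
        then have e: "Y y (\<lambda>z. \<rho> z * ((c z - c y) \<bullet> \<beta> i)) = 1 * Y y (X i) + (- (c y \<bullet> \<beta> i)) * Y y \<rho>"
          by (simp only: tangent_lincomb[OF vector_fields_tangent[OF Y] X \<rho>(1)])
        show ?thesis unfolding e by (simp add: A_def X_def right_diff_distrib)
      qed
      have "\<rho> y ^ 3 * Y y f = \<rho> y * (\<rho> y * \<rho> y * Y y f)" by (simp add: power3_eq_cube)
      also have "\<dots> = (\<Sum>i<mdim M. (\<rho> y * Y y (\<lambda>z. \<rho> z * ((c z - c y) \<bullet> \<beta> i))) * E i y f)"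
        unfolding exp1[OF vector_fields_tangent[OF Y]] sum_distrib_left
        by (rule sum.cong[OF refl]) simp
      finally show ?thesis by (simp only: *)
    qed
    then show "\<exists>A \<psi>. \<psi> \<in> smooth_functions M \<and> \<psi> x = 1 \<and>
       (\<forall>i<mdim M. A i \<in> smooth_functions M) \<and>
       (\<lambda>y f. \<psi> y * Y y f) = (\<lambda>y f. \<Sum>i<mdim M. A i y * E i y f)"
      using A \<rho>(2) smooth_power[OF \<rho>(1), of 3] by (intro exI[of _ A] exI[of _ "\<lambda>y. \<rho> y ^ 3"]) simp
  qed
qed

text \<open>The Leibniz rule alone does not give a chain rule. Coordinate fields satisfy it by
  calculus, both sides are linear in v, and the coordinate fields span.\<close>

lemma tangent_exp:
  assumes v: "v \<in> tangent_space M x" and h: "h \<in> smooth_functions M"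
  shows "v (\<lambda>y. exp (h y)) = exp (h x) * v h"
proof -
  obtain E where E: "frame_at x E" by (rule frame_exists)
  obtain a where a: "v = (\<lambda>f. \<Sum>i<mdim M. a i * E i x f)" using frame_at_span[OF E v] .
  have "E i x (\<lambda>y. exp (h y)) = exp (h x) * E i x h" if "i < mdim M" for i
    using E h that by (simp add: frame_at_def)
  then show ?thesis unfolding a by (simp add: sum_distrib_left mult_ac)
qed

text \<open>Keep the coefficients of v in a frame constant. This links conditions on single tangent
  vectors with conditions tested on vector fields.\<close>

lemma tangent_extend:
  assumes "v \<in> tangent_space M x"
  obtains Y where "Y \<in> vector_fields M" "Y x = v"
proof -
  obtain E where E: "frame_at x E" by (rule frame_exists)
  obtain a where a: "v = (\<lambda>f. \<Sum>i<mdim M. a i * E i x f)" using frame_at_span[OF E assms] .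
  have "(\<lambda>y f. \<Sum>i<mdim M. (\<lambda>y. a i) y * E i y f) \<in> vector_fields M"
    by (rule vector_fields_sum) (simp_all add: frame_at_vector_field[OF E] smooth_const)
  then show ?thesis using a by (intro that) auto
qed

end

section \<open>Alternating forms\<close>

text \<open>Interpreted with two kinds of arguments: tangent vectors at a point, and global vector
  fields. Therefore the carrier W and its addition are parameters, and scalars enter only through
  expansion formulas.\<close>

locale alternating =
  fixes n :: nat and W :: "'v set" and plus :: "'v \<Rightarrow> 'v \<Rightarrow> 'v" and \<alpha> :: "(nat \<Rightarrow> 'v) \<Rightarrow> real"
  assumes depends: "\<And>Y Z. (\<And>i. i < n \<Longrightarrow> Y i = Z i) \<Longrightarrow> \<alpha> Y = \<alpha> Z"
    and alt: "\<And>Y i j. (\<And>i. i < n \<Longrightarrow> Y i \<in> W) \<Longrightarrow> i < j \<Longrightarrow> j < n \<Longrightarrow> Y i = Y j \<Longrightarrow> \<alpha> Y = 0"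
    and plus_closed: "\<And>P Q. P \<in> W \<Longrightarrow> Q \<in> W \<Longrightarrow> plus P Q \<in> W"
    and additive: "\<And>Y i P Q. (\<And>i. i < n \<Longrightarrow> Y i \<in> W) \<Longrightarrow> i < n \<Longrightarrow> P \<in> W \<Longrightarrow> Q \<in> W \<Longrightarrow>
      \<alpha> (Y(i := plus P Q)) = \<alpha> (Y(i := P)) + \<alpha> (Y(i := Q))"
begin

lemma alt':
  assumes "\<And>i. i < n \<Longrightarrow> Y i \<in> W" "i \<noteq> j" "i < n" "j < n" "Y i = Y j"
  shows "\<alpha> Y = 0"
  using alt[of Y i j] alt[of Y j i] assms by (metis nat_neq_iff)

text \<open>Put Y i + Y j into both slots and expand the resulting zero: the terms with a repeated
  entry vanish, and the two mixed terms are Y and its exchanged version.\<close>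

lemma swap_neg:
  assumes Y: "\<And>i. i < n \<Longrightarrow> Y i \<in> W" and ij: "i \<noteq> j" "i < n" "j < n"
  shows "\<alpha> (Y(i := Y j, j := Y i)) = - \<alpha> Y"
proof -
  let ?S = "plus (Y i) (Y j)"
  have W: "Y i \<in> W" "Y j \<in> W" "?S \<in> W" using Y ij plus_closed by auto
  have "0 = \<alpha> (Y(i := ?S, j := ?S))"
    by (rule alt'[OF _ ij, symmetric]) (use Y W ij in auto)
  also have "\<dots> = \<alpha> ((Y(i := ?S))(j := Y i)) + \<alpha> ((Y(i := ?S))(j := Y j))"
    by (rule additive) (use Y W ij in auto)
  also have "(Y(i := ?S))(j := Y i) = (Y(j := Y i))(i := ?S)" using ij by (simp add: fun_upd_twist)
  also have "\<alpha> \<dots> = \<alpha> ((Y(j := Y i))(i := Y i)) + \<alpha> ((Y(j := Y i))(i := Y j))"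
    by (rule additive) (use Y W ij in auto)
  also have "(Y(i := ?S))(j := Y j) = (Y(j := Y j))(i := ?S)" using ij by (simp add: fun_upd_twist)
  also have "\<alpha> \<dots> = \<alpha> ((Y(j := Y j))(i := Y i)) + \<alpha> ((Y(j := Y j))(i := Y j))"
    by (rule additive) (use Y W ij in auto)
  also have "\<alpha> ((Y(j := Y i))(i := Y i)) = 0"
    by (rule alt'[OF _ ij]) (use Y W ij in auto)
  also have "\<alpha> ((Y(j := Y j))(i := Y j)) = 0"
    by (rule alt'[OF _ ij]) (use Y W ij in auto)
  also have "(Y(j := Y j))(i := Y i) = Y" by auto
  also have "(Y(j := Y i))(i := Y j) = Y(i := Y j, j := Y i)" using ij by (simp add: fun_upd_twist)
  finally show ?thesis by linarith
qed

text \<open>Expanding slot by slot reduces to tuples of the e k. A repeated index gives 0, and a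
  permutation of the indices changes \<alpha> e only by a sign. The expansion is required of values
  of \<alpha>, not of elements of W, since a vector field is a combination of frame fields only near
  a point.\<close>

lemma zero_on_span:
  assumes e: "\<And>k. k < n \<Longrightarrow> e k \<in> W" and e0: "\<alpha> e = 0"
    and expand: "\<And>Y i. (\<And>i. i < n \<Longrightarrow> Y i \<in> W) \<Longrightarrow> i < n \<Longrightarrow>
      \<exists>a. \<alpha> Y = (\<Sum>k<n. a k * \<alpha> (Y(i := e k)))"
    and Y: "\<And>i. i < n \<Longrightarrow> Y i \<in> W"
  shows "\<alpha> Y = 0"
proof -
  have perm: "\<alpha> (\<lambda>i. e (p i)) = 0" if "p permutes {..<n}" for p
    using that finite_lessThan[of n]
  proof (induction p rule: permutes_induct)
    case id
    then show ?case using e0 by simp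
  next
    case (swap a b p)
    let ?Y = "\<lambda>i. e (p i)"
    let ?a = "inv p a" and ?b = "inv p b"
    have pa: "p ?a = a" "p ?b = b" using permutes_inverses[OF \<open>p permutes {..<n}\<close>] by auto
    have lt: "?a < n" "?b < n"
      using permutes_in_image[OF permutes_inv[OF \<open>p permutes {..<n}\<close>]] swap by auto
    have "?a \<noteq> ?b" using pa swap by metis
    have W: "?Y i \<in> W" if "i < n" for i
      using permutes_in_image[OF \<open>p permutes {..<n}\<close>, of i] that e by simp
    \<comment> \<open>Transposing the values a and b of p amounts to exchanging the two slots in
      which they occur.\<close>
    have "(\<lambda>i. e ((Transposition.transpose a b \<circ> p) i)) = ?Y(?a := ?Y ?b, ?b := ?Y ?a)"
    proof
      fix i
      have "p i = a \<longleftrightarrow> i = ?a" "p i = b \<longleftrightarrow> i = ?b"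
        using permutes_inverses[OF \<open>p permutes {..<n}\<close>] by metis+
      then show "e ((Transposition.transpose a b \<circ> p) i) = (?Y(?a := ?Y ?b, ?b := ?Y ?a)) i"
        by (auto simp: pa Transposition.transpose_def)
    qed
    then show ?case using swap_neg[of ?Y, OF W \<open>?a \<noteq> ?b\<close> lt] swap.IH by simp
  qed
  have map: "\<alpha> (\<lambda>i. e (f i)) = 0" if f: "\<And>i. i < n \<Longrightarrow> f i < n" for f
  proof (cases "inj_on f {..<n}")
    case True
    \<comment> \<open>\<open>permutes\<close> fixes everything outside the index set, while f is
      arbitrary there.\<close>
    define p where "p i = (if i < n then f i else i)" for i
    have "p permutes {..<n}"
    proof (rule bij_imp_permutes)
      have "inj_on p {..<n}" using True by (auto simp: p_def inj_on_def)
      moreover have "p ` {..<n} \<subseteq> {..<n}" using f by (auto simp: p_def)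
      ultimately show "bij_betw p {..<n} {..<n}"
        by (simp add: bij_betw_def endo_inj_surj)
    qed (simp add: p_def)
    then have "\<alpha> (\<lambda>i. e (p i)) = 0" by (rule perm)
    moreover have "\<alpha> (\<lambda>i. e (p i)) = \<alpha> (\<lambda>i. e (f i))" by (rule depends) (simp add: p_def)
    ultimately show ?thesis by simp
  next
    case False
    then obtain i j where "i < n" "j < n" "i \<noteq> j" "f i = f j" by (auto simp: inj_on_def)
    then show ?thesis using e f by (intro alt'[of _ i j]) auto
  qed
  \<comment> \<open>The induction is on the number k of leading slots that are still free; slots
    from k on already hold some e j, and each step expands the last free one.\<close>
  have "\<alpha> Y = 0" if "k \<le> n" "\<And>i. i < n \<Longrightarrow> Y i \<in> W" "\<And>i. k \<le> i \<Longrightarrow> i < n \<Longrightarrow> \<exists>j<n. Y i = e j" for k Y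
    using that
  proof (induction k arbitrary: Y)
    case 0
    then have "\<forall>i. \<exists>j. i < n \<longrightarrow> j < n \<and> Y i = e j" by blast
    then obtain f where f: "\<And>i. i < n \<Longrightarrow> f i < n \<and> Y i = e (f i)" by metis
    have "\<alpha> Y = \<alpha> (\<lambda>i. e (f i))" by (rule depends) (use f in blast)
    then show ?case using map f by simp
  next
    case (Suc k)
    have k: "k < n" using Suc.prems(1) by simp
    obtain a where a: "\<alpha> Y = (\<Sum>j<n. a j * \<alpha> (Y(k := e j)))"
      using expand[of Y k] Suc.prems(2) k by blast
    have "\<alpha> (Y(k := e j)) = 0" if "j < n" for j
    proof (rule Suc.IH)
      show "\<exists>j'<n. (Y(k := e j)) i = e j'" if "k \<le> i" "i < n" for i
        using Suc.prems(3)[of i] that \<open>j < n\<close> by (cases "i = k") auto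
    qed (use k e \<open>j < n\<close> Suc.prems(2) in auto)
    then show ?case unfolding a by simp
  qed
  from this[of n Y] show ?thesis using Y by simp
qed

end

section \<open>Alternating forms on tangent spaces\<close>

lemma alternating_form_depends:
  "alternating_form M k x \<omega> \<Longrightarrow> (\<And>i. i < k \<Longrightarrow> v i = w i) \<Longrightarrow> \<omega> v = \<omega> w"
  by (auto simp: alternating_form_def)

lemma alternating_form_lincomb:
  assumes "alternating_form M k x \<omega>" "\<And>i. i < k \<Longrightarrow> v i \<in> tangent_space M x" "i < k"
    "u \<in> tangent_space M x" "w \<in> tangent_space M x"
  shows "\<omega> (v(i := (\<lambda>f. a * u f + b * w f))) = a * \<omega> (v(i := u)) + b * \<omega> (v(i := w))"
  using assms unfolding alternating_form_def by blast

lemma alternating_form_alt: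
  assumes "alternating_form M k x \<omega>" "\<And>i. i < k \<Longrightarrow> v i \<in> tangent_space M x" "i < j" "j < k" "v i = v j"
  shows "\<omega> v = 0"
  using assms unfolding alternating_form_def by blast

lemma alternating_form_alternating:
  assumes "alternating_form M k x \<omega>"
  shows "alternating k (tangent_space M x) (\<lambda>u w f. u f + w f) \<omega>"
proof
  show "\<omega> Y = \<omega> Z" if "\<And>i. i < k \<Longrightarrow> Y i = Z i" for Y Z
    using alternating_form_depends[OF assms] that .
  show "\<omega> Y = 0" if "\<And>i. i < k \<Longrightarrow> Y i \<in> tangent_space M x" "i < j" "j < k" "Y i = Y j" for Y i j
    by (rule alternating_form_alt[OF assms that])
  show "(\<lambda>f. u f + w f) \<in> tangent_space M x" if "u \<in> tangent_space M x" "w \<in> tangent_space M x" for u w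
    using tangent_space_lincomb[OF that, of 1 1] by simp
  show "\<omega> (Y(i := (\<lambda>f. u f + w f))) = \<omega> (Y(i := u)) + \<omega> (Y(i := w))"
    if "\<And>i. i < k \<Longrightarrow> Y i \<in> tangent_space M x" "i < k" "u \<in> tangent_space M x" "w \<in> tangent_space M x" for Y i u w
    using alternating_form_lincomb[where v = Y and a = 1 and b = 1, OF assms that] by simp
qed

lemma alternating_form_sum:
  assumes \<omega>: "alternating_form M k x \<omega>" and v: "\<And>i. i < k \<Longrightarrow> v i \<in> tangent_space M x" and i: "i < k"
    and w: "\<And>j. j < (m::nat) \<Longrightarrow> w j \<in> tangent_space M x"
  shows "\<omega> (v(i := (\<lambda>f. \<Sum>j<m. a j * w j f))) = (\<Sum>j<m. a j * \<omega> (v(i := w j)))"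
  using w
proof (induction m)
  case 0
  then show ?case
    using alternating_form_lincomb[where v = v and a = 0 and b = 0, OF \<omega> v i tangent_space_zero tangent_space_zero] by (simp add: fun_upd_def)
next
  case (Suc m)
  have "(\<lambda>f. \<Sum>j<m. a j * w j f) \<in> tangent_space M x"
    by (rule tangent_space_sum) (use Suc.prems in auto)
  from alternating_form_lincomb[where v = v and w = "w m" and a = 1 and b = "a m", OF \<omega> v i this] Suc show ?case by (simp add: fun_upd_def)
qed

section \<open>Lie brackets of vector fields\<close>

lemma lie_bracket_tangent_eq:
  assumes "f \<in> smooth_functions M"
  shows "lie_bracket M X Y x f = X x (\<lambda>y. Y y f) - Y x (\<lambda>y. X y f)"
  using assms by (simp add: lie_bracket_def)

lemma differential_forms_alternating:
  "\<mu> \<in> differential_forms M k \<Longrightarrow> alternating_form M k x (\<mu> x)"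
  by (simp add: differential_forms_def)

lemma differential_forms_smooth:
  "\<mu> \<in> differential_forms M k \<Longrightarrow> (\<And>i. i < k \<Longrightarrow> Y i \<in> vector_fields M) \<Longrightarrow>
    (\<lambda>x. \<mu> x (\<lambda>i. Y i x)) \<in> smooth_functions M"
  by (simp add: differential_forms_def)

context smooth_mfd begin

lemma lie_bracket_vector_field:
  assumes X: "X \<in> vector_fields M" and Y: "Y \<in> vector_fields M"
  shows "lie_bracket M X Y \<in> vector_fields M"
proof (rule vector_fieldsI)
  note tX = vector_fields_tangent[OF X] and tY = vector_fields_tangent[OF Y]
    and sX = vector_fields_smooth[OF X] and sY = vector_fields_smooth[OF Y]
  show "lie_bracket M X Y x \<in> tangent_space M x" for x
  proof (rule tangent_spaceI)
    fix f g :: "'a \<Rightarrow> real" and a b :: real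
    assume f: "f \<in> smooth_functions M" and g: "g \<in> smooth_functions M"
    show "lie_bracket M X Y x (\<lambda>y. a * f y + b * g y) = a * lie_bracket M X Y x f + b * lie_bracket M X Y x g"
      unfolding lie_bracket_tangent_eq[OF f] lie_bracket_tangent_eq[OF g]
        lie_bracket_tangent_eq[OF smooth_lincomb[OF f g]]
        tangent_lincomb[OF tX f g] tangent_lincomb[OF tY f g]
        tangent_lincomb[OF tX sY[OF f] sY[OF g]] tangent_lincomb[OF tY sX[OF f] sX[OF g]]
      by (simp add: algebra_simps)
    show "lie_bracket M X Y x (\<lambda>y. f y * g y) = f x * lie_bracket M X Y x g + g x * lie_bracket M X Y x f"
      unfolding lie_bracket_tangent_eq[OF f] lie_bracket_tangent_eq[OF g]
        lie_bracket_tangent_eq[OF smooth_mult[OF f g]]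
        tangent_mult[OF tX f g] tangent_mult[OF tY f g]
        tangent_add[OF tX smooth_mult[OF f sY[OF g]] smooth_mult[OF g sY[OF f]]]
        tangent_add[OF tY smooth_mult[OF f sX[OF g]] smooth_mult[OF g sX[OF f]]]
        tangent_mult[OF tX f sY[OF g]] tangent_mult[OF tX g sY[OF f]]
        tangent_mult[OF tY f sX[OF g]] tangent_mult[OF tY g sX[OF f]]
      by (simp add: algebra_simps)
  qed (simp add: lie_bracket_def)
  show "(\<lambda>x. lie_bracket M X Y x f) \<in> smooth_functions M" if "f \<in> smooth_functions M" for f
    unfolding lie_bracket_tangent_eq[OF that]
    by (rule smooth_diff[OF vector_fields_smooth[OF X sY[OF that]] vector_fields_smooth[OF Y sX[OF that]]])
qed

text \<open>The factors 1 keep the right-hand side in the shape \<open>a * u f + b * w f\<close>, so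
  that \<open>alternating_form_lincomb\<close> applies to the outer sum as well as to the inner
  ones.\<close>

lemma lie_bracket_lincomb_right:
  assumes Z: "Z \<in> vector_fields M" and PQ: "P \<in> vector_fields M" "Q \<in> vector_fields M"
    and g: "g \<in> smooth_functions M" and h: "h \<in> smooth_functions M"
  shows "lie_bracket M Z (\<lambda>x f. g x * P x f + h x * Q x f) x =
    (\<lambda>f. 1 * (g x * lie_bracket M Z P x f + h x * lie_bracket M Z Q x f) + 1 * (Z x g * P x f + Z x h * Q x f))"
proof
  fix f
  note tZ = vector_fields_tangent[OF Z] and sP = vector_fields_smooth[OF PQ(1)] and sQ = vector_fields_smooth[OF PQ(2)]
  show "lie_bracket M Z (\<lambda>x f. g x * P x f + h x * Q x f) x f =
    1 * (g x * lie_bracket M Z P x f + h x * lie_bracket M Z Q x f) + 1 * (Z x g * P x f + Z x h * Q x f)"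
  proof (cases "f \<in> smooth_functions M")
    case f: True
    show ?thesis
      unfolding lie_bracket_tangent_eq[OF f]
        tangent_add[OF tZ smooth_mult[OF g sP[OF f]] smooth_mult[OF h sQ[OF f]]]
        tangent_mult[OF tZ g sP[OF f]] tangent_mult[OF tZ h sQ[OF f]]
      by (simp add: algebra_simps)
  next
    case False
    then show ?thesis
      using PQ[THEN vector_fields_tangent, THEN tangent_nonsmooth, OF False] by (simp add: lie_bracket_def)
  qed
qed

lemma lie_bracket_lincomb_left:
  assumes Y: "Y \<in> vector_fields M" and PQ: "P \<in> vector_fields M" "Q \<in> vector_fields M"
    and g: "g \<in> smooth_functions M" and h: "h \<in> smooth_functions M"
  shows "lie_bracket M (\<lambda>x f. g x * P x f + h x * Q x f) Y x =
    (\<lambda>f. 1 * (g x * lie_bracket M P Y x f + h x * lie_bracket M Q Y x f) + (-1) * (Y x g * P x f + Y x h * Q x f))"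
proof
  fix f
  note tY = vector_fields_tangent[OF Y] and sP = vector_fields_smooth[OF PQ(1)] and sQ = vector_fields_smooth[OF PQ(2)]
  show "lie_bracket M (\<lambda>x f. g x * P x f + h x * Q x f) Y x f =
    1 * (g x * lie_bracket M P Y x f + h x * lie_bracket M Q Y x f) + (-1) * (Y x g * P x f + Y x h * Q x f)"
  proof (cases "f \<in> smooth_functions M")
    case f: True
    show ?thesis
      unfolding lie_bracket_tangent_eq[OF f]
        tangent_add[OF tY smooth_mult[OF g sP[OF f]] smooth_mult[OF h sQ[OF f]]]
        tangent_mult[OF tY g sP[OF f]] tangent_mult[OF tY h sQ[OF f]]
      by (simp add: algebra_simps)
  next
    case False
    then show ?thesis
      using PQ[THEN vector_fields_tangent, THEN tangent_nonsmooth, OF False] by (simp add: lie_bracket_def)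
  qed
qed

end

section \<open>Tensoriality of top forms and of their Lie derivatives\<close>

context smooth_mfd begin

text \<open>The value at x of an n-form, seen as a functional of vector fields. Linearity over
  smooth functions, with coefficients evaluated at x, stands in for dependence on the values at x
  alone, which is not visible in the formula for a Lie derivative.\<close>

definition tensorial_at :: "'a \<Rightarrow> ((nat \<Rightarrow> 'a \<Rightarrow> 'a tangent) \<Rightarrow> real) \<Rightarrow> bool" where
  "tensorial_at x \<alpha> \<longleftrightarrow>
    (\<forall>Y Z. (\<forall>i<mdim M. Y i = Z i) \<longrightarrow> \<alpha> Y = \<alpha> Z) \<and>
    (\<forall>Y i j. (\<forall>i<mdim M. Y i \<in> vector_fields M) \<longrightarrow> i < j \<longrightarrow> j < mdim M \<longrightarrow> Y i = Y j \<longrightarrow> \<alpha> Y = 0) \<and>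
    (\<forall>Y i g h P Q. (\<forall>i<mdim M. Y i \<in> vector_fields M) \<longrightarrow> i < mdim M \<longrightarrow>
       g \<in> smooth_functions M \<longrightarrow> h \<in> smooth_functions M \<longrightarrow>
       P \<in> vector_fields M \<longrightarrow> Q \<in> vector_fields M \<longrightarrow>
       \<alpha> (Y(i := (\<lambda>z f. g z * P z f + h z * Q z f))) = g x * \<alpha> (Y(i := P)) + h x * \<alpha> (Y(i := Q)))"

lemma tensorial_at_depends:
  "tensorial_at x \<alpha> \<Longrightarrow> (\<And>i. i < mdim M \<Longrightarrow> Y i = Z i) \<Longrightarrow> \<alpha> Y = \<alpha> Z"
  unfolding tensorial_at_def by blast

lemma tensorial_at_alt:
  "tensorial_at x \<alpha> \<Longrightarrow> (\<And>i. i < mdim M \<Longrightarrow> Y i \<in> vector_fields M) \<Longrightarrow> i < j \<Longrightarrow> j < mdim M \<Longrightarrow>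
    Y i = Y j \<Longrightarrow> \<alpha> Y = 0"
  unfolding tensorial_at_def by blast

lemma tensorial_at_lincomb:
  "tensorial_at x \<alpha> \<Longrightarrow> (\<And>i. i < mdim M \<Longrightarrow> Y i \<in> vector_fields M) \<Longrightarrow> i < mdim M \<Longrightarrow>
    g \<in> smooth_functions M \<Longrightarrow> h \<in> smooth_functions M \<Longrightarrow> P \<in> vector_fields M \<Longrightarrow> Q \<in> vector_fields M \<Longrightarrow>
    \<alpha> (Y(i := (\<lambda>z f. g z * P z f + h z * Q z f))) = g x * \<alpha> (Y(i := P)) + h x * \<alpha> (Y(i := Q))"
  unfolding tensorial_at_def by simp

lemma tensorial_at_sum:
  assumes \<alpha>: "tensorial_at x \<alpha>" and Y: "\<And>i. i < mdim M \<Longrightarrow> Y i \<in> vector_fields M" and i: "i < mdim M"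
    and A: "\<And>k. k < (m::nat) \<Longrightarrow> A k \<in> smooth_functions M" and E: "\<And>k. k < m \<Longrightarrow> E k \<in> vector_fields M"
  shows "\<alpha> (Y(i := (\<lambda>z f. \<Sum>k<m. A k z * E k z f))) = (\<Sum>k<m. A k x * \<alpha> (Y(i := E k)))"
  using A E
proof (induction m)
  case 0
  have "\<alpha> (Y(i := (\<lambda>z f. 0 * Y i z f + 0 * Y i z f))) = 0 * \<alpha> (Y(i := Y i)) + 0 * \<alpha> (Y(i := Y i))"
    by (rule tensorial_at_lincomb[OF \<alpha> Y i smooth_const smooth_const Y[OF i] Y[OF i]])
  then show ?case by (simp add: fun_upd_def)
next
  case (Suc m)
  have S: "(\<lambda>z f. \<Sum>k<m. A k z * E k z f) \<in> vector_fields M"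
    by (rule vector_fields_sum) (simp_all only: finite_lessThan lessThan_iff Suc.prems less_SucI)
  have "\<alpha> (Y(i := (\<lambda>z f. 1 * (\<lambda>z f. \<Sum>k<m. A k z * E k z f) z f + A m z * E m z f)))
     = 1 * \<alpha> (Y(i := (\<lambda>z f. \<Sum>k<m. A k z * E k z f))) + A m x * \<alpha> (Y(i := E m))"
    by (rule tensorial_at_lincomb[OF \<alpha> Y i smooth_const Suc.prems(1)[OF lessI] S Suc.prems(2)[OF lessI]])
  then show ?case using Suc by (simp add: fun_upd_def)
qed

lemma tensorial_at_zero:
  assumes \<alpha>: "tensorial_at x \<alpha>" and E: "frame_at x E" and 0: "\<alpha> E = 0"
    and Y: "\<And>i. i < mdim M \<Longrightarrow> Y i \<in> vector_fields M"
  shows "\<alpha> Y = 0"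
proof -
  note EV = frame_at_vector_field[OF E]
  interpret alternating "mdim M" "vector_fields M" "\<lambda>P Q z f. 1 * P z f + 1 * Q z f" \<alpha>
  proof
    show "\<alpha> Y = \<alpha> Z" if "\<And>i. i < mdim M \<Longrightarrow> Y i = Z i" for Y Z
      by (rule tensorial_at_depends[OF \<alpha> that])
    show "\<alpha> Y = 0" if "\<And>i. i < mdim M \<Longrightarrow> Y i \<in> vector_fields M" "i < j" "j < mdim M" "Y i = Y j" for Y i j
      by (rule tensorial_at_alt[OF \<alpha> that])
    show "(\<lambda>z f. 1 * P z f + 1 * Q z f) \<in> vector_fields M" if "P \<in> vector_fields M" "Q \<in> vector_fields M" for P Q
      by (rule vector_fields_lincomb[OF smooth_const smooth_const that])
    show "\<alpha> (Y(i := (\<lambda>z f. 1 * P z f + 1 * Q z f))) = \<alpha> (Y(i := P)) + \<alpha> (Y(i := Q))"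
      if "\<And>i. i < mdim M \<Longrightarrow> Y i \<in> vector_fields M" "i < mdim M" "P \<in> vector_fields M" "Q \<in> vector_fields M" for Y i P Q
    proof -
      have "\<alpha> (Y(i := (\<lambda>z f. 1 * P z f + 1 * Q z f))) = 1 * \<alpha> (Y(i := P)) + 1 * \<alpha> (Y(i := Q))"
        by (rule tensorial_at_lincomb[OF \<alpha> that(1,2) smooth_const smooth_const that(3,4)])
      then show ?thesis by (simp only: mult_1)
    qed
  qed
  show ?thesis
  proof (rule zero_on_span[OF EV 0 _ Y])
    fix Y i assume Y: "\<And>i. i < mdim M \<Longrightarrow> Y i \<in> vector_fields M" and i: "i < mdim M"
    obtain A \<psi> where A: "\<psi> \<in> smooth_functions M" "\<psi> x = 1" "\<forall>i<mdim M. A i \<in> smooth_functions M"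
        "(\<lambda>y f. \<psi> y * Y i y f) = (\<lambda>y f. \<Sum>k<mdim M. A k y * E k y f)"
      by (rule frame_at_expand[OF E Y[OF i]])
    \<comment> \<open>Since \<psi> is 1 at x, replacing Y i by \<psi> times Y i does not change
      \<alpha>, and that product has a global expansion in the frame. The summand with coefficient 0
      merely fits the shape of \<open>tensorial_at_lincomb\<close>.\<close>
    have "\<alpha> (Y(i := (\<lambda>z f. \<psi> z * Y i z f + 0 * Y i z f))) = \<psi> x * \<alpha> (Y(i := Y i)) + 0 * \<alpha> (Y(i := Y i))"
      by (rule tensorial_at_lincomb[OF \<alpha> Y i A(1) smooth_const Y[OF i] Y[OF i]])
    then have "\<alpha> Y = \<alpha> (Y(i := (\<lambda>z f. \<psi> z * Y i z f)))"
      by (simp only: A(2) fun_upd_triv mult_zero_left add_0_right mult_1)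
    also have "\<dots> = (\<Sum>k<mdim M. A k x * \<alpha> (Y(i := E k)))"
      unfolding A(4) by (rule tensorial_at_sum[OF \<alpha> Y i]) (simp_all only: A(3) EV)
    finally show "\<exists>a. \<alpha> Y = (\<Sum>k<mdim M. a k * \<alpha> (Y(i := E k)))" by (rule exI[of _ "\<lambda>k. A k x"])
  qed
qed

text \<open>The difference of the two sides is itself tensorial in Y and vanishes at Y = E. The
  cross-multiplied form requires no division.\<close>

lemma tensorial_at_proportional:
  assumes \<alpha>: "tensorial_at x \<alpha>" and \<beta>: "tensorial_at x \<beta>" and E: "frame_at x E"
    and Y: "\<And>i. i < mdim M \<Longrightarrow> Y i \<in> vector_fields M"
  shows "\<alpha> Y * \<beta> E = \<beta> Y * \<alpha> E"
proof -
  let ?\<gamma> = "\<lambda>Y. \<alpha> Y * \<beta> E - \<beta> Y * \<alpha> E"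
  have "tensorial_at x ?\<gamma>"
    unfolding tensorial_at_def
  proof (intro conjI allI impI)
    show "?\<gamma> Y = ?\<gamma> Z" if "\<forall>i<mdim M. Y i = Z i" for Y Z
      using tensorial_at_depends[OF \<alpha>, of Y Z] tensorial_at_depends[OF \<beta>, of Y Z] that by simp
    show "?\<gamma> Y = 0" if "\<forall>i<mdim M. Y i \<in> vector_fields M" "i < j" "j < mdim M" "Y i = Y j" for Y i j
      using tensorial_at_alt[OF \<alpha>, of Y i j] tensorial_at_alt[OF \<beta>, of Y i j] that by simp
    show "?\<gamma> (Y(i := (\<lambda>z f. g z * P z f + h z * Q z f))) = g x * ?\<gamma> (Y(i := P)) + h x * ?\<gamma> (Y(i := Q))"
      if "\<forall>i<mdim M. Y i \<in> vector_fields M" "i < mdim M" "g \<in> smooth_functions M" "h \<in> smooth_functions M"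
        "P \<in> vector_fields M" "Q \<in> vector_fields M" for Y i g h P Q
    proof -
      have *: "\<And>i. i < mdim M \<Longrightarrow> Y i \<in> vector_fields M" using that(1) by blast
      have a: "\<alpha> (Y(i := (\<lambda>z f. g z * P z f + h z * Q z f))) = g x * \<alpha> (Y(i := P)) + h x * \<alpha> (Y(i := Q))"
        by (rule tensorial_at_lincomb[OF \<alpha> * that(2-)])
      have b: "\<beta> (Y(i := (\<lambda>z f. g z * P z f + h z * Q z f))) = g x * \<beta> (Y(i := P)) + h x * \<beta> (Y(i := Q))"
        by (rule tensorial_at_lincomb[OF \<beta> * that(2-)])
      show ?thesis unfolding a b by (simp only: algebra_simps)
    qed
  qed
  then have "?\<gamma> Y = 0" by (rule tensorial_at_zero[OF _ E _ Y]) simp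
  then show ?thesis by simp
qed

context
  fixes \<mu> assumes \<mu>: "\<mu> \<in> differential_forms M (mdim M)"
begin

lemma tensorial_at_form: "tensorial_at x (\<lambda>Y. \<mu> x (\<lambda>i. Y i x))"
  unfolding tensorial_at_def
proof (intro conjI allI impI)
  note af = differential_forms_alternating[OF \<mu>, of x]
  show "\<mu> x (\<lambda>i. Y i x) = \<mu> x (\<lambda>i. Z i x)" if "\<forall>i<mdim M. Y i = Z i" for Y Z
    by (rule alternating_form_depends[OF af]) (simp add: that)
  show "\<mu> x (\<lambda>i. Y i x) = 0"
    if "\<forall>i<mdim M. Y i \<in> vector_fields M" "i < j" "j < mdim M" "Y i = Y j" for Y i j
    by (rule alternating_form_alt[OF af _ that(2,3)]) (use that in \<open>auto intro: vector_fields_tangent\<close>)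
  show "\<mu> x (\<lambda>j. (Y(i := (\<lambda>z f. g z * P z f + h z * Q z f))) j x) =
      g x * \<mu> x (\<lambda>j. (Y(i := P)) j x) + h x * \<mu> x (\<lambda>j. (Y(i := Q)) j x)"
    if "\<forall>i<mdim M. Y i \<in> vector_fields M" "i < mdim M" "P \<in> vector_fields M" "Q \<in> vector_fields M" for Y i g h P Q
  proof -
    have upd: "(\<lambda>j. (Y(i := R)) j x) = (\<lambda>j. Y j x)(i := R x)" for R by auto
    show ?thesis unfolding upd
      by (rule alternating_form_lincomb[OF af]) (use that in \<open>auto intro: vector_fields_tangent\<close>)
  qed
qed

text \<open>Differentiating the form along Z hits a coefficient g and yields an extra term with
  Z(g); the bracket of Z with gP contributes the same term with the opposite sign. For equal fields
  in slots i and j, the two bracket terms in those slots cancel and all others vanish.\<close>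

lemma tensorial_at_lie_derivative:
  assumes Z: "Z \<in> vector_fields M"
  shows "tensorial_at x (\<lambda>Y. lie_derivative_form M (mdim M) Z \<mu> Y x)"
  unfolding tensorial_at_def
proof (intro conjI allI impI)
  let ?n = "mdim M" and ?m = "\<lambda>Y y. \<mu> y (\<lambda>i. Y i y)"
  note af = differential_forms_alternating[OF \<mu>]
  fix Y Y' :: "nat \<Rightarrow> 'a \<Rightarrow> 'a tangent" assume eq: "\<forall>i<?n. Y i = Y' i"
  have "?m Y y = ?m Y' y" for y
    by (rule alternating_form_depends[OF af]) (simp add: eq)
  moreover have "\<mu> x ((\<lambda>j. Y j x)(i := lie_bracket M Z (Y i) x)) = \<mu> x ((\<lambda>j. Y' j x)(i := lie_bracket M Z (Y' i) x))"
    if "i < ?n" for i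
    by (rule alternating_form_depends[OF af]) (simp add: eq that)
  ultimately show "lie_derivative_form M ?n Z \<mu> Y x = lie_derivative_form M ?n Z \<mu> Y' x"
    by (simp add: lie_derivative_form_def)
next
  let ?n = "mdim M" and ?m = "\<lambda>Y y. \<mu> y (\<lambda>i. Y i y)"
  note af = differential_forms_alternating[OF \<mu>]
  fix Y :: "nat \<Rightarrow> 'a \<Rightarrow> 'a tangent" and i j
  assume "\<forall>i<?n. Y i \<in> vector_fields M" and ij: "i < j" "j < ?n" "Y i = Y j"
  then have Y: "\<And>i. i < ?n \<Longrightarrow> Y i \<in> vector_fields M" by blast
  have T: "Y k x \<in> tangent_space M x" if "k < ?n" for k using vector_fields_tangent[OF Y[OF that]] .
  have B: "lie_bracket M Z (Y k) x \<in> tangent_space M x" if "k < ?n" for k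
    using vector_fields_tangent[OF lie_bracket_vector_field[OF Z Y[OF that]]] .
  have m0: "?m Y y = 0" for y
    by (rule alternating_form_alt[OF af _ ij(1,2)]) (simp_all add: ij(3) vector_fields_tangent[OF Y])
  let ?t = "\<lambda>k. \<mu> x ((\<lambda>j. Y j x)(k := lie_bracket M Z (Y k) x))"
  have t0: "?t k = 0" if "k < ?n" "k \<noteq> i" "k \<noteq> j" for k
    by (rule alternating_form_alt[OF af _ ij(1,2)]) (use T B that ij in auto)
  \<comment> \<open>Exchanging slots i and j of the tuple with the bracket in slot i puts the
    bracket into slot j, because \<open>Y i = Y j\<close>.\<close>
  have tij: "?t j = - ?t i"
  proof -
    interpret alternating ?n "tangent_space M x" "\<lambda>u w f. u f + w f" "\<mu> x"
      by (rule alternating_form_alternating[OF af])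
    let ?v = "(\<lambda>j. Y j x)(i := lie_bracket M Z (Y i) x)"
    have "\<mu> x (?v(i := ?v j, j := ?v i)) = - \<mu> x ?v"
      by (rule swap_neg) (use T B ij in auto)
    moreover have "?v(i := ?v j, j := ?v i) = (\<lambda>j. Y j x)(j := lie_bracket M Z (Y j) x)"
      by (rule ext) (use ij(1) in \<open>simp add: ij(3)\<close>)
    ultimately show ?thesis by simp
  qed
  have "(\<Sum>k<?n. ?t k) = (\<Sum>k\<in>{i, j}. ?t k)"
    by (rule sum.mono_neutral_right) (use ij t0 in auto)
  also have "\<dots> = 0" using ij tij by simp
  finally show "lie_derivative_form M ?n Z \<mu> Y x = 0"
    by (simp add: lie_derivative_form_def m0 tangent_const[OF vector_fields_tangent[OF Z]])
next
  let ?n = "mdim M" and ?m = "\<lambda>Y y. \<mu> y (\<lambda>i. Y i y)"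
  note af = differential_forms_alternating[OF \<mu>] and tZ = vector_fields_tangent[OF Z]
  fix Y :: "nat \<Rightarrow> 'a \<Rightarrow> 'a tangent" and i g h P Q
  assume "\<forall>i<?n. Y i \<in> vector_fields M" and i: "i < ?n" and g: "g \<in> smooth_functions M"
    and h: "h \<in> smooth_functions M" and P: "P \<in> vector_fields M" and Q: "Q \<in> vector_fields M"
  then have Y: "\<And>i. i < ?n \<Longrightarrow> Y i \<in> vector_fields M" by blast
  define R where "R = (\<lambda>z f. g z * P z f + h z * Q z f)"
  have R: "R \<in> vector_fields M" unfolding R_def by (rule vector_fields_lincomb[OF g h P Q])
  have YP: "\<And>k. k < ?n \<Longrightarrow> (Y(i := P)) k \<in> vector_fields M"
    and YQ: "\<And>k. k < ?n \<Longrightarrow> (Y(i := Q)) k \<in> vector_fields M"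
    using Y P Q by auto
  have m: "?m (Y(i := R)) y = g y * ?m (Y(i := P)) y + h y * ?m (Y(i := Q)) y" for y
    unfolding R_def by (rule tensorial_at_lincomb[OF tensorial_at_form Y i g h P Q])
  have sP: "?m (Y(i := P)) \<in> smooth_functions M" by (rule differential_forms_smooth[OF \<mu> YP])
  have sQ: "?m (Y(i := Q)) \<in> smooth_functions M" by (rule differential_forms_smooth[OF \<mu> YQ])
  have Zm: "Z x (?m (Y(i := R))) = (g x * Z x (?m (Y(i := P))) + ?m (Y(i := P)) x * Z x g)
      + (h x * Z x (?m (Y(i := Q))) + ?m (Y(i := Q)) x * Z x h)"
    unfolding m tangent_add[OF tZ smooth_mult[OF g sP] smooth_mult[OF h sQ]]
      tangent_mult[OF tZ g sP] tangent_mult[OF tZ h sQ] ..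
  let ?t = "\<lambda>P k. \<mu> x ((\<lambda>j. (Y(i := P)) j x)(k := lie_bracket M Z ((Y(i := P)) k) x))"
  have upd: "(\<lambda>j. (Y(i := S)) j x)(i := v) = (\<lambda>j. Y j x)(i := v)" for S v by auto
  have upd1: "(\<lambda>j. (Y(i := S)) j x) = (\<lambda>j. Y j x)(i := S x)" for S by auto
  have T: "\<And>k. k < ?n \<Longrightarrow> (\<lambda>j. Y j x) k \<in> tangent_space M x" using vector_fields_tangent[OF Y] .
  note TP = vector_fields_tangent[OF P, of x] and TQ = vector_fields_tangent[OF Q, of x]
  note BP = vector_fields_tangent[OF lie_bracket_vector_field[OF Z P], of x]
    and BQ = vector_fields_tangent[OF lie_bracket_vector_field[OF Z Q], of x]
  \<comment> \<open>Only the slot k = i differentiates the coefficients; its extra term is the one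
    that cancels against those in \<open>Zm\<close>.\<close>
  have t: "?t R k = g x * ?t P k + h x * ?t Q k
      + (if k = i then Z x g * ?m (Y(i := P)) x + Z x h * ?m (Y(i := Q)) x else 0)" if k: "k < ?n" for k
  proof (cases "k = i")
    case True
    have "?t R k = \<mu> x ((\<lambda>j. Y j x)(i := (\<lambda>f. 1 * (g x * lie_bracket M Z P x f + h x * lie_bracket M Z Q x f)
        + 1 * (Z x g * P x f + Z x h * Q x f))))"
      unfolding True upd fun_upd_same by (simp only: R_def lie_bracket_lincomb_right[OF Z P Q g h])
    also have "\<dots> = 1 * \<mu> x ((\<lambda>j. Y j x)(i := (\<lambda>f. g x * lie_bracket M Z P x f + h x * lie_bracket M Z Q x f)))
        + 1 * \<mu> x ((\<lambda>j. Y j x)(i := (\<lambda>f. Z x g * P x f + Z x h * Q x f)))"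
      by (rule alternating_form_lincomb[OF af T i tangent_space_lincomb[OF BP BQ] tangent_space_lincomb[OF TP TQ]])
    also have "\<mu> x ((\<lambda>j. Y j x)(i := (\<lambda>f. g x * lie_bracket M Z P x f + h x * lie_bracket M Z Q x f)))
      = g x * \<mu> x ((\<lambda>j. Y j x)(i := lie_bracket M Z P x)) + h x * \<mu> x ((\<lambda>j. Y j x)(i := lie_bracket M Z Q x))"
      by (rule alternating_form_lincomb[OF af T i BP BQ])
    also have "\<mu> x ((\<lambda>j. Y j x)(i := (\<lambda>f. Z x g * P x f + Z x h * Q x f)))
      = Z x g * \<mu> x ((\<lambda>j. Y j x)(i := P x)) + Z x h * \<mu> x ((\<lambda>j. Y j x)(i := Q x))"
      by (rule alternating_form_lincomb[OF af T i TP TQ])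
    finally have e: "?t R k = 1 * (g x * \<mu> x ((\<lambda>j. Y j x)(i := lie_bracket M Z P x))
          + h x * \<mu> x ((\<lambda>j. Y j x)(i := lie_bracket M Z Q x)))
        + 1 * (Z x g * \<mu> x ((\<lambda>j. Y j x)(i := P x)) + Z x h * \<mu> x ((\<lambda>j. Y j x)(i := Q x)))" .
    show ?thesis unfolding e unfolding True upd upd1 fun_upd_same by (simp only: if_True mult_1 fun_upd_upd simp_thms)
  next
    case False
    let ?v = "(\<lambda>j. Y j x)(k := lie_bracket M Z (Y k) x)"
    have v: "\<And>l. l < ?n \<Longrightarrow> ?v l \<in> tangent_space M x"
      using T vector_fields_tangent[OF lie_bracket_vector_field[OF Z Y[OF k]]] by auto
    have tS: "?t S k = \<mu> x (?v(i := S x))" for S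
      using False by (intro arg_cong[of _ _ "\<mu> x"]) (auto simp: fun_eq_iff)
    have "\<mu> x (?v(i := (\<lambda>f. g x * P x f + h x * Q x f))) = g x * \<mu> x (?v(i := P x)) + h x * \<mu> x (?v(i := Q x))"
      by (rule alternating_form_lincomb[OF af v i TP TQ])
    then show ?thesis unfolding tS using False by (simp add: R_def)
  qed
  have "(\<Sum>k<?n. ?t R k) = g x * (\<Sum>k<?n. ?t P k) + h x * (\<Sum>k<?n. ?t Q k)
      + (Z x g * ?m (Y(i := P)) x + Z x h * ?m (Y(i := Q)) x)"
  proof -
    have "(\<Sum>k<?n. ?t R k) = (\<Sum>k<?n. g x * ?t P k + h x * ?t Q k
      + (if k = i then Z x g * ?m (Y(i := P)) x + Z x h * ?m (Y(i := Q)) x else 0))"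
      by (rule sum.cong[OF refl]) (simp only: t lessThan_iff)
    also have "\<dots> = g x * (\<Sum>k<?n. ?t P k) + h x * (\<Sum>k<?n. ?t Q k)
      + (Z x g * ?m (Y(i := P)) x + Z x h * ?m (Y(i := Q)) x)"
      unfolding sum.distrib sum_distrib_left using i by (simp only: sum.delta finite_lessThan lessThan_iff if_True)
    finally show ?thesis .
  qed
  then show "lie_derivative_form M ?n Z \<mu> (Y(i := (\<lambda>z f. g z * P z f + h z * Q z f))) x =
    g x * lie_derivative_form M ?n Z \<mu> (Y(i := P)) x + h x * lie_derivative_form M ?n Z \<mu> (Y(i := Q)) x"
    unfolding lie_derivative_form_def R_def[symmetric] Zm by (simp only: algebra_simps)
qed

end

end

section \<open>Volume forms and divergence\<close>

context smooth_mfd begin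

lemma smooth_functions_continuous:
  assumes "f \<in> smooth_functions M"
  shows "continuous_on UNIV f"
proof -
  have "isCont f x" for x
  proof -
    obtain U c where Uc: "(U, c) \<in> charts M" and x: "x \<in> U" by (rule chart_at)
    have "smooth_on (c ` (U \<inter> UNIV)) (\<lambda>w. f (inv_into U c w))"
      by (rule smooth_fun_onD[OF smooth_functions_imp_on[OF assms] Uc])
    then have "continuous_on (c ` U) (\<lambda>w. f (inv_into U c w))"
      unfolding Int_UNIV_right by (rule smooth_on_imp_continuous_on)
    then have "continuous_on U (\<lambda>y. f (inv_into U c (c y)))"
      using continuous_on_compose2[OF _ continuous_on_chart[OF Uc] order_refl] by blast
    then have "continuous_on U f"
      by (rule continuous_on_eq) (simp only: inv_chart[OF Uc])
    then show ?thesis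
      using continuous_on_eq_continuous_at[OF open_chart[OF Uc]] x by blast
  qed
  then show ?thesis by (intro continuous_at_imp_continuous_on ballI)
qed

lemma open_nonzero_set:
  assumes "f \<in> smooth_functions M"
  shows "open {y. f y \<noteq> 0}"
proof -
  have "{y. f y \<noteq> 0} = f -` (- {0})" by auto
  then show ?thesis
    by (simp only: open_vimage[OF open_Compl[OF closed_singleton] smooth_functions_continuous[OF assms]])
qed

lemma volume_forms_differential: "\<mu> \<in> volume_forms M \<Longrightarrow> \<mu> \<in> differential_forms M (mdim M)"
  by (simp add: volume_forms_def)

lemma some_frame: "frame_at x (SOME E. frame_at x E)"
  by (rule frame_exists[of x]) (erule someI[where P = "frame_at x"])

lemma tangent_tuple_extend:
  assumes v: "\<And>i. i < mdim M \<Longrightarrow> v i \<in> tangent_space M x"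
  obtains Y where "\<And>i. i < mdim M \<Longrightarrow> Y i \<in> vector_fields M" "\<And>i. i < mdim M \<Longrightarrow> Y i x = v i"
proof -
  have "\<forall>i. \<exists>Y. i < mdim M \<longrightarrow> Y \<in> vector_fields M \<and> Y x = v i"
  proof
    fix i
    show "\<exists>Y. i < mdim M \<longrightarrow> Y \<in> vector_fields M \<and> Y x = v i"
    proof (cases "i < mdim M")
      case True
      obtain Y where "Y \<in> vector_fields M" "Y x = v i" by (rule tangent_extend[OF v[OF True]])
      then show ?thesis by (intro exI[of _ Y]) simp
    qed simp
  qed
  from choice[OF this] obtain Y where "\<forall>i. i < mdim M \<longrightarrow> Y i \<in> vector_fields M \<and> Y i x = v i" ..
  then show ?thesis by (intro that[of Y]) simp_all
qed

text \<open>A form that vanishes on a frame at x vanishes on all tuples of vector fields at x, and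
  every tuple of tangent vectors extends to such a tuple.\<close>

lemma volume_form_frame_nonzero:
  assumes \<mu>: "\<mu> \<in> volume_forms M" and E: "frame_at x E"
  shows "\<mu> x (\<lambda>i. E i x) \<noteq> 0"
proof
  assume 0: "\<mu> x (\<lambda>i. E i x) = 0"
  have "\<exists>v. (\<forall>i<mdim M. v i \<in> tangent_space M x) \<and> \<mu> x v \<noteq> 0"
    using \<mu> unfolding volume_forms_def by blast
  then obtain v where v': "\<forall>i<mdim M. v i \<in> tangent_space M x" "\<mu> x v \<noteq> 0" by blast
  then have v: "\<And>i. i < mdim M \<Longrightarrow> v i \<in> tangent_space M x" "\<mu> x v \<noteq> 0" by simp_all
  obtain Y where Y: "\<And>i. i < mdim M \<Longrightarrow> Y i \<in> vector_fields M" "\<And>i. i < mdim M \<Longrightarrow> Y i x = v i"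
    using v(1) by (rule tangent_tuple_extend[where v = v and x = x]) (assumption, rule that)
  have "\<mu> x (\<lambda>i. Y i x) = 0"
    by (rule tensorial_at_zero[where \<alpha> = "\<lambda>Y. \<mu> x (\<lambda>i. Y i x)" and Y = Y,
          OF tensorial_at_form[OF volume_forms_differential[OF \<mu>]] E 0 Y(1)])
  moreover have "\<mu> x (\<lambda>i. Y i x) = \<mu> x v"
    by (rule alternating_form_depends[OF differential_forms_alternating[OF volume_forms_differential[OF \<mu>]]])
       (rule Y(2))
  ultimately show False using v(2) by simp
qed

text \<open>A quotient of top forms, evaluated on a frame chosen separately at each point. The
  choice does not affect the value, by proportionality, but as it varies with x in an uncontrolled
  way, smoothness cannot be read off this formula.\<close>

definition divergence :: "('a \<Rightarrow> (nat \<Rightarrow> 'a tangent) \<Rightarrow> real) \<Rightarrow> ('a \<Rightarrow> 'a tangent) \<Rightarrow> 'a \<Rightarrow> real" where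
  "divergence \<mu> Z x = (let E = SOME E. frame_at x E in
     lie_derivative_form M (mdim M) Z \<mu> E x / \<mu> x (\<lambda>i. E i x))"

context
  fixes \<mu> assumes \<mu>: "\<mu> \<in> volume_forms M"
begin

lemma lie_derivative_volume_form:
  assumes Z: "Z \<in> vector_fields M" and Y: "\<And>i. i < mdim M \<Longrightarrow> Y i \<in> vector_fields M"
  shows "lie_derivative_form M (mdim M) Z \<mu> Y x = divergence \<mu> Z x * \<mu> x (\<lambda>i. Y i x)"
proof -
  define E where "E = (SOME E. frame_at x E)"
  have E: "frame_at x E" unfolding E_def by (rule some_frame)
  note \<mu>' = volume_forms_differential[OF \<mu>]
  have "lie_derivative_form M (mdim M) Z \<mu> Y x * \<mu> x (\<lambda>i. E i x) =
      \<mu> x (\<lambda>i. Y i x) * lie_derivative_form M (mdim M) Z \<mu> E x"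
    by (rule tensorial_at_proportional[where Y = Y and \<alpha> = "\<lambda>Y. lie_derivative_form M (mdim M) Z \<mu> Y x"
          and \<beta> = "\<lambda>Y. \<mu> x (\<lambda>i. Y i x)",
          OF tensorial_at_lie_derivative[OF \<mu>' Z] tensorial_at_form[OF \<mu>'] E Y])
  then show ?thesis
    using volume_form_frame_nonzero[OF \<mu> E] by (simp add: divergence_def E_def[symmetric] field_simps)
qed

lemma smooth_lie_derivative:
  assumes Z: "Z \<in> vector_fields M" and Y: "\<And>i. i < mdim M \<Longrightarrow> Y i \<in> vector_fields M"
  shows "(\<lambda>x. lie_derivative_form M (mdim M) Z \<mu> Y x) \<in> smooth_functions M"
proof -
  note \<mu>' = volume_forms_differential[OF \<mu>]
  have s: "(\<lambda>x. \<mu> x ((\<lambda>j. Y j x)(i := lie_bracket M Z (Y i) x))) \<in> smooth_functions M" if i: "i < mdim M" for i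
  proof -
    have "(\<lambda>x. \<mu> x (\<lambda>j. (Y(i := lie_bracket M Z (Y i))) j x)) \<in> smooth_functions M"
      by (rule differential_forms_smooth[OF \<mu>'])
         (use Y lie_bracket_vector_field[OF Z Y[OF i]] in \<open>simp only: fun_upd_def simp_thms split: if_split\<close>)
    moreover have "(\<lambda>j. (Y(i := lie_bracket M Z (Y i))) j x) = (\<lambda>j. Y j x)(i := lie_bracket M Z (Y i) x)" for x
      by auto
    ultimately show ?thesis by simp
  qed
  have 1: "(\<lambda>x. \<Sum>i<mdim M. \<mu> x ((\<lambda>j. Y j x)(i := lie_bracket M Z (Y i) x))) \<in> smooth_functions M"
    by (rule smooth_sum) (simp only: s lessThan_iff)
  have "(\<lambda>x. \<mu> x (\<lambda>i. Y i x)) \<in> smooth_functions M" by (rule differential_forms_smooth[OF \<mu>' Y])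
  from smooth_diff[OF vector_fields_smooth[OF Z this] 1] show ?thesis
    unfolding lie_derivative_form_def .
qed

text \<open>Fix one frame E at x. Its fields are global, so the same quotient formula computes the
  divergence at every point where \<mu> does not vanish on E, an open set containing x.\<close>

lemma smooth_divergence:
  assumes Z: "Z \<in> vector_fields M"
  shows "divergence \<mu> Z \<in> smooth_functions M"
  unfolding smooth_functions_iff
proof (rule smooth_fun_on_local[OF open_UNIV])
  fix x
  obtain E where E: "frame_at x E" by (rule frame_exists)
  note EV = frame_at_vector_field[OF E]
  let ?m = "\<lambda>y. \<mu> y (\<lambda>i. E i y)" and ?L = "\<lambda>y. lie_derivative_form M (mdim M) Z \<mu> E y"
  have m: "?m \<in> smooth_functions M"
    by (rule differential_forms_smooth[OF volume_forms_differential[OF \<mu>] EV])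
  have L: "?L \<in> smooth_functions M" by (rule smooth_lie_derivative[OF Z EV])
  have "smooth_fun_on M {y. ?m y \<noteq> 0} (\<lambda>y. ?L y / ?m y)"
    by (rule smooth_fun_on_divide[OF smooth_functions_imp_on[OF L] smooth_functions_imp_on[OF m]]) simp
  moreover have "?L y = divergence \<mu> Z y * ?m y" for y
    by (rule lie_derivative_volume_form[OF Z EV])
  ultimately have "smooth_fun_on M {y. ?m y \<noteq> 0} (divergence \<mu> Z)"
    by (intro smooth_fun_on_cong[of "{y. ?m y \<noteq> 0}" "\<lambda>y. ?L y / ?m y" "divergence \<mu> Z"]) simp_all
  then show "\<exists>A. open A \<and> x \<in> A \<and> smooth_fun_on M A (divergence \<mu> Z)"
    using open_nonzero_set[OF m] volume_form_frame_nonzero[OF \<mu> E] by blast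
qed

text \<open>Evaluate on a frame. The bracket of gZ with E k contains - E k (g) Z, and these terms
  add up to Z(g) times the form: the identity of dg wedge the contraction of \<mu> by Z with Z(g)
  \<mu>.\<close>

lemma divergence_lincomb:
  assumes Z: "Z \<in> vector_fields M" and W: "W \<in> vector_fields M"
    and g: "g \<in> smooth_functions M" and h: "h \<in> smooth_functions M"
  shows "divergence \<mu> (\<lambda>x f. g x * Z x f + h x * W x f) x =
    g x * divergence \<mu> Z x + h x * divergence \<mu> W x + Z x g + W x h"
proof -
  let ?n = "mdim M"
  obtain E where E: "frame_at x E" by (rule frame_exists)
  note EV = frame_at_vector_field[OF E]
  define R where "R = (\<lambda>x f. g x * Z x f + h x * W x f)"
  have R: "R \<in> vector_fields M" unfolding R_def by (rule vector_fields_lincomb[OF g h Z W])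
  note af = differential_forms_alternating[OF volume_forms_differential[OF \<mu>], of x]
  let ?v = "\<lambda>j. E j x" and ?m = "\<lambda>y. \<mu> y (\<lambda>i. E i y)"
  have v: "\<And>i. i < ?n \<Longrightarrow> ?v i \<in> tangent_space M x" using vector_fields_tangent[OF EV] .
  note TZ = vector_fields_tangent[OF Z, of x] and TW = vector_fields_tangent[OF W, of x]
  have t: "\<mu> x (?v(k := lie_bracket M R (E k) x)) =
      g x * \<mu> x (?v(k := lie_bracket M Z (E k) x)) + h x * \<mu> x (?v(k := lie_bracket M W (E k) x))
      - (E k x g * \<mu> x (?v(k := Z x)) + E k x h * \<mu> x (?v(k := W x)))" if k: "k < ?n" for k
  proof -
    note BZ = vector_fields_tangent[OF lie_bracket_vector_field[OF Z EV[OF k]], of x]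
      and BW = vector_fields_tangent[OF lie_bracket_vector_field[OF W EV[OF k]], of x]
    have "\<mu> x (?v(k := lie_bracket M R (E k) x)) =
        1 * \<mu> x (?v(k := (\<lambda>f. g x * lie_bracket M Z (E k) x f + h x * lie_bracket M W (E k) x f)))
      + (-1) * \<mu> x (?v(k := (\<lambda>f. E k x g * Z x f + E k x h * W x f)))"
      unfolding R_def lie_bracket_lincomb_left[OF EV[OF k] Z W g h]
      by (rule alternating_form_lincomb[OF af v k tangent_space_lincomb[OF BZ BW] tangent_space_lincomb[OF TZ TW]])
    also have "\<mu> x (?v(k := (\<lambda>f. g x * lie_bracket M Z (E k) x f + h x * lie_bracket M W (E k) x f)))
      = g x * \<mu> x (?v(k := lie_bracket M Z (E k) x)) + h x * \<mu> x (?v(k := lie_bracket M W (E k) x))"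
      by (rule alternating_form_lincomb[OF af v k BZ BW])
    also have "\<mu> x (?v(k := (\<lambda>f. E k x g * Z x f + E k x h * W x f)))
      = E k x g * \<mu> x (?v(k := Z x)) + E k x h * \<mu> x (?v(k := W x))"
      by (rule alternating_form_lincomb[OF af v k TZ TW])
    finally show ?thesis by (simp only: mult_1 mult_minus1 diff_conv_add_uminus)
  qed
  \<comment> \<open>Cramer's rule: putting w in place of the k-th frame vector multiplies the form
    by the k-th coordinate of w. Weighting with \<open>E k x u\<close> and summing reassembles
    \<open>w u\<close>.\<close>
  have sum: "(\<Sum>k<?n. E k x u * \<mu> x (?v(k := w))) = w u * \<mu> x ?v" if w: "w \<in> tangent_space M x" for w u
  proof -
    obtain a where a: "w = (\<lambda>f. \<Sum>i<?n. a i * E i x f)" using frame_at_span[OF E w] .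
    have "\<mu> x (?v(k := w)) = a k * \<mu> x ?v" if k: "k < ?n" for k
    proof -
      have "\<mu> x (?v(k := w)) = (\<Sum>j<?n. a j * \<mu> x (?v(k := E j x)))"
        unfolding a by (rule alternating_form_sum[OF af v k v])
      also have "\<dots> = (\<Sum>j\<in>{k}. a j * \<mu> x (?v(k := E j x)))"
      proof (rule sum.mono_neutral_right)
        show "\<forall>j\<in>{..<?n} - {k}. a j * \<mu> x (?v(k := E j x)) = 0"
        proof
          fix j assume j: "j \<in> {..<?n} - {k}"
          interpret alternating ?n "tangent_space M x" "\<lambda>u w f. u f + w f" "\<mu> x"
            by (rule alternating_form_alternating[OF af])
          have "\<mu> x (?v(k := E j x)) = 0"
            by (rule alt'[of _ j k]) (use j k v in auto)
          then show "a j * \<mu> x (?v(k := E j x)) = 0" by simp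
        qed
      qed (use k in auto)
      finally show ?thesis by (simp add: fun_upd_idem)
    qed
    then have "(\<Sum>k<?n. E k x u * \<mu> x (?v(k := w))) = (\<Sum>k<?n. a k * E k x u * \<mu> x ?v)"
      by (intro sum.cong) auto
    then show ?thesis by (simp add: a sum_distrib_right)
  qed
  have "lie_derivative_form M ?n R \<mu> E x = g x * lie_derivative_form M ?n Z \<mu> E x
      + h x * lie_derivative_form M ?n W \<mu> E x + (Z x g * ?m x + W x h * ?m x)"
  proof -
    have "(\<Sum>k<?n. \<mu> x (?v(k := lie_bracket M R (E k) x))) =
      (\<Sum>k<?n. g x * \<mu> x (?v(k := lie_bracket M Z (E k) x)) + h x * \<mu> x (?v(k := lie_bracket M W (E k) x))
      - (E k x g * \<mu> x (?v(k := Z x)) + E k x h * \<mu> x (?v(k := W x))))"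
      by (rule sum.cong[OF refl]) (simp only: t lessThan_iff)
    also have "\<dots> = g x * (\<Sum>k<?n. \<mu> x (?v(k := lie_bracket M Z (E k) x)))
      + h x * (\<Sum>k<?n. \<mu> x (?v(k := lie_bracket M W (E k) x)))
      - (\<Sum>k<?n. E k x g * \<mu> x (?v(k := Z x))) - (\<Sum>k<?n. E k x h * \<mu> x (?v(k := W x)))"
      unfolding sum_subtractf sum.distrib sum_distrib_left by (simp only: algebra_simps)
    finally have s: "(\<Sum>k<?n. \<mu> x (?v(k := lie_bracket M R (E k) x))) =
      g x * (\<Sum>k<?n. \<mu> x (?v(k := lie_bracket M Z (E k) x)))
      + h x * (\<Sum>k<?n. \<mu> x (?v(k := lie_bracket M W (E k) x))) - Z x g * ?m x - W x h * ?m x"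
      unfolding sum[OF TZ] sum[OF TW] .
    have "R x ?m = g x * Z x ?m + h x * W x ?m" by (simp add: R_def)
    then show ?thesis unfolding lie_derivative_form_def s by (simp only: algebra_simps)
  qed
  moreover have LE: "lie_derivative_form M ?n X \<mu> E x = divergence \<mu> X x * ?m x"
    if "X \<in> vector_fields M" for X
    by (rule lie_derivative_volume_form[OF that EV])
  ultimately have "divergence \<mu> R x * ?m x = (g x * divergence \<mu> Z x + h x * divergence \<mu> W x + Z x g + W x h) * ?m x"
    unfolding LE[OF R] LE[OF Z] LE[OF W] by (simp only: algebra_simps)
  then show ?thesis unfolding R_def using volume_form_frame_nonzero[OF \<mu> E] by simp
qed

end

lemma volume_forms_scale_exp:
  assumes \<mu>: "\<mu> \<in> volume_forms M" and h: "h \<in> smooth_functions M"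
  shows "(\<lambda>x v. exp (h x) * \<mu> x v) \<in> volume_forms M"
proof -
  note \<mu>' = volume_forms_differential[OF \<mu>]
  have "alternating_form M (mdim M) x (\<lambda>v. exp (h x) * \<mu> x v)" for x
  proof -
    note af = differential_forms_alternating[OF \<mu>', of x]
    show ?thesis unfolding alternating_form_def
    proof (intro conjI allI impI ballI)
      show "exp (h x) * \<mu> x v = exp (h x) * \<mu> x w" if "\<forall>i<mdim M. v i = w i" for v w
        using alternating_form_depends[OF af, of v w] that by simp
      show "exp (h x) * \<mu> x (v(i := (\<lambda>f. a * u f + b * w f))) =
          a * (exp (h x) * \<mu> x (v(i := u))) + b * (exp (h x) * \<mu> x (v(i := w)))"
        if "\<forall>i<mdim M. v i \<in> tangent_space M x" "i < mdim M" "u \<in> tangent_space M x" "w \<in> tangent_space M x"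
        for v i u w a b
      proof -
        have *: "\<mu> x (v(i := (\<lambda>f. a * u f + b * w f))) = a * \<mu> x (v(i := u)) + b * \<mu> x (v(i := w))"
          by (rule alternating_form_lincomb[OF af _ that(2-)]) (use that(1) in blast)
        show ?thesis unfolding * by (simp only: algebra_simps)
      qed
      show "exp (h x) * \<mu> x v = 0" if "\<forall>i<mdim M. v i \<in> tangent_space M x" "j < mdim M" "i < j" "v i = v j" for v i j
        using alternating_form_alt[OF af _ that(3,2,4)] that(1) by simp
    qed
  qed
  moreover have "(\<lambda>x. exp (h x) * \<mu> x (\<lambda>i. Y i x)) \<in> smooth_functions M"
    if "\<forall>i<mdim M. Y i \<in> vector_fields M" for Y
    by (rule smooth_mult[OF smooth_exp[OF h] differential_forms_smooth[OF \<mu>']]) (use that in blast)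
  ultimately show ?thesis
    using \<mu> by (simp add: volume_forms_def differential_forms_def)
qed

text \<open>M may be disconnected, so g may change sign between components and the logarithm is
  taken of its square. The proportionality is restricted to tangent vectors because forms are not
  normalised on other tuples.\<close>

lemma volume_forms_ratio:
  assumes \<mu>: "\<mu> \<in> volume_forms M" and \<mu>': "\<mu>' \<in> volume_forms M"
  shows "\<exists>g\<in>smooth_functions M. \<exists>h\<in>smooth_functions M. (\<forall>x. (g x)\<^sup>2 = exp (2 * h x)) \<and>
    (\<forall>x v. (\<forall>i<mdim M. v i \<in> tangent_space M x) \<longrightarrow> \<mu>' x v = g x * \<mu> x v)"
proof -
  define F where "F x = (SOME E. frame_at x E)" for x
  have F: "frame_at x (F x)" for x unfolding F_def by (rule some_frame)
  define g where "g x = \<mu>' x (\<lambda>i. F x i x) / \<mu> x (\<lambda>i. F x i x)" for x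
  note nz = volume_form_frame_nonzero[OF \<mu>] and nz' = volume_form_frame_nonzero[OF \<mu>']
  note d = volume_forms_differential[OF \<mu>] and d' = volume_forms_differential[OF \<mu>']
  have ratio: "\<mu>' x v = g x * \<mu> x v" if v: "\<And>i. i < mdim M \<Longrightarrow> v i \<in> tangent_space M x" for x v
  proof -
    obtain Y where Y: "\<And>i. i < mdim M \<Longrightarrow> Y i \<in> vector_fields M" "\<And>i. i < mdim M \<Longrightarrow> Y i x = v i"
      using v by (rule tangent_tuple_extend[where v = v and x = x]) (assumption, rule that)
    have "\<mu>' x (\<lambda>i. Y i x) * \<mu> x (\<lambda>i. F x i x) = \<mu> x (\<lambda>i. Y i x) * \<mu>' x (\<lambda>i. F x i x)"
      by (rule tensorial_at_proportional[where \<alpha> = "\<lambda>Y. \<mu>' x (\<lambda>i. Y i x)" and \<beta> = "\<lambda>Y. \<mu> x (\<lambda>i. Y i x)" and Y = Y,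
            OF tensorial_at_form[OF d'] tensorial_at_form[OF d] F Y(1)])
    moreover have "\<mu> x (\<lambda>i. Y i x) = \<mu> x v"
      by (rule alternating_form_depends[OF differential_forms_alternating[OF d]]) (rule Y(2))
    moreover have "\<mu>' x (\<lambda>i. Y i x) = \<mu>' x v"
      by (rule alternating_form_depends[OF differential_forms_alternating[OF d']]) (rule Y(2))
    ultimately show ?thesis using nz[OF F, of x] by (simp add: g_def field_simps)
  qed
  have g: "g \<in> smooth_functions M"
    unfolding smooth_functions_iff
  proof (rule smooth_fun_on_local[OF open_UNIV])
    fix x
    obtain E where E: "frame_at x E" by (rule frame_exists)
    note EV = frame_at_vector_field[OF E]
    let ?m = "\<lambda>y. \<mu> y (\<lambda>i. E i y)" and ?m' = "\<lambda>y. \<mu>' y (\<lambda>i. E i y)"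
    have m: "?m \<in> smooth_functions M" by (rule differential_forms_smooth[OF d EV])
    have m': "?m' \<in> smooth_functions M" by (rule differential_forms_smooth[OF d' EV])
    have eq: "?m' y = g y * ?m y" for y by (rule ratio[OF vector_fields_tangent[OF EV]])
    have "smooth_fun_on M {y. ?m y \<noteq> 0} (\<lambda>y. ?m' y / ?m y)"
      by (rule smooth_fun_on_divide[OF smooth_functions_imp_on[OF m'] smooth_functions_imp_on[OF m]]) simp
    then have "smooth_fun_on M {y. ?m y \<noteq> 0} g"
      by (rule smooth_fun_on_cong[rotated]) (simp add: eq)
    then show "\<exists>A. open A \<and> x \<in> A \<and> smooth_fun_on M A g"
      using open_nonzero_set[OF m] nz[OF E] by blast
  qed
  have g0: "g x \<noteq> 0" for x using nz[OF F] nz'[OF F] by (simp add: g_def)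
  \<comment> \<open>This is ln |g|, written so that only smooth operations occur.\<close>
  define h where "h x = inverse 2 * ln ((g x)\<^sup>2)" for x
  have "smooth_fun_on M UNIV (\<lambda>x. ln ((g x)\<^sup>2))"
    by (rule smooth_fun_on_ln[OF smooth_functions_imp_on[OF smooth_power[OF g]]]) (simp add: g0)
  then have "(\<lambda>x. ln ((g x)\<^sup>2)) \<in> smooth_functions M" by (simp only: smooth_functions_iff)
  then have "h \<in> smooth_functions M"
    unfolding h_def[abs_def] by (rule smooth_mult[OF smooth_const])
  moreover have "(g x)\<^sup>2 = exp (2 * h x)" for x
    using g0[of x] by (simp add: h_def)
  ultimately show ?thesis using g ratio by blast
qed

end

section \<open>Poisson manifolds and modular vector fields\<close>

lemma cotangent_lincomb:
  "\<xi> \<in> cotangent_space M x \<Longrightarrow> v \<in> tangent_space M x \<Longrightarrow> w \<in> tangent_space M x \<Longrightarrow>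
    \<xi> (\<lambda>f. a * v f + b * w f) = a * \<xi> v + b * \<xi> w"
  by (simp add: cotangent_space_def)

lemma cotangent_zero:
  assumes "\<xi> \<in> cotangent_space M x" shows "\<xi> (\<lambda>f. 0) = 0"
  using cotangent_lincomb[OF assms tangent_space_zero tangent_space_zero, of 0 0] by simp

lemma differential_cotangent: "differential M f x \<in> cotangent_space M x"
  by (simp add: cotangent_space_def differential_def tangent_space_lincomb)

lemma differential_lincomb:
  assumes "f \<in> smooth_functions M" "g \<in> smooth_functions M"
  shows "differential M (\<lambda>y. a * f y + b * g y) x = (\<lambda>v. a * differential M f x v + b * differential M g x v)"
  by (rule ext) (simp add: differential_def tangent_lincomb[of _ M x, OF _ assms])

lemma differential_mult:
  assumes "f \<in> smooth_functions M" "g \<in> smooth_functions M"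
  shows "differential M (\<lambda>y. f y * g y) x = (\<lambda>v. f x * differential M g x v + g x * differential M f x v)"
  by (rule ext) (simp add: differential_def tangent_mult[of _ M x, OF _ assms])

lemma differential_one_form:
  assumes "f \<in> smooth_functions M"
  shows "differential M f \<in> one_forms M"
  using vector_fields_smooth[OF _ assms] differential_cotangent
  by (auto simp: one_forms_along_def differential_def vector_fields_tangent)

locale poisson_mfd = smooth_mfd M
  for M :: "('a::{t2_space,second_countable_topology}, 'e::euclidean_space) manifold" +
  fixes \<pi> :: "'a bivector_field"
  assumes bivector: "\<pi> \<in> bivector_fields M"
begin

lemma bivector_antisym:
  "\<xi> \<in> cotangent_space M x \<Longrightarrow> \<eta> \<in> cotangent_space M x \<Longrightarrow> \<pi> x \<xi> \<eta> = - \<pi> x \<eta> \<xi>"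
  using bivector unfolding bivector_fields_def by blast

lemma bivector_lincomb_left:
  "\<xi> \<in> cotangent_space M x \<Longrightarrow> \<eta> \<in> cotangent_space M x \<Longrightarrow> \<zeta> \<in> cotangent_space M x \<Longrightarrow>
    \<pi> x (\<lambda>v. a * \<xi> v + b * \<eta> v) \<zeta> = a * \<pi> x \<xi> \<zeta> + b * \<pi> x \<eta> \<zeta>"
  using bivector unfolding bivector_fields_def by blast

lemma cotangent_space_lincomb:
  assumes "\<xi> \<in> cotangent_space M x" "\<eta> \<in> cotangent_space M x"
  shows "(\<lambda>v. a * \<xi> v + b * \<eta> v) \<in> cotangent_space M x"
  using assms by (simp add: cotangent_space_def algebra_simps)

lemma bivector_lincomb_right:
  assumes "\<xi> \<in> cotangent_space M x" "\<eta> \<in> cotangent_space M x" "\<zeta> \<in> cotangent_space M x"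
  shows "\<pi> x \<zeta> (\<lambda>v. a * \<xi> v + b * \<eta> v) = a * \<pi> x \<zeta> \<xi> + b * \<pi> x \<zeta> \<eta>"
  unfolding bivector_antisym[OF assms(3) cotangent_space_lincomb[OF assms(1,2)]]
    bivector_lincomb_left[OF assms] bivector_antisym[OF assms(1,3)] bivector_antisym[OF assms(2,3)]
  by simp

lemma sharp_tangent:
  assumes "\<xi> \<in> cotangent_space M x"
  shows "sharp M \<pi> x \<xi> \<in> tangent_space M x"
proof (rule tangent_spaceI)
  fix f g :: "'a \<Rightarrow> real" and a b :: real
  assume f: "f \<in> smooth_functions M" and g: "g \<in> smooth_functions M"
  show "sharp M \<pi> x \<xi> (\<lambda>y. a * f y + b * g y) = a * sharp M \<pi> x \<xi> f + b * sharp M \<pi> x \<xi> g"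
    by (simp add: sharp_def f g smooth_lincomb differential_lincomb
        bivector_lincomb_right[OF differential_cotangent differential_cotangent assms])
  show "sharp M \<pi> x \<xi> (\<lambda>y. f y * g y) = f x * sharp M \<pi> x \<xi> g + g x * sharp M \<pi> x \<xi> f"
    by (simp add: sharp_def f g smooth_mult differential_mult
        bivector_lincomb_right[OF differential_cotangent differential_cotangent assms])
qed (simp add: sharp_def)

abbreviation "ham \<equiv> hamiltonian M \<pi>"

lemma hamiltonian_apply:
  "f \<in> smooth_functions M \<Longrightarrow> ham h x f = \<pi> x (differential M h x) (differential M f x)"
  by (simp add: hamiltonian_def sharp_def)

lemma hamiltonian_vector_field:
  assumes h: "h \<in> smooth_functions M"
  shows "ham h \<in> vector_fields M"
proof (rule vector_fieldsI)
  show "ham h x \<in> tangent_space M x" for x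
    unfolding hamiltonian_def by (rule sharp_tangent[OF differential_cotangent])
  show "(\<lambda>x. ham h x f) \<in> smooth_functions M" if "f \<in> smooth_functions M" for f
    using bivector differential_one_form[OF h] differential_one_form[OF that]
    unfolding hamiltonian_apply[OF that] bivector_fields_def by blast
qed

lemma hamiltonian_antisym:
  assumes "f \<in> smooth_functions M" "g \<in> smooth_functions M"
  shows "ham f x g = - ham g x f"
  unfolding hamiltonian_apply[OF assms(1)] hamiltonian_apply[OF assms(2)]
  by (rule bivector_antisym[OF differential_cotangent differential_cotangent])

lemma hamiltonian_lincomb:
  assumes "f \<in> smooth_functions M" "g \<in> smooth_functions M"
  shows "ham (\<lambda>y. a * f y + b * g y) = (\<lambda>x u. a * ham f x u + b * ham g x u)"
  by (intro ext) (simp add: hamiltonian_def sharp_def differential_lincomb[OF assms]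
      bivector_lincomb_left[OF differential_cotangent differential_cotangent differential_cotangent])

lemma hamiltonian_mult:
  assumes "f \<in> smooth_functions M" "g \<in> smooth_functions M"
  shows "ham (\<lambda>y. f y * g y) = (\<lambda>x u. f x * ham g x u + g x * ham f x u)"
  by (intro ext) (simp add: hamiltonian_def sharp_def differential_mult[OF assms]
      bivector_lincomb_left[OF differential_cotangent differential_cotangent differential_cotangent])

text \<open>The right-hand side is a derivation because the extra terms \<open>X\<^sub>g(f) + X\<^sub>f(g)\<close> in the Leibniz
  rule cancel.\<close>

lemma modular_vector_field_eq:
  assumes \<mu>: "\<mu> \<in> volume_forms M"
  shows "modular_vector_field M \<pi> \<mu> =
    (\<lambda>x f. if f \<in> smooth_functions M then divergence \<mu> (ham f) x else 0)" (is "_ = ?X")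
proof -
  have X: "?X \<in> vector_fields M"
  proof (rule vector_fieldsI)
    show "?X x \<in> tangent_space M x" for x
    proof (rule tangent_spaceI)
      fix f g :: "'a \<Rightarrow> real" and a b :: real
      assume f: "f \<in> smooth_functions M" and g: "g \<in> smooth_functions M"
      note hf = hamiltonian_vector_field[OF f] and hg = hamiltonian_vector_field[OF g]
      have "divergence \<mu> (ham (\<lambda>y. a * f y + b * g y)) x =
          a * divergence \<mu> (ham f) x + b * divergence \<mu> (ham g) x + ham f x (\<lambda>y. a) + ham g x (\<lambda>y. b)"
        unfolding hamiltonian_lincomb[OF f g] by (rule divergence_lincomb[OF \<mu> hf hg smooth_const smooth_const])
      then show "?X x (\<lambda>y. a * f y + b * g y) = a * ?X x f + b * ?X x g"
        using f g smooth_lincomb[OF f g]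
          tangent_const[OF vector_fields_tangent[OF hf]] tangent_const[OF vector_fields_tangent[OF hg]]
        by simp
      have "divergence \<mu> (ham (\<lambda>y. f y * g y)) x =
          f x * divergence \<mu> (ham g) x + g x * divergence \<mu> (ham f) x + ham g x f + ham f x g"
        unfolding hamiltonian_mult[OF f g] by (rule divergence_lincomb[OF \<mu> hg hf f g])
      then show "?X x (\<lambda>y. f y * g y) = f x * ?X x g + g x * ?X x f"
        using f g smooth_mult[OF f g] hamiltonian_antisym[OF f g, of x] by simp
    qed simp
    show "(\<lambda>x. ?X x f) \<in> smooth_functions M" if "f \<in> smooth_functions M" for f
      using smooth_divergence[OF \<mu> hamiltonian_vector_field[OF that]] that by simp
  qed
  show ?thesis
    unfolding modular_vector_field_def
  proof (rule the_equality, intro conjI ballI allI impI X)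
    fix f Y x assume f: "f \<in> smooth_functions M" and Y: "\<forall>i<mdim M. Y i \<in> vector_fields M"
    have "lie_derivative_form M (mdim M) (ham f) \<mu> Y x = divergence \<mu> (ham f) x * \<mu> x (\<lambda>i. Y i x)"
      by (rule lie_derivative_volume_form[OF \<mu> hamiltonian_vector_field[OF f]]) (use Y in blast)
    then show "lie_derivative_form M (mdim M) (ham f) \<mu> Y x = ?X x f * \<mu> x (\<lambda>i. Y i x)" using f by simp
  next
    fix Z assume Z: "Z \<in> vector_fields M \<and> (\<forall>f\<in>smooth_functions M. \<forall>Y. (\<forall>i<mdim M. Y i \<in> vector_fields M) \<longrightarrow>
           (\<forall>x. lie_derivative_form M (mdim M) (ham f) \<mu> Y x = Z x f * \<mu> x (\<lambda>i. Y i x)))"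
    \<comment> \<open>Uniqueness for the description operator: on a frame the factor
      \<open>\<mu> x\<close> is nonzero and can be cancelled, and at non-smooth f both sides are
      0.\<close>
    show "Z = ?X"
    proof (intro ext)
      fix x f
      show "Z x f = ?X x f"
      proof (cases "f \<in> smooth_functions M")
        case f: True
        obtain E where E: "frame_at x E" by (rule frame_exists)
        note EV = frame_at_vector_field[OF E]
        have "lie_derivative_form M (mdim M) (ham f) \<mu> E x = Z x f * \<mu> x (\<lambda>i. E i x)"
          using Z f EV by blast
        moreover have "lie_derivative_form M (mdim M) (ham f) \<mu> E x = divergence \<mu> (ham f) x * \<mu> x (\<lambda>i. E i x)"
          by (rule lie_derivative_volume_form[OF \<mu> hamiltonian_vector_field[OF f] EV])
        ultimately show ?thesis using f volume_form_frame_nonzero[OF \<mu> E] by simp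
      next
        case False
        have "Z x \<in> tangent_space M x" by (rule vector_fields_tangent[OF conjunct1[OF Z]])
        then show ?thesis using False by (simp add: tangent_nonsmooth)
      qed
    qed
  qed
qed

text \<open>Replacing \<mu> by g \<mu> adds Z(g)/g to the divergence of Z, and Z(g)/g = Z(h). For Z
  = X_f the added term is X_f(h) = - X_h(f), which explains the minus sign.\<close>

lemma modular_vector_field_rescale:
  assumes \<mu>: "\<mu> \<in> volume_forms M" and \<mu>': "\<mu>' \<in> volume_forms M"
    and g: "g \<in> smooth_functions M" and h: "h \<in> smooth_functions M" and gh: "\<And>x. (g x)\<^sup>2 = exp (2 * h x)"
    and ratio: "\<And>x v. (\<And>i. i < mdim M \<Longrightarrow> v i \<in> tangent_space M x) \<Longrightarrow> \<mu>' x v = g x * \<mu> x v"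
  shows "modular_vector_field M \<pi> \<mu>' = (\<lambda>x f. modular_vector_field M \<pi> \<mu> x f - ham h x f)"
proof (intro ext)
  fix x f
  show "modular_vector_field M \<pi> \<mu>' x f = modular_vector_field M \<pi> \<mu> x f - ham h x f"
  proof (cases "f \<in> smooth_functions M")
    case f: True
    let ?n = "mdim M"
    obtain E where E: "frame_at x E" by (rule frame_exists)
    note EV = frame_at_vector_field[OF E] and hf = hamiltonian_vector_field[OF f]
    note tf = vector_fields_tangent[OF hf]
    let ?m = "\<lambda>y. \<mu> y (\<lambda>i. E i y)" and ?m' = "\<lambda>y. \<mu>' y (\<lambda>i. E i y)"
    have m: "?m \<in> smooth_functions M"
      by (rule differential_forms_smooth[OF volume_forms_differential[OF \<mu>] EV])
    have m': "?m' y = g y * ?m y" for y by (rule ratio[OF vector_fields_tangent[OF EV]])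
    \<comment> \<open>The logarithmic derivative without a chain rule for \<open>ln\<close>:
      applying X_f to g^2 = exp (2 h) gives 2 g X_f(g) = 2 g^2 X_f(h), and g has no zero.\<close>
    have dg: "ham f x g = g x * ham f x h"
    proof -
      have h2: "(\<lambda>y. 2 * h y) \<in> smooth_functions M" by (rule smooth_mult[OF smooth_const h])
      have gg: "g y * g y = exp (2 * h y)" for y using gh[of y] by (simp only: power2_eq_square)
      have "2 * (g x * ham f x g) = ham f x (\<lambda>y. g y * g y)"
        using tangent_mult[OF tf g g, of x] by simp
      also have "\<dots> = exp (2 * h x) * ham f x (\<lambda>y. 2 * h y)"
        unfolding gg by (rule tangent_exp[OF tf h2])
      also have "\<dots> = 2 * (g x * (g x * ham f x h))"
        unfolding gg[symmetric] tangent_cmult[OF tf h] by simp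
      finally have "g x * ham f x g = g x * (g x * ham f x h)" by simp
      moreover have "g x \<noteq> 0" using gg[of x] by auto
      ultimately show ?thesis by simp
    qed
    have "lie_derivative_form M ?n (ham f) \<mu>' E x = g x * lie_derivative_form M ?n (ham f) \<mu> E x + ?m x * ham f x g"
    proof -
      have "\<mu>' x ((\<lambda>j. E j x)(i := lie_bracket M (ham f) (E i) x)) =
          g x * \<mu> x ((\<lambda>j. E j x)(i := lie_bracket M (ham f) (E i) x))" if i: "i < ?n" for i
      proof (rule ratio)
        fix j assume "j < ?n"
        then show "((\<lambda>j. E j x)(i := lie_bracket M (ham f) (E i) x)) j \<in> tangent_space M x"
          using vector_fields_tangent[OF EV] vector_fields_tangent[OF lie_bracket_vector_field[OF hf EV[OF i]]]
          by (cases "j = i") (simp_all only: fun_upd_same fun_upd_other not_False_eq_True)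
      qed
      then have "(\<Sum>i<?n. \<mu>' x ((\<lambda>j. E j x)(i := lie_bracket M (ham f) (E i) x))) =
          g x * (\<Sum>i<?n. \<mu> x ((\<lambda>j. E j x)(i := lie_bracket M (ham f) (E i) x)))"
        unfolding sum_distrib_left by (intro sum.cong) simp_all
      moreover have "ham f x ?m' = g x * ham f x ?m + ?m x * ham f x g"
        unfolding m' by (rule tangent_mult[OF tf g m])
      ultimately show ?thesis unfolding lie_derivative_form_def by (simp only: algebra_simps)
    qed
    moreover have "lie_derivative_form M ?n (ham f) \<mu>' E x = divergence \<mu>' (ham f) x * ?m' x"
      by (rule lie_derivative_volume_form[OF \<mu>' hf EV])
    moreover have "lie_derivative_form M ?n (ham f) \<mu> E x = divergence \<mu> (ham f) x * ?m x"
      by (rule lie_derivative_volume_form[OF \<mu> hf EV])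
    ultimately have "divergence \<mu>' (ham f) x * ?m' x = (divergence \<mu> (ham f) x + ham f x h) * ?m' x"
      unfolding m' dg by (simp only: algebra_simps)
    then have "divergence \<mu>' (ham f) x = divergence \<mu> (ham f) x + ham f x h"
      using volume_form_frame_nonzero[OF \<mu>' E] by simp
    then show ?thesis
      using f hamiltonian_antisym[OF f h, of x]
      by (simp add: modular_vector_field_eq[OF \<mu>] modular_vector_field_eq[OF \<mu>'])
  next
    case False
    then show ?thesis
      by (simp add: modular_vector_field_eq[OF \<mu>] modular_vector_field_eq[OF \<mu>'] hamiltonian_def sharp_def)
  qed
qed

lemma modular_vector_field_change:
  assumes "\<mu> \<in> volume_forms M" "\<mu>' \<in> volume_forms M"
  obtains h where "h \<in> smooth_functions M"
    "modular_vector_field M \<pi> \<mu>' = (\<lambda>x f. modular_vector_field M \<pi> \<mu> x f - ham h x f)"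
proof -
  obtain g h where gh: "g \<in> smooth_functions M" "h \<in> smooth_functions M" "\<forall>x. (g x)\<^sup>2 = exp (2 * h x)"
    "\<forall>x v. (\<forall>i<mdim M. v i \<in> tangent_space M x) \<longrightarrow> \<mu>' x v = g x * \<mu> x v"
    using volume_forms_ratio[OF assms] by blast
  have "modular_vector_field M \<pi> \<mu>' = (\<lambda>x f. modular_vector_field M \<pi> \<mu> x f - ham h x f)"
  proof (rule modular_vector_field_rescale[OF assms gh(1,2)])
    show "(g x)\<^sup>2 = exp (2 * h x)" for x using gh(3) by blast
    show "\<mu>' x v = g x * \<mu> x v" if "\<And>i. i < mdim M \<Longrightarrow> v i \<in> tangent_space M x" for x v
      using gh(4) that by blast
  qed
  then show ?thesis by (rule that[OF gh(2)])
qed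

lemma modular_vector_field_exp:
  assumes \<mu>: "\<mu> \<in> volume_forms M" and h: "h \<in> smooth_functions M"
  shows "modular_vector_field M \<pi> (\<lambda>x v. exp (h x) * \<mu> x v) =
    (\<lambda>x f. modular_vector_field M \<pi> \<mu> x f - ham h x f)"
  by (rule modular_vector_field_rescale[OF \<mu> volume_forms_scale_exp[OF \<mu> h] smooth_exp[OF h] h])
     (simp_all add: exp_double)

end

section \<open>Tangent and cotangent maps, and the zero cocycle\<close>

lemma tangent_map_tangent:
  assumes M: "smooth_manifold M" and N: "smooth_manifold N" and \<phi>: "smooth_map M N \<phi>"
    and v: "v \<in> tangent_space M x"
  shows "tangent_map N \<phi> v \<in> tangent_space N (\<phi> x)"
proof (rule tangent_spaceI)
  interpret N: smooth_mfd N by unfold_locales (rule N)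
  fix f g and a b :: real assume f: "f \<in> smooth_functions N" and g: "g \<in> smooth_functions N"
  note c = smooth_map_compose[OF M N \<phi> f] smooth_map_compose[OF M N \<phi> g]
  show "tangent_map N \<phi> v (\<lambda>y. a * f y + b * g y) = a * tangent_map N \<phi> v f + b * tangent_map N \<phi> v g"
    using tangent_lincomb[OF v c, of a b] by (simp add: tangent_map_def f g N.smooth_lincomb comp_def)
  show "tangent_map N \<phi> v (\<lambda>y. f y * g y) = f (\<phi> x) * tangent_map N \<phi> v g + g (\<phi> x) * tangent_map N \<phi> v f"
    using tangent_mult[OF v c] by (simp add: tangent_map_def f g N.smooth_mult comp_def)
qed (simp add: tangent_map_def)

lemma cotangent_map_cotangent:
  assumes M: "smooth_manifold M" and N: "smooth_manifold N" and \<phi>: "smooth_map M N \<phi>"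
    and \<xi>: "\<xi> \<in> cotangent_space N (\<phi> x)"
  shows "cotangent_map M N \<phi> x \<xi> \<in> cotangent_space M x"
proof -
  have "cotangent_map M N \<phi> x \<xi> (\<lambda>f. a * v f + b * w f) =
      a * cotangent_map M N \<phi> x \<xi> v + b * cotangent_map M N \<phi> x \<xi> w"
    if v: "v \<in> tangent_space M x" and w: "w \<in> tangent_space M x" for v w a b
  proof -
    have "tangent_map N \<phi> (\<lambda>f. a * v f + b * w f) =
        (\<lambda>f. a * tangent_map N \<phi> v f + b * tangent_map N \<phi> w f)"
      by (rule ext) (simp add: tangent_map_def)
    then show ?thesis
      using cotangent_lincomb[OF \<xi> tangent_map_tangent[OF M N \<phi> v] tangent_map_tangent[OF M N \<phi> w], of a b]
      by (simp add: cotangent_map_def v w tangent_space_lincomb)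
  qed
  then show ?thesis by (simp add: cotangent_space_def cotangent_map_def)
qed

text \<open>The first two terms of \<open>coboundary1\<close> apply a derivation to the zero
  function, the third a covector to the zero vector. This makes the zero field a member of its own
  class, so that equality with that class can be exploited.\<close>

lemma zero_cocycle:
  assumes M: "poisson_manifold M \<pi>\<^sub>M" and N: "poisson_manifold N \<pi>\<^sub>N" and \<phi>: "smooth_map M N \<phi>"
  shows "(\<lambda>x f. 0) \<in> cocycles1 M \<pi>\<^sub>M N \<pi>\<^sub>N \<phi>"
proof -
  have M': "smooth_manifold M" and N': "smooth_manifold N"
    using M N by (simp_all add: poisson_manifold_def)
  interpret M: poisson_mfd M \<pi>\<^sub>M
    by unfold_locales (use M in \<open>simp_all add: poisson_manifold_def\<close>)
  have zero: "s x (\<lambda>f. 0) = 0" if "s \<in> one_forms_along M N \<phi>" for s x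
  proof -
    have "s x \<in> cotangent_space N (\<phi> x)" using that by (simp add: one_forms_along_def)
    then show ?thesis by (rule cotangent_zero)
  qed
  have anc: "anchor M \<pi>\<^sub>M N \<phi> x (s x) (\<lambda>y. 0) = 0" if "s \<in> one_forms_along M N \<phi>" for s x
  proof -
    have "s x \<in> cotangent_space N (\<phi> x)" using that by (simp add: one_forms_along_def)
    then have "anchor M \<pi>\<^sub>M N \<phi> x (s x) \<in> tangent_space M x"
      unfolding anchor_def by (intro M.sharp_tangent cotangent_map_cotangent[OF M' N' \<phi>])
    then show ?thesis by (rule M.tangent_const)
  qed
  have V: "(\<lambda>x f. 0) \<in> vector_fields_along M N \<phi>"
    by (simp add: vector_fields_along_def tangent_space_zero M.smooth_const)
  have "coboundary1 M \<pi>\<^sub>M N \<phi> B (\<lambda>x f. 0) s t x = 0"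
    if B: "is_pullback_bracket M \<pi>\<^sub>M N \<pi>\<^sub>N \<phi> B" and s: "s \<in> one_forms_along M N \<phi>"
      and t: "t \<in> one_forms_along M N \<phi>" for B s t x
  proof -
    have "B s t \<in> one_forms_along M N \<phi>" using B s t unfolding is_pullback_bracket_def by blast
    then show ?thesis by (simp add: coboundary1_def zero s t anc)
  qed
  then show ?thesis using V unfolding cocycles1_def by blast
qed

section \<open>Independence of the volume forms, and the equivalence\<close>

theorem corollary1p13:
  fixes M :: "('a::{t2_space,second_countable_topology}, 'e::euclidean_space) manifold"
    and N :: "('b::{t2_space,second_countable_topology}, 'f::euclidean_space) manifold"
    and \<pi>\<^sub>M :: "'a bivector_field" and \<pi>\<^sub>N :: "'b bivector_field" and \<phi> :: "'a \<Rightarrow> 'b"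
  assumes "poisson_manifold M \<pi>\<^sub>M" and "orientable_manifold M"
    and "poisson_manifold N \<pi>\<^sub>N" and "orientable_manifold N"
    and "poisson_map M \<pi>\<^sub>M N \<pi>\<^sub>N \<phi>"
  shows "modular_class M \<pi>\<^sub>M N \<pi>\<^sub>N \<phi> = zero_cohomology_class M \<pi>\<^sub>M N \<pi>\<^sub>N \<phi> \<longleftrightarrow>
    (\<exists>\<mu>\<in>volume_forms M. \<exists>\<nu>\<in>volume_forms N.
       (\<lambda>x. tangent_map N \<phi> (modular_vector_field M \<pi>\<^sub>M \<mu> x)) = modular_vector_field N \<pi>\<^sub>N \<nu> \<circ> \<phi>)"
proof -
  have M': "smooth_manifold M" and N': "smooth_manifold N"
    using assms by (simp_all add: poisson_manifold_def)
  interpret M: poisson_mfd M \<pi>\<^sub>M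
    by unfold_locales (use assms in \<open>simp_all add: poisson_manifold_def\<close>)
  interpret N: poisson_mfd N \<pi>\<^sub>N
    by unfold_locales (use assms in \<open>simp_all add: poisson_manifold_def\<close>)
  have \<phi>: "smooth_map M N \<phi>" using assms(5) by (simp add: poisson_map_def)
  note comp = smooth_map_compose[OF M' N' \<phi>]
  let ?d = "coboundary0 M \<pi>\<^sub>M N \<phi>"
  let ?X = "relative_modular_field M \<pi>\<^sub>M N \<pi>\<^sub>N \<phi>"
  let ?cls = "cohomology_class M \<pi>\<^sub>M N \<pi>\<^sub>N \<phi>"
  let ?XM = "modular_vector_field M \<pi>\<^sub>M" and ?XN = "modular_vector_field N \<pi>\<^sub>N"
  have d_lin: "?d (\<lambda>y. a * h y + b * k y) x f = a * ?d h x f + b * ?d k x f"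
    if "h \<in> smooth_functions M" "k \<in> smooth_functions M" for h k a b x f
    by (simp add: coboundary0_def tangent_map_def M.hamiltonian_lincomb[OF that])
  have ham_related: "N.ham k (\<phi> x) f = M.ham (k \<circ> \<phi>) x (f \<circ> \<phi>)"
    if k: "k \<in> smooth_functions N" and f: "f \<in> smooth_functions N" for k f x
  proof -
    have "poisson_bracket M \<pi>\<^sub>M (k \<circ> \<phi>) (f \<circ> \<phi>) x = (poisson_bracket N \<pi>\<^sub>N k f \<circ> \<phi>) x"
      using assms(5) k f unfolding poisson_map_def by metis
    then show ?thesis
      unfolding N.hamiltonian_apply[OF f] M.hamiltonian_apply[OF comp[OF f]] by (simp add: poisson_bracket_def)
  qed
  \<comment> \<open>The equalities below are equalities of HOL functions and must be checked at
    non-smooth f too, where tangent vectors take the value 0.\<close>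
  have XN_nonsmooth: "?XN \<nu> y f = 0" if "\<nu> \<in> volume_forms N" "f \<notin> smooth_functions N" for \<nu> y f
    by (simp add: N.modular_vector_field_eq[OF that(1)] that(2))
  \<comment> \<open>Two representatives differing by the coboundary of k have the same coset: a
    primitive h relative to one becomes h + k or h - k relative to the other.\<close>
  have cls_shift: "?cls P' = ?cls P"
    if k: "k \<in> smooth_functions M" and P': "\<And>x f. P' x f = P x f + ?d k x f" for P P' k
  proof -
    have "(\<exists>h\<in>smooth_functions M. \<forall>x f. Q x f - P' x f = ?d h x f) \<longleftrightarrow>
        (\<exists>h\<in>smooth_functions M. \<forall>x f. Q x f - P x f = ?d h x f)" for Q
    proof
      assume "\<exists>h\<in>smooth_functions M. \<forall>x f. Q x f - P' x f = ?d h x f"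
      then obtain h where h: "h \<in> smooth_functions M" "\<And>x f. Q x f - P' x f = ?d h x f" by blast
      have "Q x f - P x f = ?d (\<lambda>y. 1 * h y + 1 * k y) x f" for x f
        unfolding d_lin[OF h(1) k] using h(2)[of x f] P'[of x f] by linarith
      then show "\<exists>h\<in>smooth_functions M. \<forall>x f. Q x f - P x f = ?d h x f"
        using M.smooth_lincomb[OF h(1) k] by blast
    next
      assume "\<exists>h\<in>smooth_functions M. \<forall>x f. Q x f - P x f = ?d h x f"
      then obtain h where h: "h \<in> smooth_functions M" "\<And>x f. Q x f - P x f = ?d h x f" by blast
      have "Q x f - P' x f = ?d (\<lambda>y. 1 * h y + (-1) * k y) x f" for x f
        unfolding d_lin[OF h(1) k] using h(2)[of x f] P'[of x f] by linarith
      then show "\<exists>h\<in>smooth_functions M. \<forall>x f. Q x f - P' x f = ?d h x f"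
        using M.smooth_lincomb[OF h(1) k] by blast
    qed
    then show ?thesis unfolding cohomology_class_def by simp
  qed
  have cls_indep: "?cls (?X \<mu>' \<nu>') = ?cls (?X \<mu> \<nu>)"
    if v: "\<mu> \<in> volume_forms M" "\<mu>' \<in> volume_forms M" "\<nu> \<in> volume_forms N" "\<nu>' \<in> volume_forms N" for \<mu> \<mu>' \<nu> \<nu>'
  proof -
    obtain h where h: "h \<in> smooth_functions M" "?XM \<mu>' = (\<lambda>x f. ?XM \<mu> x f - M.ham h x f)"
      using v(1,2) by (rule M.modular_vector_field_change)
    obtain k where k: "k \<in> smooth_functions N" "?XN \<nu>' = (\<lambda>x f. ?XN \<nu> x f - N.ham k x f)"
      using v(3,4) by (rule N.modular_vector_field_change)
    show ?thesis
    \<comment> \<open>The change of \<mu> contributes - d\<phi> X_h, the coboundary of h; the change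
      of \<nu> contributes + X_k along \<phi>, minus the coboundary of k after \<phi>. Hence the
      coefficients 1 and -1.\<close>
    proof (rule cls_shift[OF M.smooth_lincomb[OF h(1) comp[OF k(1)]]])
      fix x f
      show "?X \<mu>' \<nu>' x f = ?X \<mu> \<nu> x f + ?d (\<lambda>y. 1 * h y + (-1) * (k \<circ> \<phi>) y) x f"
      proof (cases "f \<in> smooth_functions N")
        case f: True
        show ?thesis
          unfolding d_lin[OF h(1) comp[OF k(1)]] relative_modular_field_def h(2) k(2)
          by (simp add: coboundary0_def tangent_map_def f ham_related[OF k(1) f])
      next
        case False
        then show ?thesis
          by (simp add: relative_modular_field_def tangent_map_def coboundary0_def XN_nonsmooth v)
      qed
    qed
  qed
  obtain \<mu> \<nu> where v: "\<mu> \<in> volume_forms M" "\<nu> \<in> volume_forms N"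
    using assms(2,4) by (auto simp: orientable_manifold_def)
  \<comment> \<open>Independence gives a class that serves for all pairs of volume forms at once;
    the pair at hand then forces its uniqueness.\<close>
  have mod: "modular_class M \<pi>\<^sub>M N \<pi>\<^sub>N \<phi> = ?cls (?X \<mu>' \<nu>')"
    if v': "\<mu>' \<in> volume_forms M" "\<nu>' \<in> volume_forms N" for \<mu>' \<nu>'
    unfolding modular_class_def
  proof (rule the_equality)
    show "\<forall>\<mu>\<in>volume_forms M. \<forall>\<nu>\<in>volume_forms N. ?cls (?X \<mu>' \<nu>') = ?cls (?X \<mu> \<nu>)"
      using cls_indep v' by blast
  qed (use v' in blast)
  show ?thesis
  proof
    assume "modular_class M \<pi>\<^sub>M N \<pi>\<^sub>N \<phi> = zero_cohomology_class M \<pi>\<^sub>M N \<pi>\<^sub>N \<phi>"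
    \<comment> \<open>The common element of the two classes: its membership in the class of
      X_{\<mu>,\<nu>} is what produces the function h.\<close>
    moreover have "(\<lambda>x f. 0) \<in> zero_cohomology_class M \<pi>\<^sub>M N \<pi>\<^sub>N \<phi>"
    proof -
      \<comment> \<open>Linearity with zero coefficients shows that the coboundary of the zero
        function is 0.\<close>
      have "?d (\<lambda>y. 0 * 0 + 0 * 0) x f = 0 * ?d (\<lambda>y. 0) x f + 0 * ?d (\<lambda>y. 0) x f" for x f
        by (rule d_lin[OF M.smooth_const M.smooth_const])
      then have "(0::real) - 0 = ?d (\<lambda>y. 0) x f" for x f by simp
      then show ?thesis
        unfolding zero_cohomology_class_def cohomology_class_def
        using zero_cocycle[OF assms(1,3) \<phi>] M.smooth_const[of 0] by blast
    qed
    ultimately have "(\<lambda>x f. 0) \<in> ?cls (?X \<mu> \<nu>)" by (simp add: mod[OF v])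
    then obtain h where h: "h \<in> smooth_functions M" "\<And>x f. 0 - ?X \<mu> \<nu> x f = ?d h x f"
      unfolding cohomology_class_def by blast
    let ?\<mu>' = "\<lambda>x v. exp (h x) * \<mu> x v"
    have "tangent_map N \<phi> (?XM ?\<mu>' x) f = ?XN \<nu> (\<phi> x) f" for x f
    proof (cases "f \<in> smooth_functions N")
      case f: True
      show ?thesis
        using h(2)[of x f] f
        by (simp add: M.modular_vector_field_exp[OF v(1) h(1)] relative_modular_field_def
            coboundary0_def tangent_map_def)
    next
      case False
      then show ?thesis by (simp add: tangent_map_def XN_nonsmooth v)
    qed
    then have "(\<lambda>x. tangent_map N \<phi> (?XM ?\<mu>' x)) = ?XN \<nu> \<circ> \<phi>"
      by (intro ext) simp
    then show "\<exists>\<mu>\<in>volume_forms M. \<exists>\<nu>\<in>volume_forms N.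
       (\<lambda>x. tangent_map N \<phi> (?XM \<mu> x)) = ?XN \<nu> \<circ> \<phi>"
      using M.volume_forms_scale_exp[OF v(1) h(1)] v(2) by blast
  next
    assume "\<exists>\<mu>\<in>volume_forms M. \<exists>\<nu>\<in>volume_forms N.
       (\<lambda>x. tangent_map N \<phi> (?XM \<mu> x)) = ?XN \<nu> \<circ> \<phi>"
    then obtain \<mu>' \<nu>' where v': "\<mu>' \<in> volume_forms M" "\<nu>' \<in> volume_forms N"
      and eq: "(\<lambda>x. tangent_map N \<phi> (?XM \<mu>' x)) = ?XN \<nu>' \<circ> \<phi>" by blast
    have "?X \<mu>' \<nu>' = (\<lambda>x f. 0)"
      using fun_cong[OF eq] by (intro ext) (simp add: relative_modular_field_def)
    then show "modular_class M \<pi>\<^sub>M N \<pi>\<^sub>N \<phi> = zero_cohomology_class M \<pi>\<^sub>M N \<pi>\<^sub>N \<phi>"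
      by (simp add: mod[OF v'] zero_cohomology_class_def)
  qed
qed

end
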